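(* Let $(X,d)$ be an extended metric space with bounded geometry. Then the following conditions are equivalent: (1) $(X,d)$ is properly amenable. (2) The algebraic uniform Roe algebra $C^*_{\mathrm{u,alg}}(X)$ is properly algebraically amenable. (3) The uniform Roe algebra $C^*_{\mathrm{u}}(X)$ is a properly Følner $C^*$-algebra.
   Context: Extended metric spaces: metrics $d\colon X\times X\to[0,\infty]$ may take the value $\infty$. $(X,d)$ has bounded geometry if it is uniformly discrete (there is $C>0$ with $d(x,y)\ge C$ for all $x\ne y$) and $\sup_{x\in X}|B_R(x)|<\infty$ for every $R>0$, where $B_R(x)=\{y: d(x,y)\le R\}$. Proper amenability of $(X,d)$: for $A\subset X$ and $R>0$ let $\partial_RA=\{x\in X: d(x,A)\le R \text{ and } d(x,X\setminus A)\le R\}$ (the distance to the empty set is $\infty$). $(X,d)$ is properly amenable if for all $R>0$, $\varepsilon>0$ and every finite $A\subset X$ there is a finite non-empty $F\subset X$ with $A\subset F$ and $|\partial_RF|\le\varepsilon|F|$. Roe algebras: a partial translation on $X$ is a bijection $t\colon A\to B$ between subsets of $X$ with $\sup_{x\in A}d(x,t(x))<\infty$; it defines $V_t\in\mathcal{L}(\ell^2(X))$ by $V_t\delta_x=\delta_{t(x)}$ for $x\in A$ and $V_t\delta_x=0$ otherwise. $C^*_{\mathrm{u,alg}}(X)$ is the unital $*$-subalgebra of $\mathcal{L}(\ell^2(X))$ generated by all $V_t$ and $\ell^\infty(X)$ (diagonal operators); $C^*_{\mathrm{u}}(X)$ is its norm closure in $\mathcal{L}(\ell^2(X))$. Proper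 algebraic amenability: a complex algebra $\mathcal{B}$ is (left) properly algebraically amenable if for every $\varepsilon>0$ and finite $\mathcal{F}\subset\mathcal{B}$ there is a nonzero finite-dimensional linear subspace $W\subset\mathcal{B}$ with $\mathcal{F}\subset W$ and $\dim(aW+W)\le(1+\varepsilon)\dim W$ for all $a\in\mathcal{F}$. Properly Følner: a unital $C^*$-algebra $\mathcal{A}$ is properly Følner if for any finite $\mathcal{F}\subset\mathcal{A}$ and $\varepsilon>0$ there exist a cyclic unital $*$-representation $\pi\colon\mathcal{A}\to\mathcal{L}(\mathcal{H})$ with cyclic vector $\Omega$ and a nonzero finite rank orthogonal projection $P\in\mathcal{L}(\mathcal{H})$ with $\|\pi(T)P-P\pi(T)\|_2\le\varepsilon\|P\|_2$ for all $T\in\mathcal{F}$ ($\|\cdot\|_2$ the Hilbert–Schmidt norm), such that the linear map $\mathrm{span}\,\mathcal{F}\to\mathcal{H}$, $A\mapsto P\pi(A)\Omega$, is injective. *)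

theory Defs
  imports "HOL-Analysis.Analysis" "HOL-Library.Function_Algebras"
begin

section \<open>Complex vector spaces\<close>

class scaleC =
  fixes scaleC :: "complex \<Rightarrow> 'a \<Rightarrow> 'a"  (infixr \<open>*\<^sub>C\<close> 75)

class complex_vector = scaleC + ab_group_add +
  assumes scaleC_add_right: "c *\<^sub>C (x + y) = c *\<^sub>C x + c *\<^sub>C y"
    and scaleC_add_left: "(b + c) *\<^sub>C x = b *\<^sub>C x + c *\<^sub>C x"
    and scaleC_scaleC: "b *\<^sub>C c *\<^sub>C x = (b * c) *\<^sub>C x"
    and scaleC_one: "1 *\<^sub>C x = x"

global_interpretation cvs: vector_space "scaleC :: complex \<Rightarrow> 'v \<Rightarrow> 'v::complex_vector"
  by standard (simp_all add: scaleC_add_right scaleC_add_left scaleC_scaleC scaleC_one)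

instantiation complex :: complex_vector
begin
definition scaleC_complex :: "complex \<Rightarrow> complex \<Rightarrow> complex" where "scaleC_complex c z = c * z"
instance by standard (simp_all add: scaleC_complex_def algebra_simps)
end

instantiation "fun" :: (type, complex_vector) complex_vector
begin
definition scaleC_fun :: "complex \<Rightarrow> ('a \<Rightarrow> 'b) \<Rightarrow> 'a \<Rightarrow> 'b"
  where "scaleC_fun c f = (\<lambda>x. c *\<^sub>C f x)"
instance
  by standard (simp_all add: scaleC_fun_def fun_eq_iff scaleC_add_right scaleC_add_left
      scaleC_scaleC scaleC_one)
end

lemma scaleC_fun_apply [simp]: "(c *\<^sub>C f) x = c *\<^sub>C f x"
  by (simp add: scaleC_fun_def)

definition finite_dimensional :: "'v::complex_vector set \<Rightarrow> bool" where
  "finite_dimensional W \<longleftrightarrow> (\<exists>B. finite B \<and> W \<subseteq> cvs.span B)"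


section \<open>Algebras and proper algebraic amenability\<close>

text \<open>
  The linear structure of an algebra is that of the ambient type; the carrier is a linear
  subspace of it.
\<close>

record 'b complex_algebra =
  carr :: "'b set"
  mul :: "'b \<Rightarrow> 'b \<Rightarrow> 'b"

record 'b star_algebra = "'b complex_algebra" +
  unit :: "'b"
  star :: "'b \<Rightarrow> 'b"

definition properly_alg_amenable :: "('b::complex_vector, 'm) complex_algebra_scheme \<Rightarrow> bool" where
  "properly_alg_amenable \<B> \<longleftrightarrow>
    (\<forall>\<epsilon>::real. \<forall>F. \<epsilon> > 0 \<and> finite F \<and> F \<subseteq> carr \<B> \<longrightarrow>
      (\<exists>W. cvs.subspace W \<and> W \<subseteq> carr \<B> \<and> finite_dimensional W \<and> W \<noteq> {0} \<and> F \<subseteq> W \<and>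
        (\<forall>a\<in>F. real (cvs.dim {mul \<B> a v + w |v w. v \<in> W \<and> w \<in> W})
                 \<le> (1 + \<epsilon>) * real (cvs.dim W))))"

definition unital_star_subalgebra :: "('b::complex_vector) star_algebra \<Rightarrow> 'b set \<Rightarrow> bool" where
  "unital_star_subalgebra \<A> S \<longleftrightarrow>
    S \<subseteq> carr \<A> \<and> cvs.subspace S \<and> unit \<A> \<in> S \<and>
    (\<forall>a\<in>S. \<forall>b\<in>S. mul \<A> a b \<in> S) \<and> (\<forall>a\<in>S. star \<A> a \<in> S)"


section \<open>Hilbert spaces and bounded operators\<close>

text \<open>
  A Hilbert space is a linear subspace \<open>H\<close> of a complex vector space together with a form \<open>ip\<close>,
  linear in its first argument, which makes \<open>H\<close> complete.
\<close>

definition vnorm :: "('v \<Rightarrow> 'v \<Rightarrow> complex) \<Rightarrow> 'v \<Rightarrow> real" where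
  "vnorm ip x = sqrt (Re (ip x x))"

locale complex_hilbert_space =
  fixes H :: "'v::complex_vector set" and ip :: "'v \<Rightarrow> 'v \<Rightarrow> complex"
  assumes subspace: "cvs.subspace H"
    and ip_add_left: "\<lbrakk>x \<in> H; y \<in> H; z \<in> H\<rbrakk> \<Longrightarrow> ip (x + y) z = ip x z + ip y z"
    and ip_scale_left: "\<lbrakk>x \<in> H; y \<in> H\<rbrakk> \<Longrightarrow> ip (c *\<^sub>C x) y = c * ip x y"
    and ip_commute: "\<lbrakk>x \<in> H; y \<in> H\<rbrakk> \<Longrightarrow> ip y x = cnj (ip x y)"
    and ip_nonneg: "x \<in> H \<Longrightarrow> 0 \<le> Re (ip x x)"
    and ip_definite: "\<lbrakk>x \<in> H; ip x x = 0\<rbrakk> \<Longrightarrow> x = 0"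
    and complete: "\<lbrakk>\<forall>n. s n \<in> H; \<forall>e>0. \<exists>N. \<forall>m\<ge>N. \<forall>n\<ge>N. vnorm ip (s m - s n) < e\<rbrakk>
      \<Longrightarrow> \<exists>l\<in>H. (\<lambda>n::nat. vnorm ip (s n - l)) \<longlonglongrightarrow> 0"

text \<open>
  Operators on \<open>H\<close> are total functions on the ambient type; they are normalised to vanish
  outside \<open>H\<close>, so that equality of functions is equality of operators on \<open>H\<close>.
\<close>

definition bounded_operators :: "'v::complex_vector set \<Rightarrow> ('v \<Rightarrow> 'v \<Rightarrow> complex) \<Rightarrow> ('v \<Rightarrow> 'v) set" where
  "bounded_operators H ip = {T.
     (\<forall>x\<in>H. T x \<in> H) \<and> (\<forall>x. x \<notin> H \<longrightarrow> T x = 0) \<and>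
     (\<forall>x\<in>H. \<forall>y\<in>H. T (x + y) = T x + T y) \<and> (\<forall>c. \<forall>x\<in>H. T (c *\<^sub>C x) = c *\<^sub>C T x) \<and>
     (\<exists>K. \<forall>x\<in>H. vnorm ip (T x) \<le> K * vnorm ip x)}"

definition op_norm :: "'v::complex_vector set \<Rightarrow> ('v \<Rightarrow> 'v \<Rightarrow> complex) \<Rightarrow> ('v \<Rightarrow> 'v) \<Rightarrow> real" where
  "op_norm H ip T = (SUP x\<in>{x\<in>H. vnorm ip x \<le> 1}. vnorm ip (T x))"

definition id_op :: "'v::complex_vector set \<Rightarrow> 'v \<Rightarrow> 'v" where
  "id_op H = (\<lambda>x. if x \<in> H then x else 0)"

definition is_adjoint ::
    "'v::complex_vector set \<Rightarrow> ('v \<Rightarrow> 'v \<Rightarrow> complex) \<Rightarrow> ('v \<Rightarrow> 'v) \<Rightarrow> ('v \<Rightarrow> 'v) \<Rightarrow> bool" where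
  "is_adjoint H ip T S \<longleftrightarrow> (\<forall>x\<in>H. \<forall>y\<in>H. ip (T x) y = ip x (S y))"

definition adjoint_op ::
    "'v::complex_vector set \<Rightarrow> ('v \<Rightarrow> 'v \<Rightarrow> complex) \<Rightarrow> ('v \<Rightarrow> 'v) \<Rightarrow> 'v \<Rightarrow> 'v" where
  "adjoint_op H ip T = (THE S. S \<in> bounded_operators H ip \<and> is_adjoint H ip T S)"

definition operator_algebra ::
    "'v::complex_vector set \<Rightarrow> ('v \<Rightarrow> 'v \<Rightarrow> complex) \<Rightarrow> ('v \<Rightarrow> 'v) star_algebra" where
  "operator_algebra H ip =
    \<lparr>carr = bounded_operators H ip, mul = (\<circ>), unit = id_op H, star = adjoint_op H ip\<rparr>"

definition operator_norm_closure ::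
    "'v::complex_vector set \<Rightarrow> ('v \<Rightarrow> 'v \<Rightarrow> complex) \<Rightarrow> ('v \<Rightarrow> 'v) set \<Rightarrow> ('v \<Rightarrow> 'v) set" where
  "operator_norm_closure H ip \<S> =
    {T \<in> bounded_operators H ip. \<forall>e>0. \<exists>S\<in>\<S>. op_norm H ip (T - S) < e}"

definition orthonormal_basis ::
    "'v::complex_vector set \<Rightarrow> ('v \<Rightarrow> 'v \<Rightarrow> complex) \<Rightarrow> 'v set \<Rightarrow> bool" where
  "orthonormal_basis H ip E \<longleftrightarrow>
    E \<subseteq> H \<and> (\<forall>e\<in>E. \<forall>f\<in>E. ip e f = (if e = f then 1 else 0)) \<and>
    (\<forall>x\<in>H. \<forall>\<delta>>0. \<exists>y\<in>cvs.span E. vnorm ip (x - y) < \<delta>)"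

text \<open>
  The Hilbert--Schmidt norm is the common value, for all orthonormal bases \<open>E\<close>, of the square
  root of the sum of all \<open>\<parallel>T e\<parallel>\<^sup>2\<close>. Since \<open>infsum\<close> is \<open>0\<close> for divergent sums, this is only
  meaningful for Hilbert--Schmidt operators; below it is applied to finite rank operators only.
\<close>

definition hs_norm :: "'v::complex_vector set \<Rightarrow> ('v \<Rightarrow> 'v \<Rightarrow> complex) \<Rightarrow> ('v \<Rightarrow> 'v) \<Rightarrow> real" where
  "hs_norm H ip T =
    (THE r. \<forall>E. orthonormal_basis H ip E \<longrightarrow> r = sqrt (\<Sum>\<^sub>\<infinity>e\<in>E. (vnorm ip (T e))\<^sup>2))"

definition finite_rank_projection ::
    "'v::complex_vector set \<Rightarrow> ('v \<Rightarrow> 'v \<Rightarrow> complex) \<Rightarrow> ('v \<Rightarrow> 'v) \<Rightarrow> bool" where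
  "finite_rank_projection H ip P \<longleftrightarrow>
    P \<in> bounded_operators H ip \<and> P \<circ> P = P \<and> is_adjoint H ip P P \<and> finite_dimensional (P ` H)"


section \<open>Representations and properly Foelner algebras\<close>

definition unital_star_rep ::
    "('b::complex_vector) star_algebra \<Rightarrow> 'v::complex_vector set \<Rightarrow> ('v \<Rightarrow> 'v \<Rightarrow> complex)
      \<Rightarrow> ('b \<Rightarrow> 'v \<Rightarrow> 'v) \<Rightarrow> bool" where
  "unital_star_rep \<A> H ip \<pi> \<longleftrightarrow>
    complex_hilbert_space H ip \<and>
    (\<forall>a\<in>carr \<A>. \<pi> a \<in> bounded_operators H ip) \<and>
    (\<forall>a\<in>carr \<A>. \<forall>b\<in>carr \<A>. \<pi> (a + b) = \<pi> a + \<pi> b) \<and>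
    (\<forall>c. \<forall>a\<in>carr \<A>. \<pi> (c *\<^sub>C a) = c *\<^sub>C \<pi> a) \<and>
    (\<forall>a\<in>carr \<A>. \<forall>b\<in>carr \<A>. \<pi> (mul \<A> a b) = \<pi> a \<circ> \<pi> b) \<and>
    (\<forall>a\<in>carr \<A>. is_adjoint H ip (\<pi> a) (\<pi> (star \<A> a))) \<and>
    \<pi> (unit \<A>) = id_op H"

definition cyclic_vector ::
    "('b::complex_vector) star_algebra \<Rightarrow> 'v::complex_vector set \<Rightarrow> ('v \<Rightarrow> 'v \<Rightarrow> complex)
      \<Rightarrow> ('b \<Rightarrow> 'v \<Rightarrow> 'v) \<Rightarrow> 'v \<Rightarrow> bool" where
  "cyclic_vector \<A> H ip \<pi> \<Omega> \<longleftrightarrow>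
    \<Omega> \<in> H \<and> (\<forall>x\<in>H. \<forall>\<delta>>0. \<exists>a\<in>carr \<A>. vnorm ip (x - \<pi> a \<Omega>) < \<delta>)"

definition proper_foelner_data ::
    "('b::complex_vector) star_algebra \<Rightarrow> 'b set \<Rightarrow> real \<Rightarrow> 'v::complex_vector set
      \<Rightarrow> ('v \<Rightarrow> 'v \<Rightarrow> complex) \<Rightarrow> ('b \<Rightarrow> 'v \<Rightarrow> 'v) \<Rightarrow> 'v \<Rightarrow> ('v \<Rightarrow> 'v) \<Rightarrow> bool" where
  "proper_foelner_data \<A> F \<epsilon> H ip \<pi> \<Omega> P \<longleftrightarrow>
    unital_star_rep \<A> H ip \<pi> \<and> cyclic_vector \<A> H ip \<pi> \<Omega> \<and>
    finite_rank_projection H ip P \<and> P \<noteq> 0 \<and>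
    (\<forall>T\<in>F. hs_norm H ip ((\<pi> T \<circ> P) - (P \<circ> \<pi> T)) \<le> \<epsilon> * hs_norm H ip P) \<and>
    inj_on (\<lambda>a. P (\<pi> a \<Omega>)) (cvs.span F)"

text \<open>
  HOL cannot quantify existentially over types, so \<open>H\<close> ranges over all Hilbert spaces whose
  underlying vector space is a linear subspace of \<open>'b \<Rightarrow> complex\<close> (with an arbitrary inner product).
  This is no restriction: if \<open>\<Omega>\<close> is cyclic for \<open>\<pi>\<close> then \<open>\<xi> \<mapsto> (\<lambda>a. \<langle>\<xi>, \<pi> a \<Omega>\<rangle>)\<close> embeds the given
  Hilbert space into this function space; see \<open>properly_foelner_universe\<close> below.
\<close>

definition properly_foelner :: "('b::complex_vector) star_algebra \<Rightarrow> bool" where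
  "properly_foelner \<A> \<longleftrightarrow>
    (\<forall>F \<epsilon>. finite F \<and> F \<subseteq> carr \<A> \<and> \<epsilon> > 0 \<longrightarrow>
      (\<exists>(H :: ('b \<Rightarrow> complex) set) ip \<pi> \<Omega> P. proper_foelner_data \<A> F \<epsilon> H ip \<pi> \<Omega> P))"


subsection \<open>Independence of the choice of the universe\<close>

lemma linear_image_span:
  fixes U :: "'v::complex_vector \<Rightarrow> 'w::complex_vector"
  assumes H: "cvs.subspace H" and E: "E \<subseteq> H"
    and add: "\<And>x y. x \<in> H \<Longrightarrow> y \<in> H \<Longrightarrow> U (x + y) = U x + U y"
    and scale: "\<And>c x. x \<in> H \<Longrightarrow> U (c *\<^sub>C x) = c *\<^sub>C U x"
    and y: "y \<in> cvs.span E"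
  shows "y \<in> H \<and> U y \<in> cvs.span (U ` E)"
proof -
  have U0: "U 0 = 0"
    using scale[of 0 0] cvs.subspace_0[OF H] by simp
  have "cvs.subspace {y. y \<in> H \<and> U y \<in> cvs.span (U ` E)}"
    unfolding cvs.subspace_def
    using H by (auto simp: U0 add scale cvs.subspace_0 cvs.subspace_add cvs.subspace_scale
        cvs.span_zero cvs.span_add cvs.span_scale)
  from cvs.span_induct[OF y this] show ?thesis
    using E by (auto intro: cvs.span_base)
qed

locale hilbert_transport = complex_hilbert_space H ip
  for H :: "'v::complex_vector set" and ip +
  fixes U :: "'v \<Rightarrow> 'w::complex_vector"
  assumes U_add: "\<And>x y. x \<in> H \<Longrightarrow> y \<in> H \<Longrightarrow> U (x + y) = U x + U y"
    and U_scale: "\<And>c x. x \<in> H \<Longrightarrow> U (c *\<^sub>C x) = c *\<^sub>C U x"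
    and U_inj: "inj_on U H"
begin

definition "V = inv_into H U"
definition "H' = U ` H"
definition "ip' = (\<lambda>f g. ip (V f) (V g))"
definition "lift T = (\<lambda>f. if f \<in> H' then U (T (V f)) else 0)"

lemma VU [simp]: "x \<in> H \<Longrightarrow> V (U x) = x"
  by (simp add: V_def U_inj)

lemma UV [simp]: "f \<in> H' \<Longrightarrow> U (V f) = f"
  by (auto simp: H'_def)

lemma V_in [simp]: "f \<in> H' \<Longrightarrow> V f \<in> H"
  by (auto simp: H'_def)

lemma U_in [simp]: "x \<in> H \<Longrightarrow> U x \<in> H'"
  by (auto simp: H'_def)

lemma H_closed [simp]:
  "0 \<in> H" "x \<in> H \<Longrightarrow> y \<in> H \<Longrightarrow> x + y \<in> H" "x \<in> H \<Longrightarrow> y \<in> H \<Longrightarrow> x - y \<in> H" "x \<in> H \<Longrightarrow> c *\<^sub>C x \<in> H"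
  using subspace by (simp_all add: cvs.subspace_0 cvs.subspace_add cvs.subspace_diff cvs.subspace_scale)

lemma U_0 [simp]: "U 0 = 0"
  using U_scale[of 0 0] by simp

lemma U_diff: "x \<in> H \<Longrightarrow> y \<in> H \<Longrightarrow> U (x - y) = U x - U y"
  using U_add[of "x - y" y] by (simp add: eq_diff_eq)

lemma subspace': "cvs.subspace H'"
proof -
  have "0 \<in> H'" using U_in[of 0] by simp
  moreover have "f + g \<in> H'" if "f \<in> H'" "g \<in> H'" for f g
    using U_in[of "V f + V g"] U_add[of "V f" "V g"] that by simp
  moreover have "c *\<^sub>C f \<in> H'" if "f \<in> H'" for c f
    using U_in[of "c *\<^sub>C V f"] U_scale[of "V f" c] that by simp
  ultimately show ?thesis by (simp add: cvs.subspace_def)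
qed

lemma H'_closed [simp]:
  "0 \<in> H'" "x \<in> H' \<Longrightarrow> y \<in> H' \<Longrightarrow> x + y \<in> H'" "x \<in> H' \<Longrightarrow> y \<in> H' \<Longrightarrow> x - y \<in> H'"
  "x \<in> H' \<Longrightarrow> c *\<^sub>C x \<in> H'"
  using subspace' by (simp_all add: cvs.subspace_0 cvs.subspace_add cvs.subspace_diff cvs.subspace_scale)

lemma V_add: "f \<in> H' \<Longrightarrow> g \<in> H' \<Longrightarrow> V (f + g) = V f + V g"
  using VU[of "V f + V g"] U_add[of "V f" "V g"] by simp

lemma V_diff: "f \<in> H' \<Longrightarrow> g \<in> H' \<Longrightarrow> V (f - g) = V f - V g"
  using VU[of "V f - V g"] U_diff[of "V f" "V g"] by simp

lemma V_scale: "f \<in> H' \<Longrightarrow> V (c *\<^sub>C f) = c *\<^sub>C V f"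
  using VU[of "c *\<^sub>C V f"] U_scale[of "V f" c] by simp

lemma V_0 [simp]: "V 0 = 0"
  using VU[of 0] by simp

lemma vnorm': "vnorm ip' f = vnorm ip (V f)"
  by (simp add: vnorm_def ip'_def)

lemma hilbert': "complex_hilbert_space H' ip'"
proof
  show "cvs.subspace H'" by (rule subspace')
next
  fix s :: "nat \<Rightarrow> 'w"
  assume s: "\<forall>n. s n \<in> H'" and c: "\<forall>e>0. \<exists>N. \<forall>m\<ge>N. \<forall>n\<ge>N. vnorm ip' (s m - s n) < e"
  have "\<exists>l\<in>H. (\<lambda>n. vnorm ip (V (s n) - l)) \<longlonglongrightarrow> 0"
    by (rule complete) (use s c in \<open>simp_all add: vnorm' V_diff\<close>)
  then obtain l where l: "l \<in> H" "(\<lambda>n. vnorm ip (V (s n) - l)) \<longlonglongrightarrow> 0" by blast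
  have "vnorm ip' (s n - U l) = vnorm ip (V (s n) - l)" for n
    using s l(1) by (simp add: vnorm' V_diff)
  then show "\<exists>l\<in>H'. (\<lambda>n. vnorm ip' (s n - l)) \<longlonglongrightarrow> 0"
    using l by (intro bexI[of _ "U l"]) simp_all
next
  fix f assume "f \<in> H'" "ip' f f = 0"
  then have "V f = 0" by (intro ip_definite) (simp_all add: ip'_def)
  then show "f = 0" using UV[OF \<open>f \<in> H'\<close>] by simp
next
  fix f g assume "f \<in> H'" "g \<in> H'"
  then show "ip' g f = cnj (ip' f g)"
    unfolding ip'_def by (intro ip_commute) simp_all
qed (simp_all add: ip'_def V_add V_scale ip_add_left ip_scale_left ip_nonneg)

lemma bounded_operatorsD:
  assumes "T \<in> bounded_operators H ip"
  shows "x \<in> H \<Longrightarrow> T x \<in> H" "x \<notin> H \<Longrightarrow> T x = 0"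
    "x \<in> H \<Longrightarrow> y \<in> H \<Longrightarrow> T (x + y) = T x + T y" "x \<in> H \<Longrightarrow> T (c *\<^sub>C x) = c *\<^sub>C T x" "T 0 = 0"
proof -
  show *: "x \<in> H \<Longrightarrow> T (c *\<^sub>C x) = c *\<^sub>C T x" for c x
    using assms by (simp add: bounded_operators_def)
  show "T 0 = 0" using *[of 0 0] by simp
qed (use assms in \<open>simp_all add: bounded_operators_def\<close>)

lemma lift_bounded:
  assumes T: "T \<in> bounded_operators H ip"
  shows "lift T \<in> bounded_operators H' ip'"
proof -
  obtain K where "\<forall>x\<in>H. vnorm ip (T x) \<le> K * vnorm ip x"
    using T by (auto simp: bounded_operators_def)
  then have "\<forall>f\<in>H'. vnorm ip' (lift T f) \<le> K * vnorm ip' f"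
    by (simp add: vnorm' lift_def bounded_operatorsD[OF T])
  then show ?thesis
    by (auto simp: bounded_operators_def lift_def bounded_operatorsD[OF T] V_add V_scale U_add U_scale)
qed

lemma lift_apply: "x \<in> H \<Longrightarrow> lift T (U x) = U (T x)"
  by (simp add: lift_def)

lemma lift_comp:
  assumes "T \<in> bounded_operators H ip" "S \<in> bounded_operators H ip"
  shows "lift (T \<circ> S) = lift T \<circ> lift S"
  by (rule ext) (simp add: lift_def bounded_operatorsD[OF assms(1)] bounded_operatorsD[OF assms(2)])

lemma lift_add:
  assumes "T \<in> bounded_operators H ip" "S \<in> bounded_operators H ip"
  shows "lift (T + S) = lift T + lift S"
  by (rule ext)
    (simp add: lift_def U_add bounded_operatorsD[OF assms(1)] bounded_operatorsD[OF assms(2)])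

lemma lift_diff:
  assumes "\<And>x. x \<in> H \<Longrightarrow> T x \<in> H" "\<And>x. x \<in> H \<Longrightarrow> S x \<in> H"
  shows "lift (T - S) = lift T - lift S"
  by (rule ext) (simp add: lift_def U_diff assms)

lemma lift_scale:
  assumes "T \<in> bounded_operators H ip"
  shows "lift (c *\<^sub>C T) = c *\<^sub>C lift T"
  by (rule ext) (simp add: lift_def U_scale bounded_operatorsD[OF assms])

lemma lift_id: "lift (id_op H) = id_op H'"
  by (rule ext) (simp add: lift_def id_op_def)

lemma lift_adjoint:
  assumes "T \<in> bounded_operators H ip" "S \<in> bounded_operators H ip" "is_adjoint H ip T S"
  shows "is_adjoint H' ip' (lift T) (lift S)"
  using assms(3)
  by (simp add: is_adjoint_def lift_def ip'_def bounded_operatorsD[OF assms(1)]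
      bounded_operatorsD[OF assms(2)])

lemma onb_image:
  assumes E: "orthonormal_basis H ip E"
  shows "orthonormal_basis H' ip' (U ` E)"
proof -
  have EH: "E \<subseteq> H" using E by (simp add: orthonormal_basis_def)
  have "\<exists>y\<in>cvs.span (U ` E). vnorm ip' (f - y) < \<delta>" if f: "f \<in> H'" and "\<delta> > 0" for f \<delta>
  proof -
    obtain y where y: "y \<in> cvs.span E" "vnorm ip (V f - y) < \<delta>"
      using E V_in[OF f] \<open>\<delta> > 0\<close> unfolding orthonormal_basis_def by blast
    have "y \<in> H \<and> U y \<in> cvs.span (U ` E)"
      by (rule linear_image_span[OF subspace EH U_add U_scale y(1)])
    then show ?thesis using y(2) f by (intro bexI[of _ "U y"]) (simp_all add: vnorm' V_diff)
  qed
  moreover have "ip' (U e) (U f) = (if U e = U f then 1 else 0)" if "e \<in> E" "f \<in> E" for e f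
    using E EH that inj_on_eq_iff[OF U_inj, of e f]
    by (auto simp: orthonormal_basis_def ip'_def subset_iff)
  ultimately show ?thesis
    using EH by (auto simp: orthonormal_basis_def)
qed

lemma onb_preimage:
  assumes E: "orthonormal_basis H' ip' E'"
  shows "orthonormal_basis H ip (V ` E')"
proof -
  have EH: "E' \<subseteq> H'" using E by (simp add: orthonormal_basis_def)
  have "\<exists>y\<in>cvs.span (V ` E'). vnorm ip (x - y) < \<delta>" if x: "x \<in> H" and "\<delta> > 0" for x \<delta>
  proof -
    obtain y where y: "y \<in> cvs.span E'" "vnorm ip' (U x - y) < \<delta>"
      using E U_in[OF x] \<open>\<delta> > 0\<close> unfolding orthonormal_basis_def by blast
    have "y \<in> H' \<and> V y \<in> cvs.span (V ` E')"
      by (rule linear_image_span[OF subspace' EH V_add V_scale y(1)])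
    then show ?thesis using y(2) x by (intro bexI[of _ "V y"]) (simp_all add: vnorm' V_diff)
  qed
  moreover have "ip (V e) (V f) = (if V e = V f then 1 else 0)" if "e \<in> E'" "f \<in> E'" for e f
  proof -
    have "V e = V f \<longleftrightarrow> e = f" using EH that UV by (metis subsetD)
    then show ?thesis using E that by (auto simp: orthonormal_basis_def ip'_def)
  qed
  ultimately show ?thesis
    using EH by (auto simp: orthonormal_basis_def)
qed

lemma hs_norm_lift:
  assumes T: "\<And>x. x \<in> H \<Longrightarrow> T x \<in> H"
  shows "hs_norm H' ip' (lift T) = hs_norm H ip T"
proof -
  have sum: "(\<Sum>\<^sub>\<infinity>e\<in>U ` E. (vnorm ip' (lift T e))\<^sup>2) = (\<Sum>\<^sub>\<infinity>e\<in>E. (vnorm ip (T e))\<^sup>2)"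
    if EH: "E \<subseteq> H" for E
  proof -
    have "(\<Sum>\<^sub>\<infinity>e\<in>U ` E. (vnorm ip' (lift T e))\<^sup>2) =
        infsum ((\<lambda>e. (vnorm ip' (lift T e))\<^sup>2) \<circ> U) E"
      by (rule infsum_reindex) (rule inj_on_subset[OF U_inj EH])
    also have "\<dots> = (\<Sum>\<^sub>\<infinity>e\<in>E. (vnorm ip (T e))\<^sup>2)"
      using EH by (intro infsum_cong) (auto simp: vnorm' lift_apply T subset_iff)
    finally show ?thesis .
  qed
  have "(\<forall>E'. orthonormal_basis H' ip' E' \<longrightarrow> r = sqrt (\<Sum>\<^sub>\<infinity>e\<in>E'. (vnorm ip' (lift T e))\<^sup>2)) \<longleftrightarrow>
        (\<forall>E. orthonormal_basis H ip E \<longrightarrow> r = sqrt (\<Sum>\<^sub>\<infinity>e\<in>E. (vnorm ip (T e))\<^sup>2))"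
    (is "?l \<longleftrightarrow> ?r") for r
  proof
    assume l: ?l
    show ?r
    proof (intro allI impI)
      fix E assume E: "orthonormal_basis H ip E"
      then have "E \<subseteq> H" by (simp add: orthonormal_basis_def)
      then show "r = sqrt (\<Sum>\<^sub>\<infinity>e\<in>E. (vnorm ip (T e))\<^sup>2)"
        using l onb_image[OF E] sum by metis
    qed
  next
    assume r: ?r
    show ?l
    proof (intro allI impI)
      fix E' assume E': "orthonormal_basis H' ip' E'"
      then have "E' \<subseteq> H'" by (simp add: orthonormal_basis_def)
      then have "U ` V ` E' = E'" "V ` E' \<subseteq> H" by (force simp: image_iff)+
      then show "r = sqrt (\<Sum>\<^sub>\<infinity>e\<in>E'. (vnorm ip' (lift T e))\<^sup>2)"
        using r onb_preimage[OF E'] sum[of "V ` E'"] by metis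
    qed
  qed
  then show ?thesis by (simp add: hs_norm_def)
qed

lemma lift_projection:
  assumes P: "finite_rank_projection H ip P"
  shows "finite_rank_projection H' ip' (lift P)"
proof -
  have Pb: "P \<in> bounded_operators H ip" and idem: "P \<circ> P = P" and adj: "is_adjoint H ip P P"
    using P by (simp_all add: finite_rank_projection_def)
  obtain B where B: "finite B" "P ` H \<subseteq> cvs.span B"
    using P by (auto simp: finite_rank_projection_def finite_dimensional_def)
  have "P ` H \<subseteq> H" using bounded_operatorsD(1)[OF Pb] by auto
  obtain B' where B': "B' \<subseteq> P ` H" "cvs.independent B'" "P ` H \<subseteq> cvs.span B'"
    by (rule cvs.maximal_independent_subset)
  have "finite B'"
    using cvs.independent_span_bound[OF B(1) B'(2)] B' B by blast
  have B'H: "B' \<subseteq> H" using B' \<open>P ` H \<subseteq> H\<close> by blast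
  have "lift P ` H' \<subseteq> cvs.span (U ` B')"
  proof
    fix g assume "g \<in> lift P ` H'"
    then obtain f where f: "f \<in> H'" "g = U (P (V f))" by (auto simp: lift_def)
    have "P (V f) \<in> cvs.span B'" using B' f by auto
    from linear_image_span[OF subspace B'H U_add U_scale this]
    show "g \<in> cvs.span (U ` B')" using f by simp
  qed
  then have "finite_dimensional (lift P ` H')"
    using \<open>finite B'\<close> unfolding finite_dimensional_def by blast
  then show ?thesis
    using lift_bounded[OF Pb] lift_comp[OF Pb Pb] lift_adjoint[OF Pb Pb adj]
    by (simp add: finite_rank_projection_def idem)
qed

lemma lift_rep:
  assumes \<pi>: "unital_star_rep \<A> H ip \<pi>" and star: "\<And>a. a \<in> carr \<A> \<Longrightarrow> star \<A> a \<in> carr \<A>"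
  shows "unital_star_rep \<A> H' ip' (\<lambda>a. lift (\<pi> a))"
  using \<pi> star
  by (simp add: unital_star_rep_def hilbert' lift_bounded lift_add lift_scale lift_comp
      lift_adjoint lift_id)

lemma lift_data:
  assumes D: "proper_foelner_data \<A> F \<epsilon> H ip \<pi> \<Omega> P"
    and A: "cvs.subspace (carr \<A>)" and star: "\<And>a. a \<in> carr \<A> \<Longrightarrow> star \<A> a \<in> carr \<A>"
    and F: "F \<subseteq> carr \<A>"
  shows "proper_foelner_data \<A> F \<epsilon> H' ip' (\<lambda>a. lift (\<pi> a)) (U \<Omega>) (lift P)"
proof -
  have rep: "unital_star_rep \<A> H ip \<pi>" and cyc: "cyclic_vector \<A> H ip \<pi> \<Omega>"
    and P: "finite_rank_projection H ip P" "P \<noteq> 0"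
    and hs: "\<And>T. T \<in> F \<Longrightarrow> hs_norm H ip ((\<pi> T \<circ> P) - (P \<circ> \<pi> T)) \<le> \<epsilon> * hs_norm H ip P"
    and inj: "inj_on (\<lambda>a. P (\<pi> a \<Omega>)) (cvs.span F)"
    using D by (simp_all add: proper_foelner_data_def)
  have Pb: "P \<in> bounded_operators H ip" using P by (simp add: finite_rank_projection_def)
  have \<pi>b: "\<pi> a \<in> bounded_operators H ip" if "a \<in> carr \<A>" for a
    using rep that by (simp add: unital_star_rep_def)
  note PD = bounded_operatorsD[OF Pb] and \<pi>D = bounded_operatorsD[OF \<pi>b]
  have \<Omega>: "\<Omega> \<in> H" using cyc by (simp add: cyclic_vector_def)
  have "\<exists>a\<in>carr \<A>. vnorm ip' (f - lift (\<pi> a) (U \<Omega>)) < \<delta>" if "f \<in> H'" "\<delta> > 0" for f \<delta>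
  proof -
    obtain a where "a \<in> carr \<A>" "vnorm ip (V f - \<pi> a \<Omega>) < \<delta>"
      using cyc V_in[OF \<open>f \<in> H'\<close>] \<open>\<delta> > 0\<close> unfolding cyclic_vector_def by blast
    then show ?thesis using \<Omega> that
      by (intro bexI[of _ a]) (simp_all add: vnorm' V_diff lift_apply \<pi>D)
  qed
  then have cyc': "cyclic_vector \<A> H' ip' (\<lambda>a. lift (\<pi> a)) (U \<Omega>)"
    using \<Omega> by (simp add: cyclic_vector_def)
  have nz: "lift P \<noteq> 0"
  proof
    assume z: "lift P = 0"
    have "P x = 0" for x
    proof (cases "x \<in> H")
      case True
      have "U (P x) = 0" using lift_apply[OF True, of P] z by simp
      then show ?thesis using VU[OF PD(1)[OF True]] by simp
    qed (simp add: PD)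
    then show False using P(2) by (auto simp: fun_eq_iff)
  qed
  have hs': "hs_norm H' ip' ((lift (\<pi> T) \<circ> lift P) - (lift P \<circ> lift (\<pi> T))) \<le> \<epsilon> * hs_norm H' ip' (lift P)"
    if "T \<in> F" for T
  proof -
    have T: "T \<in> carr \<A>" using that F by blast
    have "(lift (\<pi> T) \<circ> lift P) - (lift P \<circ> lift (\<pi> T)) = lift ((\<pi> T \<circ> P) - (P \<circ> \<pi> T))"
      using lift_diff[of "\<pi> T \<circ> P" "P \<circ> \<pi> T"]
      by (simp add: lift_comp[OF \<pi>b[OF T] Pb] lift_comp[OF Pb \<pi>b[OF T]] PD \<pi>D T)
    moreover have "hs_norm H' ip' (lift ((\<pi> T \<circ> P) - (P \<circ> \<pi> T))) = hs_norm H ip ((\<pi> T \<circ> P) - (P \<circ> \<pi> T))"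
      by (rule hs_norm_lift) (simp add: PD \<pi>D T)
    moreover have "hs_norm H' ip' (lift P) = hs_norm H ip P"
      by (rule hs_norm_lift) (simp add: PD)
    ultimately show ?thesis using hs[OF that] by simp
  qed
  have span: "cvs.span F \<subseteq> carr \<A>" by (rule cvs.span_minimal[OF F A])
  have "inj_on (\<lambda>a. lift P (lift (\<pi> a) (U \<Omega>))) (cvs.span F)"
  proof (rule inj_onI)
    fix a b assume ab: "a \<in> cvs.span F" "b \<in> cvs.span F"
      and eq: "lift P (lift (\<pi> a) (U \<Omega>)) = lift P (lift (\<pi> b) (U \<Omega>))"
    have "U (P (\<pi> a \<Omega>)) = U (P (\<pi> b \<Omega>))"
      using eq ab span \<Omega> by (simp add: lift_apply \<pi>D subset_iff)
    then have "P (\<pi> a \<Omega>) = P (\<pi> b \<Omega>)"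
      using ab span \<Omega> by (intro inj_onD[OF U_inj]) (auto simp: PD \<pi>D)
    then show "a = b" using inj ab by (auto dest: inj_onD)
  qed
  then show ?thesis
    unfolding proper_foelner_data_def
    using lift_rep[OF rep star] cyc' lift_projection[OF P(1)] nz hs' by blast
qed

end

text \<open>A vector orthogonal to a dense set vanishes.\<close>

lemma (in complex_hilbert_space) orthogonal_dense_eq_0:
  assumes x: "x \<in> H" and S: "S \<subseteq> H" and orth: "\<And>y. y \<in> S \<Longrightarrow> ip x y = 0"
    and dense: "\<And>\<delta>. \<delta> > 0 \<Longrightarrow> \<exists>y\<in>S. vnorm ip (x - y) < \<delta>"
  shows "x = 0"
proof (rule ccontr)
  assume "x \<noteq> 0"
  have "Im (ip x x) = 0" using arg_cong[OF ip_commute[OF x x], of Im] by simp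
  then have pos: "Re (ip x x) > 0"
    using ip_nonneg[OF x] ip_definite[OF x] \<open>x \<noteq> 0\<close> by (auto simp: complex_eq_iff less_le)
  then have "vnorm ip x > 0" by (simp add: vnorm_def)
  then obtain y where y: "y \<in> S" "vnorm ip (x - y) < vnorm ip x" using dense by blast
  have yH: "y \<in> H" using y S by blast
  have xy: "x - y \<in> H" using subspace x yH by (rule cvs.subspace_diff)
  have e1: "ip (x - y) z = ip x z - ip y z" if "z \<in> H" for z
    using ip_add_left[OF xy yH that] by simp
  have yx: "ip y x = 0" using ip_commute[OF x yH] orth[OF y(1)] by simp
  have "ip x (x - y) = cnj (ip x x)"
    using ip_commute[OF xy x] e1[OF x] yx by simp
  moreover have "ip y (x - y) = - cnj (ip y y)"
    using ip_commute[OF xy yH] e1[OF yH] orth[OF y(1)] by simp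
  ultimately have "Re (ip (x - y) (x - y)) = Re (ip x x) + Re (ip y y)"
    using e1[OF xy] by simp
  then show False using y(2) ip_nonneg[OF yH] by (simp add: vnorm_def)
qed

lemma properly_foelner_universe:
  fixes H :: "'v::complex_vector set" and \<A> :: "('b::complex_vector) star_algebra"
  assumes D: "proper_foelner_data \<A> F \<epsilon> H ip \<pi> \<Omega> P"
    and A: "cvs.subspace (carr \<A>)" and star: "\<And>a. a \<in> carr \<A> \<Longrightarrow> star \<A> a \<in> carr \<A>"
    and F: "F \<subseteq> carr \<A>"
  shows "\<exists>(H' :: ('b \<Rightarrow> complex) set) ip' \<pi>' \<Omega>' P'. proper_foelner_data \<A> F \<epsilon> H' ip' \<pi>' \<Omega>' P'"
proof -
  have rep: "unital_star_rep \<A> H ip \<pi>" and cyc: "cyclic_vector \<A> H ip \<pi> \<Omega>"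
    using D by (simp_all add: proper_foelner_data_def)
  interpret complex_hilbert_space H ip using rep by (simp add: unital_star_rep_def)
  define U where "U = (\<lambda>\<xi> a. if a \<in> carr \<A> then ip \<xi> (\<pi> a \<Omega>) else 0)"
  have \<pi>H: "\<pi> a \<Omega> \<in> H" if "a \<in> carr \<A>" for a
    using rep cyc that by (simp add: unital_star_rep_def cyclic_vector_def bounded_operators_def)
  have add: "U (x + y) = U x + U y" if "x \<in> H" "y \<in> H" for x y
    using that by (auto simp: U_def fun_eq_iff ip_add_left \<pi>H)
  have scale: "U (c *\<^sub>C x) = c *\<^sub>C U x" if "x \<in> H" for c x
    using that by (auto simp: U_def fun_eq_iff ip_scale_left \<pi>H scaleC_complex_def)
  have "inj_on U H"
  proof (rule inj_onI)
    fix x y assume xy: "x \<in> H" "y \<in> H" and eq: "U x = U y"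
    have d: "x - y \<in> H" using subspace xy by (rule cvs.subspace_diff)
    have "x - y = 0"
    proof (rule orthogonal_dense_eq_0[OF d, of "(\<lambda>a. \<pi> a \<Omega>) ` carr \<A>"])
      fix z assume "z \<in> (\<lambda>a. \<pi> a \<Omega>) ` carr \<A>"
      then obtain a where a: "a \<in> carr \<A>" "z = \<pi> a \<Omega>" by blast
      have "ip x z = ip y z" using fun_cong[OF eq, of a] a by (simp add: U_def)
      then show "ip (x - y) z = 0"
        using ip_add_left[OF d xy(2) \<pi>H[OF a(1)]] a by simp
    qed (use \<pi>H cyc d in \<open>auto simp: cyclic_vector_def\<close>)
    then show "x = y" by simp
  qed
  then interpret hilbert_transport H ip U
    by unfold_locales (simp_all add: add scale)
  show ?thesis using lift_data[OF D A star F] by blast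
qed



section \<open>Extended metric spaces\<close>

locale ext_metric_space =
  fixes X :: "'a set" and d :: "'a \<Rightarrow> 'a \<Rightarrow> ennreal"
  assumes zero_iff: "\<lbrakk>x \<in> X; y \<in> X\<rbrakk> \<Longrightarrow> d x y = 0 \<longleftrightarrow> x = y"
    and sym: "\<lbrakk>x \<in> X; y \<in> X\<rbrakk> \<Longrightarrow> d x y = d y x"
    and triangle: "\<lbrakk>x \<in> X; y \<in> X; z \<in> X\<rbrakk> \<Longrightarrow> d x z \<le> d x y + d y z"

definition bounded_geometry :: "'a set \<Rightarrow> ('a \<Rightarrow> 'a \<Rightarrow> ennreal) \<Rightarrow> bool" where
  "bounded_geometry X d \<longleftrightarrow>
    (\<exists>C>0::real. \<forall>x\<in>X. \<forall>y\<in>X. x \<noteq> y \<longrightarrow> ennreal C \<le> d x y) \<and>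
    (\<forall>R>0::real. \<exists>N::nat. \<forall>x\<in>X. finite {y\<in>X. d x y \<le> ennreal R} \<and>
                                    card {y\<in>X. d x y \<le> ennreal R} \<le> N)"

definition set_distance :: "('a \<Rightarrow> 'a \<Rightarrow> ennreal) \<Rightarrow> 'a \<Rightarrow> 'a set \<Rightarrow> ennreal" where
  "set_distance d x A = (INF y\<in>A. d x y)"

definition R_boundary :: "'a set \<Rightarrow> ('a \<Rightarrow> 'a \<Rightarrow> ennreal) \<Rightarrow> real \<Rightarrow> 'a set \<Rightarrow> 'a set" where
  "R_boundary X d R A =
    {x\<in>X. set_distance d x A \<le> ennreal R \<and> set_distance d x (X - A) \<le> ennreal R}"

definition properly_amenable :: "'a set \<Rightarrow> ('a \<Rightarrow> 'a \<Rightarrow> ennreal) \<Rightarrow> bool" where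
  "properly_amenable X d \<longleftrightarrow>
    (\<forall>R>0::real. \<forall>\<epsilon>>0::real. \<forall>A. finite A \<and> A \<subseteq> X \<longrightarrow>
      (\<exists>F. finite F \<and> F \<noteq> {} \<and> F \<subseteq> X \<and> A \<subseteq> F \<and>
           finite (R_boundary X d R F) \<and> real (card (R_boundary X d R F)) \<le> \<epsilon> * real (card F)))"


section \<open>Uniform Roe algebras\<close>

text \<open>The space \<open>\<ell>\<^sup>2(X)\<close> consists of functions on the ambient type vanishing outside \<open>X\<close>.\<close>

definition ell2 :: "'a set \<Rightarrow> ('a \<Rightarrow> complex) set" where
  "ell2 X = {f. (\<forall>x. x \<notin> X \<longrightarrow> f x = 0) \<and> (\<lambda>x. (cmod (f x))\<^sup>2) summable_on X}"

definition ell2_ip :: "'a set \<Rightarrow> ('a \<Rightarrow> complex) \<Rightarrow> ('a \<Rightarrow> complex) \<Rightarrow> complex" where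
  "ell2_ip X f g = (\<Sum>\<^sub>\<infinity>x\<in>X. f x * cnj (g x))"

definition ell2_delta :: "'a \<Rightarrow> 'a \<Rightarrow> complex" where
  "ell2_delta x = (\<lambda>y. if y = x then 1 else 0)"

definition partial_translation ::
    "'a set \<Rightarrow> ('a \<Rightarrow> 'a \<Rightarrow> ennreal) \<Rightarrow> 'a set \<Rightarrow> 'a set \<Rightarrow> ('a \<Rightarrow> 'a) \<Rightarrow> bool" where
  "partial_translation X d A B t \<longleftrightarrow>
    A \<subseteq> X \<and> B \<subseteq> X \<and> bij_betw t A B \<and> (SUP x\<in>A. d x (t x)) < \<infinity>"

definition translation_op :: "'a set \<Rightarrow> 'a set \<Rightarrow> ('a \<Rightarrow> 'a) \<Rightarrow> ('a \<Rightarrow> complex) \<Rightarrow> 'a \<Rightarrow> complex" where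
  "translation_op X A t = (\<lambda>f. if f \<in> ell2 X
     then (\<lambda>y. if y \<in> t ` A then f (inv_into A t y) else 0) else 0)"

lemma translation_op_delta:
  assumes t: "partial_translation X d A B t" and x: "x \<in> X"
  shows "translation_op X A t (ell2_delta x) = (if x \<in> A then ell2_delta (t x) else 0)"
proof -
  have "(\<lambda>y. (cmod (ell2_delta x y))\<^sup>2) summable_on X \<longleftrightarrow> (\<lambda>y. (cmod (ell2_delta x y))\<^sup>2) summable_on {x}"
    by (rule summable_on_cong_neutral) (use x in \<open>auto simp: ell2_delta_def\<close>)
  then have "ell2_delta x \<in> ell2 X"
    using x by (auto simp: ell2_def ell2_delta_def)
  moreover have "inj_on t A"
    using t by (auto simp: partial_translation_def bij_betw_def)
  ultimately show ?thesis
    by (auto simp: translation_op_def ell2_delta_def fun_eq_iff inj_on_eq_iff)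
qed

definition diagonal_op :: "'a set \<Rightarrow> ('a \<Rightarrow> complex) \<Rightarrow> ('a \<Rightarrow> complex) \<Rightarrow> 'a \<Rightarrow> complex" where
  "diagonal_op X g = (\<lambda>f. if f \<in> ell2 X then (\<lambda>x. g x * f x) else 0)"

definition alg_uniform_roe ::
    "'a set \<Rightarrow> ('a \<Rightarrow> 'a \<Rightarrow> ennreal) \<Rightarrow> (('a \<Rightarrow> complex) \<Rightarrow> 'a \<Rightarrow> complex) star_algebra" where
  "alg_uniform_roe X d = (operator_algebra (ell2 X) (ell2_ip X))
    \<lparr>carr := unital_star_subalgebra (operator_algebra (ell2 X) (ell2_ip X)) hull
       ({translation_op X A t |A B t. partial_translation X d A B t} \<union>
        {diagonal_op X g |g. bounded (g ` X)})\<rparr>"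

definition uniform_roe ::
    "'a set \<Rightarrow> ('a \<Rightarrow> 'a \<Rightarrow> ennreal) \<Rightarrow> (('a \<Rightarrow> complex) \<Rightarrow> 'a \<Rightarrow> complex) star_algebra" where
  "uniform_roe X d = (operator_algebra (ell2 X) (ell2_ip X))
    \<lparr>carr := operator_norm_closure (ell2 X) (ell2_ip X) (carr (alg_uniform_roe X d))\<rparr>"

end

theory Submission
  imports Defs
begin

text \<open>
  A properly amenable space yields Foelner sets \<open>F\<close> containing any prescribed finite set. Choosing
  one base point \<open>c x\<close> in each component, the matrix units \<open>e\<^bsub>x,c x\<^esub>\<close> with \<open>x \<in> F\<close> span an almost
  invariant subspace of the algebraic Roe algebra, and the points \<open>(x, c x)\<close> with \<open>x \<in> F\<close> span an
  almost invariant subspace of the cyclic representation on \<open>\<ell>\<^sup>2\<close> of a disjoint union of components.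
  As \<open>F\<close> may be taken large, adding a fixed finite dimensional piece, which ensures that the given
  finite set of operators is contained, respectively separated, does no harm.

  Conversely, if \<open>X\<close> is not properly amenable, then Foelner sets at a suitable scale have bounded
  size and lie in a finite set \<open>Y\<close> at infinite distance from its complement. The complement expands
  uniformly, so Hall's theorem gives two injections of bounded displacement with disjoint ranges,
  hence isometries \<open>V\<^sub>0, V\<^sub>1\<close> on \<open>\<ell>\<^sup>2(X - Y)\<close> with orthogonal ranges. An almost invariant subspace,
  or the range of an almost commuting projection, then lives essentially over \<open>Y\<close>, which bounds
  its dimension by a constant depending only on \<open>Y\<close>; but it has to be large as soon as the given
  finite set contains many linearly independent operators.
\<close>

section \<open>Separating functionals and dimension counts\<close>

section \<open>Linear algebra\<close>

text \<open>In the converse direction almost invariance alone gives no contradiction: if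
  \<open>X\<close> is an expanding part together with a nonempty finite \<open>Y\<close> at infinite
  distance, the matrix units over \<open>Y\<close> span exactly invariant subspaces and yield
  exactly commuting projections. Only containment or separation of the prescribed set excludes them.
  The number to beat is |Y|^2: elements of the Roe algebra have no entries between points at
  infinite distance, so their rows over \<open>Y\<close> are supported in Y x Y. The multiples
  4|Y|^2 + 1 and 2|Y|^2 + 1 of diagonal matrix units fit the tolerances 1/4 and 1/2.

  In the forward direction infinite distances force the choice of columns: a matrix unit with
  indices x, y lies in the algebra only if x and y are at finite distance, so one column index
  cannot serve all x. A choice \<open>c\<close> that is constant on components makes a, applied to
  the unit at (x, c x), a combination of units at (z, c z). In the representation each base point
  gets its own copy of its component, because P \<pi>(a) \<Omega> has to record entries of a in
  several columns at once.\<close>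

lemma independent_if_dual:
  fixes \<phi> :: "'v::complex_vector \<Rightarrow> 'v \<Rightarrow> complex"
  assumes add: "\<And>b x y. b \<in> B \<Longrightarrow> \<phi> b (x + y) = \<phi> b x + \<phi> b y"
    and scale: "\<And>b c x. b \<in> B \<Longrightarrow> \<phi> b (c *\<^sub>C x) = c * \<phi> b x"
    and dual: "\<And>b b'. b \<in> B \<Longrightarrow> b' \<in> B \<Longrightarrow> \<phi> b b' = (if b = b' then 1 else 0)"
  shows "cvs.independent B"
  unfolding cvs.independent_explicit_finite_subsets
proof (intro allI impI ballI)
  fix S u b assume S: "S \<subseteq> B" "finite S" and z: "(\<Sum>v\<in>S. u v *\<^sub>C v) = 0" and b: "b \<in> S"
  have bB: "b \<in> B" using b S by blast
  have 0: "\<phi> b 0 = 0" using scale[OF bB, of 0 0] by simp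
  have "\<phi> b (\<Sum>v\<in>T. u v *\<^sub>C v) = (\<Sum>v\<in>T. u v * \<phi> b v)" if "finite T" for T
    using that by (induction T rule: finite_induct) (simp_all add: 0 add[OF bB] scale[OF bB])
  from this[OF S(2)] have "0 = (\<Sum>v\<in>S. u v * \<phi> b v)"
    using z 0 by simp
  also have "\<dots> = (\<Sum>v\<in>S. if v = b then u v else 0)"
    using S dual[OF bB] by (intro sum.cong) auto
  also have "\<dots> = u b" using S b by simp
  finally show "u b = 0" by simp
qed

text \<open>The joint kernel of all functionals on a finite dimensional span is already the joint
  kernel of finitely many of them: by induction, each new spanning vector costs at most one further
  functional. Applied to matrix entries, it reduces the vanishing of an operator in a span to
  finitely many entries.\<close>

lemma finite_separating_set:
  fixes \<phi> :: "'i \<Rightarrow> 'v::complex_vector \<Rightarrow> complex"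
  assumes F: "finite F"
    and add: "\<And>i x y. i \<in> I \<Longrightarrow> \<phi> i (x + y) = \<phi> i x + \<phi> i y"
    and scale: "\<And>i c x. i \<in> I \<Longrightarrow> \<phi> i (c *\<^sub>C x) = c * \<phi> i x"
  shows "\<exists>J. finite J \<and> J \<subseteq> I \<and> (\<forall>v\<in>cvs.span F. (\<forall>j\<in>J. \<phi> j v = 0) \<longrightarrow> (\<forall>i\<in>I. \<phi> i v = 0))"
  using F
proof (induction F)
    case empty
    have "\<phi> i 0 = 0" if "i \<in> I" for i using scale[OF that, of 0 0] by simp
    then show ?case by (intro exI[of _ "{}"]) auto
  next
    case (insert f F)
    have diff: "\<phi> i (x - c *\<^sub>C y) = \<phi> i x - c * \<phi> i y" if "i \<in> I" for i x y c
      using add[OF that, of x "(- c) *\<^sub>C y"] scale[OF that, of "- c" y]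
      by (simp add: cvs.scale_minus_left)
    obtain J where J: "finite J" "J \<subseteq> I"
      "\<forall>v\<in>cvs.span F. (\<forall>j\<in>J. \<phi> j v = 0) \<longrightarrow> (\<forall>i\<in>I. \<phi> i v = 0)"
      using insert.IH by blast
    \<comment> \<open>Either some u in the coset f + span F is killed by all of \<open>J\<close> but
      seen by an \<open>i\<close>, and \<open>i\<close> is added, which forces the f-coefficient to
      vanish; or \<open>J\<close> already suffices.\<close>
    show ?case
    proof (cases "\<exists>u i. u - f \<in> cvs.span F \<and> i \<in> I \<and> (\<forall>j\<in>J. \<phi> j u = 0) \<and> \<phi> i u \<noteq> 0")
      case True
      then obtain u i where u: "u - f \<in> cvs.span F" "i \<in> I" "\<forall>j\<in>J. \<phi> j u = 0" "\<phi> i u \<noteq> 0"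
        by blast
      have "\<phi> k v = 0" if v: "v \<in> cvs.span (insert f F)" "\<forall>j\<in>insert i J. \<phi> j v = 0" and k: "k \<in> I"
        for v k
      proof -
        obtain c where c: "v - c *\<^sub>C f \<in> cvs.span F"
          using v(1) unfolding cvs.span_insert by blast
        have eq: "v - c *\<^sub>C u = (v - c *\<^sub>C f) - c *\<^sub>C (u - f)"
          by (simp add: cvs.scale_right_diff_distrib)
        have "v - c *\<^sub>C u \<in> cvs.span F"
          unfolding eq by (intro cvs.span_diff cvs.span_scale c u)
        moreover have "\<forall>j\<in>J. \<phi> j (v - c *\<^sub>C u) = 0"
          using v(2) u J by (auto simp: diff subset_iff)
        ultimately have z: "\<forall>i\<in>I. \<phi> i (v - c *\<^sub>C u) = 0" using J by blast
        then have "c = 0" using u v(2) by (auto simp: diff)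
        then show ?thesis using z k by simp
      qed
      then have "\<forall>v\<in>cvs.span (insert f F). (\<forall>j\<in>insert i J. \<phi> j v = 0) \<longrightarrow> (\<forall>i\<in>I. \<phi> i v = 0)"
        by blast
      moreover have "finite (insert i J)" "insert i J \<subseteq> I" using J u by simp_all
      ultimately show ?thesis by blast
    next
      case False
      have "\<phi> k v = 0" if v: "v \<in> cvs.span (insert f F)" "\<forall>j\<in>J. \<phi> j v = 0" and k: "k \<in> I"
        for v k
      proof -
        obtain c where c: "v - c *\<^sub>C f \<in> cvs.span F"
          using v(1) unfolding cvs.span_insert by blast
        show ?thesis
        proof (cases "c = 0")
          case True
          then show ?thesis using c v J k by auto
        next
          case c0: False
          \<comment> \<open>Normalising the f-coefficient to 1 moves v into the coset f + span F, to
            which the failed case condition applies.\<close>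
          have "inverse c *\<^sub>C v - f = inverse c *\<^sub>C (v - c *\<^sub>C f)"
            using c0 by (simp add: cvs.scale_right_diff_distrib)
          then have "inverse c *\<^sub>C v - f \<in> cvs.span F"
            using cvs.span_scale[OF c] by metis
          moreover have "\<forall>j\<in>J. \<phi> j (inverse c *\<^sub>C v) = 0"
            using v(2) J by (auto simp: scale subset_iff)
          ultimately have "\<phi> k (inverse c *\<^sub>C v) = 0" using False k by blast
          then show ?thesis using c0 k by (simp add: scale)
        qed
      qed
      then show ?thesis using J by blast
    qed
  qed

text \<open>Maps such as a representation are controlled only on the carrier of the algebra, so
  linearity is required on a subspace \<open>H\<close> of the ambient type; the same holds for
  \<open>independent_image_on\<close>.\<close>

lemma linear_on_sum:
  fixes U :: "'v::complex_vector \<Rightarrow> 'w::complex_vector"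
  assumes H: "cvs.subspace H"
    and add: "\<And>x y. x \<in> H \<Longrightarrow> y \<in> H \<Longrightarrow> U (x + y) = U x + U y"
    and scale: "\<And>c x. x \<in> H \<Longrightarrow> U (c *\<^sub>C x) = c *\<^sub>C U x"
    and f: "\<And>i. i \<in> A \<Longrightarrow> f i \<in> H"
  shows "U (\<Sum>i\<in>A. c i *\<^sub>C f i) = (\<Sum>i\<in>A. c i *\<^sub>C U (f i))"
proof -
  have U0: "U 0 = 0" using scale[of 0 0] cvs.subspace_0[OF H] by simp
  show ?thesis using f
    by (induction A rule: infinite_finite_induct)
      (simp_all add: U0 add scale cvs.subspace_sum[OF H] cvs.subspace_scale[OF H])
qed

lemma independent_image_on:
  fixes U :: "'v::complex_vector \<Rightarrow> 'w::complex_vector"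
  assumes H: "cvs.subspace H"
    and add: "\<And>x y. x \<in> H \<Longrightarrow> y \<in> H \<Longrightarrow> U (x + y) = U x + U y"
    and scale: "\<And>c x. x \<in> H \<Longrightarrow> U (c *\<^sub>C x) = c *\<^sub>C U x"
    and D: "finite D" "D \<subseteq> H" "cvs.independent D" and inj: "inj_on U (cvs.span D)"
  shows "cvs.independent (U ` D)"
proof
  have injD: "inj_on U D" using inj cvs.span_superset by (rule inj_on_subset)
  have U0: "U 0 = 0" using scale[of 0 0] cvs.subspace_0[OF H] by simp
  assume "cvs.dependent (U ` D)"
  then obtain u y where z: "(\<Sum>y\<in>U ` D. u y *\<^sub>C y) = 0" and y: "y \<in> U ` D" "u y \<noteq> 0"
    unfolding cvs.dependent_finite[OF finite_imageI[OF D(1)]] by blast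
  obtain x where x: "x \<in> D" "y = U x" using y(1) by blast
  let ?v = "\<Sum>x\<in>D. u (U x) *\<^sub>C x"
  have "U ?v = (\<Sum>x\<in>D. u (U x) *\<^sub>C U x)"
    by (rule linear_on_sum[OF H add scale]) (use D in auto)
  also have "\<dots> = 0" using z by (simp add: sum.reindex[OF injD])
  finally have "U ?v = U 0" using U0 by simp
  moreover have "?v \<in> cvs.span D" by (intro cvs.span_sum cvs.span_scale cvs.span_base)
  ultimately have "?v = 0" using inj cvs.span_zero by (auto dest: inj_onD)
  from cvs.independentD[OF D(3,1) order_refl this x(1)] show False using y(2) x(2) by simp
qed

lemma finite_dimensional_basis:
  assumes "finite_dimensional W"
  obtains B where "finite B" "B \<subseteq> W" "cvs.independent B" "W \<subseteq> cvs.span B" "card B = cvs.dim W"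
proof -
  obtain S where S: "finite S" "W \<subseteq> cvs.span S" using assms by (auto simp: finite_dimensional_def)
  obtain B where B: "B \<subseteq> W" "cvs.independent B" "W \<subseteq> cvs.span B" "card B = cvs.dim W"
    using cvs.basis_exists by blast
  moreover have "finite B" using cvs.independent_span_bound[OF S(1) B(2)] B S by blast
  ultimately show ?thesis using that by blast
qed

lemma independent_card_le_dim:
  assumes "finite_dimensional W" "B \<subseteq> W" "cvs.independent B"
  shows "finite B" "card B \<le> cvs.dim W"
proof -
  obtain C where C: "finite C" "W \<subseteq> cvs.span C" "card C = cvs.dim W"
    using finite_dimensional_basis[OF assms(1)] by metis
  have "B \<subseteq> cvs.span C" using assms C by blast
  then show "finite B" "card B \<le> cvs.dim W"
    using cvs.independent_span_bound[OF C(1) assms(3)] C(3) by auto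
qed

text \<open>Enlarging a basis of \<open>W\<close> to bases of \<open>W\<^sub>1\<close> and of \<open>W\<^sub>2\<close> costs the two codimensions.\<close>

lemma independent_card_in_sum:
  assumes fd: "finite_dimensional W1" "finite_dimensional W2"
    and W: "W \<subseteq> W1" "W \<subseteq> W2"
    and I: "cvs.independent I" "I \<subseteq> cvs.span (W1 \<union> W2)"
  shows "card I + cvs.dim W \<le> cvs.dim W1 + cvs.dim W2"
proof -
  obtain B where B: "B \<subseteq> W" "cvs.independent B" "W \<subseteq> cvs.span B" "card B = cvs.dim W"
    using cvs.basis_exists by blast
  have ext: "\<exists>B'. finite B' \<and> B \<subseteq> B' \<and> V \<subseteq> cvs.span B' \<and> card B' = cvs.dim V"
    if V: "finite_dimensional V" "W \<subseteq> V" for V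
  proof -
    have "B \<subseteq> V" using B V by blast
    then obtain B' where B': "B \<subseteq> B'" "B' \<subseteq> V" "cvs.independent B'" "V \<subseteq> cvs.span B'"
      using cvs.maximal_independent_subset_extend[OF _ B(2)] by metis
    then show ?thesis
      using independent_card_le_dim(1)[OF V(1) B'(2,3)] cvs.basis_card_eq_dim[of B' V] by blast
  qed
  obtain B1 where B1: "finite B1" "B \<subseteq> B1" "W1 \<subseteq> cvs.span B1" "card B1 = cvs.dim W1"
    using ext[OF fd(1) W(1)] by blast
  obtain B2 where B2: "finite B2" "B \<subseteq> B2" "W2 \<subseteq> cvs.span B2" "card B2 = cvs.dim W2"
    using ext[OF fd(2) W(2)] by blast
  have "W1 \<union> W2 \<subseteq> cvs.span (B1 \<union> B2)"
    using B1 B2 cvs.span_mono[of B1 "B1 \<union> B2"] cvs.span_mono[of B2 "B1 \<union> B2"] by blast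
  then have "I \<subseteq> cvs.span (B1 \<union> B2)" using I(2) cvs.span_minimal[OF _ cvs.subspace_span] by blast
  then have "card I \<le> card (B1 \<union> B2)"
    using cvs.independent_span_bound[OF _ I(1)] B1 B2 by blast
  moreover have "card (B1 \<union> B2) + card (B1 \<inter> B2) = card B1 + card B2"
    using card_Un_Int[OF B1(1) B2(1)] by simp
  moreover have "card B \<le> card (B1 \<inter> B2)" using B1 B2 by (intro card_mono) auto
  ultimately show ?thesis using B B1 B2 by linarith
qed

section \<open>Matchings saturating the left side of a graph with finite left degrees\<close>

section \<open>Hall's theorem for locally finite relations\<close>

text \<open>Rado's argument: a minimal relation satisfying Hall's condition is a function.\<close>

lemma Hall_locally_finite:
  fixes E :: "('a \<times> 'b) set"
  assumes fin: "\<And>x. x \<in> L \<Longrightarrow> finite (E `` {x})"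
    and hall: "\<And>S. finite S \<Longrightarrow> S \<subseteq> L \<Longrightarrow> card S \<le> card (E `` S)"
  obtains f where "inj_on f L" "\<And>x. x \<in> L \<Longrightarrow> (x, f x) \<in> E"
proof -
  define \<H> where "\<H> = {G. G \<subseteq> E \<and> (\<forall>S. finite S \<and> S \<subseteq> L \<longrightarrow> card S \<le> card (G `` S))}"
  have finS: "finite (G `` S)" if "G \<subseteq> E" "finite S" "S \<subseteq> L" for G S
  proof -
    have "G `` S \<subseteq> (\<Union>x\<in>S. E `` {x})" using that by blast
    then show ?thesis using that fin by (meson finite_UN_I finite_subset subsetD)
  qed
  have "\<exists>M\<in>\<H>. \<forall>G\<in>\<H>. G \<subseteq> M \<longrightarrow> G = M"
  proof -
    \<comment> \<open>A minimal relation is wanted, so Zorn's lemma is applied to the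
      complements.\<close>
    have "\<exists>M\<in>uminus ` \<H>. \<forall>G\<in>uminus ` \<H>. M \<subseteq> G \<longrightarrow> G = M"
    proof (rule subset_Zorn_nonempty)
      show "uminus ` \<H> \<noteq> {}" using hall by (auto simp: \<H>_def)
      fix \<C> assume ne: "\<C> \<noteq> {}" and ch: "subset.chain (uminus ` \<H>) \<C>"
      define D where "D = uminus ` \<C>"
      have DH: "D \<subseteq> \<H>" using ch by (auto simp: D_def subset.chain_def)
      have Dne: "D \<noteq> {}" using ne by (simp add: D_def)
      have Dch: "A \<subseteq> B \<or> B \<subseteq> A" if "A \<in> D" "B \<in> D" for A B
      proof -
        have "-A \<in> \<C>" "-B \<in> \<C>" using that by (auto simp: D_def)
        then show ?thesis using ch unfolding subset.chain_def by blast
      qed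
      have "\<Inter>D \<in> \<H>"
      proof -
        have "card S \<le> card (\<Inter>D `` S)" if S: "finite S" "S \<subseteq> L" for S
        proof -
          \<comment> \<open>Over a finite \<open>S\<close> all members of the chain are finite, so
            one with fewest edges over \<open>S\<close> is contained there in every other. The
            intersection of the chain agrees with it over \<open>S\<close> and inherits Hall's
            inequality for \<open>S\<close>.\<close>
          obtain G where G: "G \<in> D" "\<And>G'. G' \<in> D \<Longrightarrow> card (G \<inter> S \<times> UNIV) \<le> card (G' \<inter> S \<times> UNIV)"
            using Dne ex_has_least_nat[of "\<lambda>G. G \<in> D" _ "\<lambda>G. card (G \<inter> S \<times> UNIV)"] by blast
          have finG: "finite (G' \<inter> S \<times> UNIV)" if "G' \<in> D" for G'
          proof -
            have "G' \<inter> S \<times> UNIV \<subseteq> S \<times> (G' `` S)" by blast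
            moreover have "finite (S \<times> (G' `` S))"
              using S that DH by (intro finite_cartesian_product finS) (auto simp: \<H>_def)
            ultimately show ?thesis by (rule finite_subset)
          qed
          have "G \<inter> S \<times> UNIV \<subseteq> G'" if "G' \<in> D" for G'
          proof (cases "G \<subseteq> G'")
            case False
            then have "G' \<inter> S \<times> UNIV \<subseteq> G \<inter> S \<times> UNIV" using Dch[OF G(1) that] by blast
            then have "G' \<inter> S \<times> UNIV = G \<inter> S \<times> UNIV"
              using card_seteq[OF finG[OF G(1)]] G(2)[OF that] by blast
            then show ?thesis by blast
          qed blast
          then have "\<Inter>D `` S = G `` S" using G(1) by blast
          then show ?thesis using S G DH by (auto simp: \<H>_def)
        qed
        then show ?thesis using DH Dne unfolding \<H>_def by blast
      qed
      moreover have "\<Union>\<C> = - \<Inter>D" by (auto simp: D_def)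
      ultimately show "\<Union>\<C> \<in> uminus ` \<H>" by blast
    qed
    then show ?thesis by auto
  qed
  then obtain M where M: "M \<in> \<H>" and min: "\<And>G. G \<in> \<H> \<Longrightarrow> G \<subseteq> M \<Longrightarrow> G = M" by blast
  have ME: "M \<subseteq> E" and Mh: "\<And>S. finite S \<Longrightarrow> S \<subseteq> L \<Longrightarrow> card S \<le> card (M `` S)"
    using M by (auto simp: \<H>_def)
  have witness: "\<exists>S. finite S \<and> S \<subseteq> L \<and> x \<notin> S \<and> card (M `` S \<union> (M `` {x} - {y})) \<le> card S"
    if xy: "x \<in> L" "(x, y) \<in> M" for x y
  proof -
    \<comment> \<open>By minimality, deleting the edge violates Hall's condition at some
      \<open>T\<close>; the violation must involve x, and removing x from \<open>T\<close> gives the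
      witness.\<close>
    have "M - {(x, y)} \<notin> \<H>" using min[of "M - {(x, y)}"] xy by blast
    then obtain T where T: "finite T" "T \<subseteq> L" "card ((M - {(x, y)}) `` T) < card T"
      using ME by (auto simp: \<H>_def not_le)
    have xT: "x \<in> T"
    proof (rule ccontr)
      assume "x \<notin> T"
      then have "(M - {(x, y)}) `` T = M `` T" by blast
      then show False using T Mh[of T] by simp
    qed
    have "(M - {(x, y)}) `` T = M `` (T - {x}) \<union> (M `` {x} - {y})" using xT by blast
    moreover have "card T = Suc (card (T - {x}))" using T(1) xT by (metis card.remove)
    ultimately show ?thesis using T by (intro exI[of _ "T - {x}"]) auto
  qed
  have uniq: "y = z" if xyz: "x \<in> L" "(x, y) \<in> M" "(x, z) \<in> M" for x y z
  proof (rule ccontr)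
    assume ne: "y \<noteq> z"
    obtain S where S: "finite S" "S \<subseteq> L" "x \<notin> S" "card (M `` S \<union> (M `` {x} - {y})) \<le> card S"
      using witness[OF xyz(1,2)] by blast
    obtain T where T: "finite T" "T \<subseteq> L" "x \<notin> T" "card (M `` T \<union> (M `` {x} - {z})) \<le> card T"
      using witness[OF xyz(1,3)] by blast
    let ?A = "M `` S \<union> (M `` {x} - {y})" and ?B = "M `` T \<union> (M `` {x} - {z})"
    have fx: "finite (M `` {x})" using finS[OF ME, of "{x}"] xyz by simp
    have fA: "finite ?A" and fB: "finite ?B" using finS[OF ME] S T fx by auto
    \<comment> \<open>Submodularity: the union is the image of a set with one more point than the
      union of \<open>S\<close> and \<open>T\<close>, and the intersection contains the image of
      their intersection. Adding up gives |A| + |B| > |S| + |T|, contrary to the two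
      witnesses.\<close>
    have "?A \<union> ?B = M `` (insert x (S \<union> T))" using ne by blast
    then have "card (insert x (S \<union> T)) \<le> card (?A \<union> ?B)"
      using Mh[of "insert x (S \<union> T)"] S T xyz by simp
    then have 1: "Suc (card (S \<union> T)) \<le> card (?A \<union> ?B)" using S T by simp
    have 2: "card (S \<inter> T) \<le> card (?A \<inter> ?B)"
    proof -
      have "card (S \<inter> T) \<le> card (M `` (S \<inter> T))" using Mh[of "S \<inter> T"] S T by blast
      also have "\<dots> \<le> card (?A \<inter> ?B)" using fA by (intro card_mono) auto
      finally show ?thesis .
    qed
    show False
      using card_Un_Int[OF fA fB] card_Un_Int[OF S(1) T(1)] 1 2 S(4) T(4) by linarith
  qed
  have ex: "\<exists>y. (x, y) \<in> M" if "x \<in> L" for x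
  proof (rule ccontr)
    assume "\<not> ?thesis"
    then have "M `` {x} = {}" by blast
    then show False using Mh[of "{x}"] that by simp
  qed
  define f where "f x = (SOME y. (x, y) \<in> M)" for x
  have f: "(x, f x) \<in> M" if "x \<in> L" for x
    using someI_ex[OF ex[OF that]] by (simp add: f_def)
  show ?thesis
  proof
    show "inj_on f L"
    proof (rule inj_onI, rule ccontr)
      fix x x' assume xx: "x \<in> L" "x' \<in> L" "f x = f x'" "x \<noteq> x'"
      \<comment> \<open>\<open>M\<close> is a function on \<open>L\<close>, so two points with equal
        value would have a joint image of size 1, against Hall's condition.\<close>
      have "y = f x" if "(z, y) \<in> M" "z = x \<or> z = x'" for z y
        using that(2) uniq[OF xx(1) _ f[OF xx(1)], of y] uniq[OF xx(2) _ f[OF xx(2)], of y] that(1) xx(3)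
        by metis
      then have "M `` {x, x'} \<subseteq> {f x}" by auto
      then have "card (M `` {x, x'}) \<le> 1" using card_mono[of "{f x}"] by fastforce
      then show False using Mh[of "{x, x'}"] xx by simp
    qed
    show "\<And>x. x \<in> L \<Longrightarrow> (x, f x) \<in> E" using f ME by blast
  qed
qed

section \<open>Geometry and operators of an abstract Hilbert space\<close>

section \<open>Hilbert spaces\<close>

lemma has_sum_finite_sum:
  fixes g :: "'i \<Rightarrow> 'a \<Rightarrow> 'b::topological_comm_monoid_add"
  assumes "finite B" "\<And>f. f \<in> B \<Longrightarrow> (g f has_sum a f) A"
  shows "((\<lambda>e. \<Sum>f\<in>B. g f e) has_sum (\<Sum>f\<in>B. a f)) A"
  using assms by (induction B rule: finite_induct) (auto intro!: has_sum_add)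

context complex_hilbert_space
begin

lemma mem_H [simp, intro]:
  "0 \<in> H" "x \<in> H \<Longrightarrow> y \<in> H \<Longrightarrow> x + y \<in> H" "x \<in> H \<Longrightarrow> y \<in> H \<Longrightarrow> x - y \<in> H"
  "x \<in> H \<Longrightarrow> c *\<^sub>C x \<in> H" "(\<And>i. i \<in> A \<Longrightarrow> f i \<in> H) \<Longrightarrow> sum f A \<in> H"
  using subspace by (simp_all add: cvs.subspace_0 cvs.subspace_add cvs.subspace_diff
      cvs.subspace_scale cvs.subspace_sum)

lemma span_in_H: "B \<subseteq> H \<Longrightarrow> x \<in> cvs.span B \<Longrightarrow> x \<in> H"
  using cvs.span_minimal[OF _ subspace] by blast

lemma ip_add_right: "x \<in> H \<Longrightarrow> y \<in> H \<Longrightarrow> z \<in> H \<Longrightarrow> ip x (y + z) = ip x y + ip x z"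
  using ip_commute[of "y + z" x] ip_commute[of y x] ip_commute[of z x] ip_add_left[of y z x] by simp

lemma ip_scale_right: "x \<in> H \<Longrightarrow> y \<in> H \<Longrightarrow> ip x (c *\<^sub>C y) = cnj c * ip x y"
  using ip_commute[of "c *\<^sub>C y" x] ip_commute[of y x] ip_scale_left[of y x c] by simp

lemma ip_zero [simp]: "x \<in> H \<Longrightarrow> ip 0 x = 0" "x \<in> H \<Longrightarrow> ip x 0 = 0"
  using ip_scale_left[of 0 x 0] ip_scale_right[of x 0 0] by simp_all

lemma ip_diff_left: "x \<in> H \<Longrightarrow> y \<in> H \<Longrightarrow> z \<in> H \<Longrightarrow> ip (x - y) z = ip x z - ip y z"
  using ip_add_left[of "x - y" y z] by simp

lemma ip_diff_right: "x \<in> H \<Longrightarrow> y \<in> H \<Longrightarrow> z \<in> H \<Longrightarrow> ip x (y - z) = ip x y - ip x z"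
  using ip_add_right[of x "y - z" z] by simp

lemma ip_sum_left: "(\<And>i. i \<in> A \<Longrightarrow> f i \<in> H) \<Longrightarrow> x \<in> H \<Longrightarrow> ip (sum f A) x = (\<Sum>i\<in>A. ip (f i) x)"
  by (induction A rule: infinite_finite_induct) (simp_all add: ip_add_left)

lemma ip_sum_right: "(\<And>i. i \<in> A \<Longrightarrow> f i \<in> H) \<Longrightarrow> x \<in> H \<Longrightarrow> ip x (sum f A) = (\<Sum>i\<in>A. ip x (f i))"
  by (induction A rule: infinite_finite_induct) (simp_all add: ip_add_right)

lemma vnorm_sq: "x \<in> H \<Longrightarrow> (vnorm ip x)\<^sup>2 = Re (ip x x)"
  by (simp add: vnorm_def ip_nonneg)

lemma ip_self: assumes "x \<in> H" shows "ip x x = of_real ((vnorm ip x)\<^sup>2)"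
proof -
  have "Im (ip x x) = 0" using arg_cong[OF ip_commute[OF assms assms], of Im] by simp
  then show ?thesis by (simp add: vnorm_sq assms complex_eq_iff)
qed

lemma vnorm_ge_0 [simp]: "x \<in> H \<Longrightarrow> vnorm ip x \<ge> 0"
  by (simp add: vnorm_def ip_nonneg)

lemma vnorm_eq_0D: "x \<in> H \<Longrightarrow> vnorm ip x = 0 \<Longrightarrow> x = 0"
  by (rule ip_definite) (simp_all add: ip_self)

lemma vnorm_0 [simp]: "vnorm ip 0 = 0"
  by (simp add: vnorm_def)

lemma cmod_ip_commute: "x \<in> H \<Longrightarrow> y \<in> H \<Longrightarrow> cmod (ip y x) = cmod (ip x y)"
  using ip_commute[of x y] by simp

lemma vnorm_scale:
  assumes x: "x \<in> H"
  shows "vnorm ip (c *\<^sub>C x) = cmod c * vnorm ip x"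
proof -
  have "ip (c *\<^sub>C x) (c *\<^sub>C x) = (c * cnj c) * ip x x"
    using x by (simp add: ip_scale_left ip_scale_right)
  then have "Re (ip (c *\<^sub>C x) (c *\<^sub>C x)) = (cmod c)\<^sup>2 * (vnorm ip x)\<^sup>2"
    using x by (simp add: vnorm_sq flip: complex_norm_square)
  then have "(vnorm ip (c *\<^sub>C x))\<^sup>2 = (cmod c * vnorm ip x)\<^sup>2"
    using x by (simp add: vnorm_sq power_mult_distrib)
  then show ?thesis using x by (simp add: power2_eq_iff_nonneg)
qed

lemma vnorm_minus_commute: "x \<in> H \<Longrightarrow> y \<in> H \<Longrightarrow> vnorm ip (x - y) = vnorm ip (y - x)"
  using vnorm_scale[of "x - y" "-1"] by (simp add: cvs.scale_minus_left scaleC_one)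

lemma pythagoras:
  assumes "x \<in> H" "y \<in> H" "ip x y = 0"
  shows "(vnorm ip (x + y))\<^sup>2 = (vnorm ip x)\<^sup>2 + (vnorm ip y)\<^sup>2"
proof -
  have "ip y x = 0" using ip_commute[of x y] assms by simp
  then show ?thesis using assms by (simp add: vnorm_sq ip_add_left ip_add_right)
qed

lemma parallelogram:
  assumes "x \<in> H" "y \<in> H"
  shows "(vnorm ip (x + y))\<^sup>2 + (vnorm ip (x - y))\<^sup>2 = 2 * (vnorm ip x)\<^sup>2 + 2 * (vnorm ip y)\<^sup>2"
  using assms by (simp add: vnorm_sq ip_add_left ip_add_right ip_diff_left ip_diff_right)

lemma vnorm_add_sq_le:
  assumes "x \<in> H" "y \<in> H"
  shows "(vnorm ip (x + y))\<^sup>2 \<le> 2 * (vnorm ip x)\<^sup>2 + 2 * (vnorm ip y)\<^sup>2"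
  using parallelogram[OF assms] zero_le_power2[of "vnorm ip (x - y)"] by linarith

subsection \<open>Orthonormal sets\<close>

definition orthonormal :: "'v set \<Rightarrow> bool" where
  "orthonormal B \<longleftrightarrow> B \<subseteq> H \<and> (\<forall>e\<in>B. \<forall>f\<in>B. ip e f = (if e = f then 1 else 0))"

lemma orthonormalD:
  assumes "orthonormal B"
  shows "B \<subseteq> H" "e \<in> B \<Longrightarrow> e \<in> H" "e \<in> B \<Longrightarrow> f \<in> B \<Longrightarrow> ip e f = (if e = f then 1 else 0)"
    "e \<in> B \<Longrightarrow> vnorm ip e = 1"
  using assms by (auto simp: orthonormal_def vnorm_def)

lemma orthonormal_subset: "orthonormal B \<Longrightarrow> C \<subseteq> B \<Longrightarrow> orthonormal C"
  unfolding orthonormal_def by blast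

text \<open>For finite orthonormal \<open>B\<close> this is the orthogonal projection onto the span.
  Over an infinite set the sum defaults to 0, so closed infinite dimensional spans are reached
  through limits in \<open>exists_residual\<close>.\<close>

definition proj :: "'v set \<Rightarrow> 'v \<Rightarrow> 'v" where
  "proj B x = (\<Sum>e\<in>B. ip x e *\<^sub>C e)"

lemma proj_in_H [simp]: "orthonormal B \<Longrightarrow> proj B x \<in> H"
  unfolding proj_def using orthonormalD(2) by blast

lemma proj_in_span: "proj B x \<in> cvs.span B"
  unfolding proj_def by (intro cvs.span_sum cvs.span_scale cvs.span_base)

lemma ip_proj:
  assumes "orthonormal B" "finite B" "e \<in> B"
  shows "ip (proj B x) e = ip x e"
proof -
  have "ip (proj B x) e = (\<Sum>f\<in>B. ip x f * ip f e)"
    unfolding proj_def using orthonormalD(2)[OF assms(1)] assms(3)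
    by (subst ip_sum_left) (auto simp: ip_scale_left)
  also have "\<dots> = (\<Sum>f\<in>B. if f = e then ip x f else 0)"
    using orthonormalD(3)[OF assms(1)] assms(3) by (intro sum.cong) auto
  finally show ?thesis using assms by simp
qed

lemma orth_span:
  assumes B: "B \<subseteq> H" and x: "x \<in> H" and o: "\<And>e. e \<in> B \<Longrightarrow> ip x e = 0" and y: "y \<in> cvs.span B"
  shows "ip x y = 0"
proof -
  have "cvs.subspace {y \<in> H. ip x y = 0}"
    using x by (auto simp: cvs.subspace_def ip_add_right ip_scale_right)
  then show ?thesis using cvs.span_minimal[of B "{y \<in> H. ip x y = 0}"] B o y by blast
qed

lemma residual_orth:
  assumes "orthonormal B" "finite B" "x \<in> H" "y \<in> cvs.span B"
  shows "ip (x - proj B x) y = 0"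
  using assms orthonormalD[OF assms(1)]
  by (intro orth_span[OF _ _ _ assms(4)]) (auto simp: ip_diff_left ip_proj)

lemma vnorm_proj:
  assumes "orthonormal B" "finite B" "x \<in> H"
  shows "(vnorm ip (proj B x))\<^sup>2 = (\<Sum>e\<in>B. (cmod (ip x e))\<^sup>2)"
proof -
  have "ip (proj B x) (proj B x) = (\<Sum>e\<in>B. cnj (ip x e) * ip (proj B x) e)"
    using orthonormalD(2)[OF assms(1)] assms
    by (subst (2) proj_def) (simp add: ip_sum_right ip_scale_right)
  also have "\<dots> = (\<Sum>e\<in>B. of_real ((cmod (ip x e))\<^sup>2))"
    using assms by (intro sum.cong) (simp_all add: ip_proj complex_norm_square mult.commute del: of_real_power)
  finally show ?thesis using assms by (simp add: vnorm_sq del: of_real_power)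
qed

lemma vnorm_decompose:
  assumes "orthonormal B" "finite B" "x \<in> H"
  shows "(vnorm ip x)\<^sup>2 = (\<Sum>e\<in>B. (cmod (ip x e))\<^sup>2) + (vnorm ip (x - proj B x))\<^sup>2"
  using pythagoras[of "x - proj B x" "proj B x"] residual_orth[OF assms proj_in_span] assms
  by (simp add: vnorm_proj)

lemma bessel:
  assumes "orthonormal B" "finite B" "x \<in> H"
  shows "(\<Sum>e\<in>B. (cmod (ip x e))\<^sup>2) \<le> (vnorm ip x)\<^sup>2"
  using vnorm_decompose[OF assms] by simp

lemma best_approximation:
  assumes B: "orthonormal B" "finite B" "x \<in> H" "y \<in> cvs.span B"
  shows "(vnorm ip (x - proj B x))\<^sup>2 \<le> (vnorm ip (x - y))\<^sup>2"
proof -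
  have y: "y \<in> H" using B orthonormalD(1) span_in_H by blast
  have "(vnorm ip ((x - proj B x) + (proj B x - y)))\<^sup>2
      = (vnorm ip (x - proj B x))\<^sup>2 + (vnorm ip (proj B x - y))\<^sup>2"
    using B y by (intro pythagoras residual_orth cvs.span_diff proj_in_span) auto
  then show ?thesis by simp
qed

lemma proj_eq_self:
  assumes B: "orthonormal B" "finite B" "x \<in> cvs.span B"
  shows "proj B x = x"
proof -
  have x: "x \<in> H" using B orthonormalD(1) span_in_H by blast
  have "(vnorm ip (x - proj B x))\<^sup>2 \<le> 0"
    using best_approximation[OF B(1,2) x B(3)] by simp
  then have "x - proj B x = 0" using x B by (intro vnorm_eq_0D) auto
  then show ?thesis by simp
qed

lemma vnorm_sq_span:
  assumes "orthonormal B" "finite B" "x \<in> cvs.span B"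
  shows "(vnorm ip x)\<^sup>2 = (\<Sum>e\<in>B. (cmod (ip x e))\<^sup>2)"
  using vnorm_proj[OF assms(1,2), of x] proj_eq_self[OF assms] assms
    span_in_H[OF orthonormalD(1)[OF assms(1)]] by simp

text \<open>Bessel's inequality for the one-element orthonormal set obtained by normalising
  \<open>y\<close>.\<close>

lemma cauchy_schwarz:
  assumes "x \<in> H" "y \<in> H"
  shows "cmod (ip x y) \<le> vnorm ip x * vnorm ip y"
proof (cases "vnorm ip y = 0")
  case True
  then have "y = 0" using assms vnorm_eq_0D by blast
  then show ?thesis using assms by simp
next
  case False
  then have pos: "vnorm ip y > 0" using assms(2) vnorm_ge_0[of y] by linarith
  define e where "e = of_real (inverse (vnorm ip y)) *\<^sub>C y"
  have e: "e \<in> H" "vnorm ip e = 1" using pos assms by (simp_all add: e_def vnorm_scale norm_inverse)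
  have on: "orthonormal {e}" using e by (simp add: orthonormal_def ip_self)
  have "(cmod (ip x e))\<^sup>2 \<le> (vnorm ip x)\<^sup>2" using bessel[OF on _ assms(1)] by simp
  then have "cmod (ip x e) \<le> vnorm ip x" using assms power2_le_imp_le by fastforce
  moreover have "cmod (ip x e) = cmod (ip x y) / vnorm ip y"
    using pos assms by (simp add: e_def ip_scale_right norm_mult norm_inverse norm_divide divide_simps)
  ultimately show ?thesis using pos by (simp add: divide_le_eq)
qed

text \<open>Vectors with zero residual are dropped, so the cardinality can only decrease; the rank
  bounds use this inequality together with the equality of spans.\<close>

lemma gram_schmidt:
  assumes "finite S" "S \<subseteq> H"
  shows "\<exists>B. orthonormal B \<and> finite B \<and> card B \<le> card S \<and> cvs.span B = cvs.span S"
  using assms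
proof (induction S)
  case empty
  then show ?case by (intro exI[of _ "{}"]) (auto simp: orthonormal_def)
next
  case (insert x S)
  then obtain B where B: "orthonormal B" "finite B" "card B \<le> card S" "cvs.span B = cvs.span S"
    by blast
  have x: "x \<in> H" using insert by blast
  define r where "r = x - proj B x"
  have r: "r \<in> H" using B x by (simp add: r_def)
  have ro: "ip r y = 0" if "y \<in> cvs.span B" for y
    using residual_orth[OF B(1,2) x that] by (simp add: r_def)
  have sp: "cvs.span (insert x S) = cvs.span (insert r B)"
  proof
    have "x = r + proj B x" by (simp add: r_def)
    then have "x \<in> cvs.span (insert r B)"
      using cvs.span_add[of r "insert r B" "proj B x"] cvs.span_base[of r "insert r B"]
        proj_in_span[of B x] cvs.span_mono[of B "insert r B"] by auto
    moreover have "S \<subseteq> cvs.span (insert r B)"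
      using cvs.span_superset[of S] B(4) cvs.span_mono[of B "insert r B"] by blast
    ultimately show "cvs.span (insert x S) \<subseteq> cvs.span (insert r B)"
      by (intro cvs.span_minimal) auto
    have S': "cvs.span B \<subseteq> cvs.span (insert x S)"
      using B(4) cvs.span_mono[of S "insert x S"] by auto
    have "r \<in> cvs.span (insert x S)"
      unfolding r_def using proj_in_span[of B x] S'
      by (intro cvs.span_diff) (auto intro: cvs.span_base)
    then show "cvs.span (insert r B) \<subseteq> cvs.span (insert x S)"
      using S' cvs.span_superset[of B] by (intro cvs.span_minimal) auto
  qed
  show ?case
  proof (cases "r = 0")
    case True
    then have "cvs.span (insert x S) = cvs.span B" using sp by (simp add: cvs.span_insert_0)
    then show ?thesis using B insert.hyps by (intro exI[of _ B]) simp
  next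
    case False
    define n where "n = vnorm ip r"
    have n: "n > 0" using vnorm_ge_0[OF r] vnorm_eq_0D[OF r] False by (auto simp: n_def less_le)
    define e where "e = of_real (inverse n) *\<^sub>C r"
    have e: "e \<in> H" "vnorm ip e = 1" using n r by (simp_all add: e_def vnorm_scale norm_inverse n_def)
    have eo: "ip e y = 0" "ip y e = 0" if "y \<in> B" for y
    proof -
      have y: "y \<in> H" using that orthonormalD(2)[OF B(1)] by blast
      show "ip e y = 0" using ro[OF cvs.span_base[OF that]] r y by (simp add: e_def ip_scale_left)
      then show "ip y e = 0" using ip_commute[OF e(1) y] by simp
    qed
    have "r = of_real n *\<^sub>C e" using n by (simp add: e_def cvs.scale_scale scaleC_one)
    then have "r \<in> cvs.span (insert e B)" by (metis cvs.span_scale cvs.span_base insertI1)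
    moreover have "e \<in> cvs.span (insert r B)"
      unfolding e_def by (intro cvs.span_scale cvs.span_base) simp
    ultimately have "cvs.span (insert e B) = cvs.span (insert r B)"
      using cvs.span_superset[of "insert r B"] cvs.span_superset[of "insert e B"]
      by (intro equalityI cvs.span_minimal) auto
    moreover have eB: "e \<notin> B"
    proof
      assume "e \<in> B"
      then have "ip e e = 0" by (rule eo)
      then show False using e by (simp add: ip_self)
    qed
    moreover have "orthonormal (insert e B)"
      using eB B(1) e(1) ip_self[OF e(1)] e(2) eo unfolding orthonormal_def by auto
    ultimately show ?thesis using B insert.hyps sp by (intro exI[of _ "insert e B"]) simp
  qed
qed

subsection \<open>Orthonormal bases\<close>

lemma orthonormal_basis_iff:
  "orthonormal_basis H ip E \<longleftrightarrow>
    orthonormal E \<and> (\<forall>x\<in>H. \<forall>\<delta>>0. \<exists>y\<in>cvs.span E. vnorm ip (x - y) < \<delta>)"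
  by (auto simp: orthonormal_basis_def orthonormal_def)

lemma span_finite_subset:
  fixes x :: "'w::complex_vector"
  assumes "x \<in> cvs.span E"
  obtains F where "finite F" "F \<subseteq> E" "x \<in> cvs.span F"
proof -
  obtain F u where "finite F" "F \<subseteq> E" "x = (\<Sum>a\<in>F. u a *\<^sub>C a)"
    using assms by (auto simp: cvs.span_explicit)
  then show ?thesis using that[of F] by (auto intro: cvs.span_sum cvs.span_scale cvs.span_base)
qed

text \<open>Bessel's inequality bounds the sum from above. From below, a vector of the span within
  sqrt \<delta> of \<open>x\<close> involves a finite set \<open>F\<close> of basis vectors, and the
  projection onto their span is at least as close.\<close>

lemma parseval:
  assumes E: "orthonormal_basis H ip E" and x: "x \<in> H"
  shows "((\<lambda>e. (cmod (ip x e))\<^sup>2) has_sum (vnorm ip x)\<^sup>2) E"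
proof -
  let ?f = "\<lambda>e. (cmod (ip x e))\<^sup>2"
  have on: "orthonormal E" using E by (simp add: orthonormal_basis_iff)
  have le: "sum ?f F \<le> (vnorm ip x)\<^sup>2" if "finite F" "F \<subseteq> E" for F
    using bessel[OF orthonormal_subset[OF on that(2)] that(1) x] .
  then have s: "?f summable_on E"
    by (intro nonneg_bdd_above_summable_on bdd_aboveI[of _ "(vnorm ip x)\<^sup>2"]) auto
  have "infsum ?f E \<le> (vnorm ip x)\<^sup>2" using le by (intro infsum_le_finite_sums[OF s])
  moreover have "(vnorm ip x)\<^sup>2 \<le> infsum ?f E + \<delta>" if "\<delta> > 0" for \<delta> :: real
  proof -
    have "\<exists>y\<in>cvs.span E. vnorm ip (x - y) < sqrt \<delta>"
      using E x that by (simp add: orthonormal_basis_iff)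
    then obtain y where y: "y \<in> cvs.span E" "vnorm ip (x - y) < sqrt \<delta>" by blast
    then obtain F where F: "finite F" "F \<subseteq> E" "y \<in> cvs.span F" using span_finite_subset by blast
    have onF: "orthonormal F" using orthonormal_subset[OF on F(2)] .
    have "y \<in> H" using span_in_H[OF orthonormalD(1)[OF onF] F(3)] .
    then have "(vnorm ip (x - y))\<^sup>2 \<le> (sqrt \<delta>)\<^sup>2" using y(2) x by (intro power_mono) auto
    then have "(vnorm ip x)\<^sup>2 \<le> sum ?f F + \<delta>"
      using vnorm_decompose[OF onF F(1) x] best_approximation[OF onF F(1) x F(3)] that by simp
    also have "sum ?f F \<le> infsum ?f E" by (rule finite_sum_le_infsum[OF s F(1,2)]) simp
    finally show ?thesis by simp
  qed
  then have "(vnorm ip x)\<^sup>2 \<le> infsum ?f E" using field_le_epsilon by blast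
  ultimately show ?thesis using s by (simp add: has_sum_iff)
qed

text \<open>Existence of the orthogonal projection of \<open>x\<close> onto the closed span of a
  possibly infinite orthonormal set: projections onto an increasing sequence of finite parts, whose
  Bessel sums approach their supremum \<open>s\<close>, form a Cauchy sequence, and completeness
  supplies the limit.\<close>

lemma exists_residual:
  assumes on: "orthonormal E" and x: "x \<in> H"
  obtains y where "y \<in> H" "\<And>e. e \<in> E \<Longrightarrow> ip (x - y) e = 0"
    "\<And>\<delta>. \<delta> > 0 \<Longrightarrow> \<exists>z\<in>cvs.span E. vnorm ip (y - z) < \<delta>"
proof -
  let ?f = "\<lambda>e. (cmod (ip x e))\<^sup>2"
  let ?FS = "{F. finite F \<and> F \<subseteq> E}"
  define s where "s = (SUP F\<in>?FS. sum ?f F)"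
  have bdd: "bdd_above (sum ?f ` ?FS)"
    using bessel[OF orthonormal_subset[OF on] _ x]
    by (intro bdd_aboveI[of _ "(vnorm ip x)\<^sup>2"]) auto
  have le_s: "sum ?f F \<le> s" if "finite F" "F \<subseteq> E" for F
    unfolding s_def using that by (intro cSUP_upper bdd) auto
  have "\<exists>F. finite F \<and> F \<subseteq> E \<and> s - 1 / Suc n < sum ?f F" for n
  proof -
    have "s - 1 / Suc n < s" by simp
    then show ?thesis unfolding s_def using bdd by (subst (asm) less_cSUP_iff) auto
  qed
  then obtain F where F: "\<And>n. finite (F n)" "\<And>n. F n \<subseteq> E" "\<And>n. s - 1 / Suc n < sum ?f (F n)"
    by metis
  define G where "G n = (\<Union>i\<le>n. F i)" for n
  have G: "finite (G n)" "G n \<subseteq> E" for n using F by (auto simp: G_def)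
  have Gs: "s - 1 / Suc n < sum ?f (G n)" for n
  proof -
    have "sum ?f (F n) \<le> sum ?f (G n)" using G by (intro sum_mono2) (auto simp: G_def)
    then show ?thesis using F(3)[of n] by linarith
  qed
  have Gmono: "G m \<subseteq> G n" if "m \<le> n" for m n using that by (force simp: G_def)
  have onG: "orthonormal (G n)" for n using orthonormal_subset[OF on G(2)] .
  define p where "p n = proj (G n) x" for n
  have pH: "p n \<in> H" for n using onG by (simp add: p_def)
  \<comment> \<open>The difference is the projection onto the newly added vectors, so its squared
    norm is the gain in the Bessel sum; this gain is at most s - (s - 1/(m+1)).\<close>
  have diff_le: "(vnorm ip (p n - p m))\<^sup>2 \<le> 1 / Suc m" if mn: "m \<le> n" for m n
  proof -
    have onD: "orthonormal (G n - G m)" using orthonormal_subset[OF onG] by blast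
    have split: "sum g (G n) = sum g (G n - G m) + sum g (G m)" for g :: "'v \<Rightarrow> 'z::comm_monoid_add"
      using sum.subset_diff[OF Gmono[OF mn] G(1)] .
    have "p n - p m = proj (G n - G m) x"
      by (simp add: p_def proj_def split)
    then have "(vnorm ip (p n - p m))\<^sup>2 = sum ?f (G n - G m)"
      using vnorm_proj[OF onD _ x] G(1) by simp
    also have "\<dots> = sum ?f (G n) - sum ?f (G m)" using split[of ?f] by simp
    also have "\<dots> \<le> 1 / Suc m" using le_s[OF G, of n] Gs[of m] by simp
    finally show ?thesis .
  qed
  have "\<exists>N. \<forall>m\<ge>N. \<forall>n\<ge>N. vnorm ip (p m - p n) < e" if "e > 0" for e :: real
  proof -
    have "e\<^sup>2 > 0" using that by simp
    then obtain N where N: "1 / Suc N < e\<^sup>2" by (rule nat_approx_posE)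
    have less: "vnorm ip (p n - p m) < e" if "N \<le> m" "m \<le> n" for m n
    proof -
      have "1 / Suc m \<le> 1 / Suc N" using that by (simp add: frac_le)
      then have "(vnorm ip (p n - p m))\<^sup>2 < e\<^sup>2" using diff_le[OF that(2)] N by linarith
      then show ?thesis using \<open>e > 0\<close> power2_less_imp_less by fastforce
    qed
    have "vnorm ip (p m - p n) < e" if "N \<le> m" "N \<le> n" for m n
      using that less[of m n] less[of n m] vnorm_minus_commute[OF pH pH, of m n]
      by (cases "m \<le> n") auto
    then show ?thesis by blast
  qed
  then obtain y where y: "y \<in> H" "(\<lambda>n. vnorm ip (p n - y)) \<longlonglongrightarrow> 0"
    using complete[of p] pH by blast
  have near: "\<exists>n. \<forall>m\<ge>n. vnorm ip (p m - y) < \<delta>" if "\<delta> > 0" for \<delta>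
    using LIMSEQ_D[OF y(2) that] pH y(1) by (auto simp: abs_of_nonneg)
  show thesis
  proof
    show "y \<in> H" by fact
    show "\<exists>z\<in>cvs.span E. vnorm ip (y - z) < \<delta>" if pos: "\<delta> > 0" for \<delta>
    proof -
      obtain n where "vnorm ip (p n - y) < \<delta>" using near[OF pos] by blast
      moreover have "p n \<in> cvs.span E"
        using proj_in_span[of "G n" x] cvs.span_mono[OF G(2)] by (auto simp: p_def)
      ultimately show ?thesis using vnorm_minus_commute[OF y(1) pH, of n] by (intro bexI[of _ "p n"]) simp_all
    qed
    show "ip (x - y) e = 0" if e: "e \<in> E" for e
    proof -
      have eH: "e \<in> H" "vnorm ip e = 1" using orthonormalD[OF on] e by auto
      \<comment> \<open>If e is not yet in \<open>G n\<close>, adding it cannot push the Bessel sum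
        beyond \<open>s\<close>, so its coefficient has square at most 1/(n+1).\<close>
      have small: "cmod (ip (x - p n) e) \<le> sqrt (1 / Suc n)" for n
      proof (cases "e \<in> G n")
        case True
        then have "ip (x - p n) e = 0"
          using residual_orth[OF onG G(1) x, of e n] by (simp add: p_def cvs.span_base)
        then show ?thesis by simp
      next
        case False
        have "ip (p n) e = (\<Sum>f\<in>G n. ip x f * ip f e)"
          unfolding p_def proj_def using orthonormalD(2)[OF onG] eH(1)
          by (subst ip_sum_left) (auto simp: ip_scale_left)
        also have "\<dots> = 0"
          using False G(2) e orthonormalD(3)[OF on] by (intro sum.neutral) (auto simp: subset_iff)
        finally have eq: "ip (x - p n) e = ip x e" using x pH eH by (simp add: ip_diff_left)
        have "sum ?f (insert e (G n)) \<le> s" using G e by (intro le_s) auto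
        then have "(cmod (ip x e))\<^sup>2 \<le> 1 / Suc n" using False G Gs[of n] by simp
        then show ?thesis using eq real_le_rsqrt by fastforce
      qed
      have "cmod (ip (x - y) e) \<le> sqrt (1 / Suc n) + vnorm ip (p n - y)" for n
      proof -
        have "ip (x - y) e = ip (x - p n) e + ip (p n - y) e"
          using x y pH eH by (simp add: ip_diff_left)
        then have "cmod (ip (x - y) e) \<le> cmod (ip (x - p n) e) + cmod (ip (p n - y) e)"
          by (simp add: norm_triangle_ineq)
        also have "cmod (ip (p n - y) e) \<le> vnorm ip (p n - y)"
          using cauchy_schwarz[of "p n - y" e] pH y eH by simp
        finally show ?thesis using small[of n] by linarith
      qed
      moreover have "(\<lambda>n. sqrt (1 / Suc n) + vnorm ip (p n - y)) \<longlonglongrightarrow> 0 + 0"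
        using tendsto_real_sqrt[OF LIMSEQ_inverse_real_of_nat] 
        by (intro tendsto_add y(2)) (simp add: inverse_eq_divide)
      ultimately have "cmod (ip (x - y) e) \<le> 0 + 0"
        by (intro LIMSEQ_le_const) auto
      then show ?thesis by simp
    qed
  qed
qed

text \<open>A maximal orthonormal set containing \<open>B\<close> has dense span, since a nonzero
  residual could be normalised and added. Extending a given \<open>B\<close> allows Hilbert--Schmidt
  norms to be computed in a basis adapted to a projection.\<close>

lemma orthonormal_basis_extend:
  assumes B: "orthonormal B"
  obtains E where "B \<subseteq> E" "orthonormal_basis H ip E"
proof -
  let ?\<A> = "{E. orthonormal E \<and> B \<subseteq> E}"
  have "\<exists>M\<in>?\<A>. \<forall>E\<in>?\<A>. M \<subseteq> E \<longrightarrow> E = M"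
  proof (rule subset_Zorn_nonempty)
    show "?\<A> \<noteq> {}" using B by blast
    fix \<C> assume ne: "\<C> \<noteq> {}" and ch: "subset.chain ?\<A> \<C>"
    have "ip e f = (if e = f then 1 else 0)" if ef: "e \<in> \<Union>\<C>" "f \<in> \<Union>\<C>" for e f
    proof -
      obtain E F where EF: "E \<in> \<C>" "e \<in> E" "F \<in> \<C>" "f \<in> F" using ef by blast
      then have "E \<subseteq> F \<or> F \<subseteq> E" using ch unfolding subset.chain_def by blast
      then obtain G where "G \<in> \<C>" "e \<in> G" "f \<in> G" using EF by blast
      moreover from this have "orthonormal G" using ch by (auto simp: subset.chain_def)
      ultimately show ?thesis using orthonormalD(3) by blast
    qed
    moreover have "\<Union>\<C> \<subseteq> H" using ch by (auto simp: subset.chain_def orthonormal_def)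
    moreover have "B \<subseteq> \<Union>\<C>" using ne ch unfolding subset.chain_def by blast
    ultimately show "\<Union>\<C> \<in> ?\<A>" by (simp add: orthonormal_def)
  qed
  then obtain M where M': "M \<in> ?\<A>" and max': "\<forall>E\<in>?\<A>. M \<subseteq> E \<longrightarrow> E = M"
    by (elim bexE)
  have M: "orthonormal M" "B \<subseteq> M" using M' by simp_all
  have max: "E = M" if "orthonormal E" "B \<subseteq> E" "M \<subseteq> E" for E using max' that by simp
  have "\<exists>z\<in>cvs.span M. vnorm ip (x - z) < \<delta>" if x: "x \<in> H" "\<delta> > 0" for x \<delta>
  proof -
    obtain y where y: "y \<in> H" "\<And>e. e \<in> M \<Longrightarrow> ip (x - y) e = 0"
      "\<And>\<delta>. \<delta> > 0 \<Longrightarrow> \<exists>z\<in>cvs.span M. vnorm ip (y - z) < \<delta>"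
      using exists_residual[OF M(1) x(1)] by metis
    have "x - y = 0"
    proof (rule ccontr)
      assume ne: "x - y \<noteq> 0"
      have rH: "x - y \<in> H" using x y by simp
      define n where "n = vnorm ip (x - y)"
      have n: "n > 0" using vnorm_ge_0[OF rH] vnorm_eq_0D[OF rH] ne by (auto simp: n_def less_le)
      define e where "e = of_real (inverse n) *\<^sub>C (x - y)"
      have e: "e \<in> H" "vnorm ip e = 1"
        using n rH by (simp_all add: e_def vnorm_scale norm_inverse flip: n_def)
      have eo: "ip e f = 0" "ip f e = 0" if "f \<in> M" for f
      proof -
        have f: "f \<in> H" using that orthonormalD(2)[OF M(1)] by blast
        show "ip e f = 0" using y(2)[OF that] rH f by (simp add: e_def ip_scale_left)
        then show "ip f e = 0" using ip_commute[OF e(1) f] by simp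
      qed
      have "e \<notin> M"
      proof
        assume "e \<in> M"
        then have "ip e e = 0" by (rule eo)
        then show False using e by (simp add: ip_self)
      qed
      then have "orthonormal (insert e M)"
        using M(1) e(1) ip_self[OF e(1)] e(2) eo unfolding orthonormal_def by auto
      then show False using max[of "insert e M"] M(2) \<open>e \<notin> M\<close> by blast
    qed
    then show ?thesis using y(3)[OF x(2)] by simp
  qed
  then show ?thesis using that M by (simp add: orthonormal_basis_iff)
qed

subsection \<open>The Hilbert--Schmidt norm of finite rank operators\<close>

text \<open>Expanding T e in \<open>B\<close> and using the adjoint turns the sum over e into a
  finite sum over f in \<open>B\<close> of Parseval sums for S f. The value does not mention
  \<open>E\<close>, which is the basis independence behind \<open>hs_norm\<close>.\<close>

lemma hs_has_sum:
  assumes E: "orthonormal_basis H ip E" and B: "orthonormal B" "finite B"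
    and T: "\<And>x. x \<in> H \<Longrightarrow> T x \<in> cvs.span B"
    and S: "\<And>x. x \<in> H \<Longrightarrow> S x \<in> H" and adj: "is_adjoint H ip T S"
  shows "((\<lambda>e. (vnorm ip (T e))\<^sup>2) has_sum (\<Sum>f\<in>B. (vnorm ip (S f))\<^sup>2)) E"
proof -
  have EH: "e \<in> H" if "e \<in> E" for e using E that by (auto simp: orthonormal_basis_def)
  have BH: "f \<in> H" if "f \<in> B" for f using orthonormalD(2)[OF B(1) that] .
  have TH: "T e \<in> H" if "e \<in> E" for e
    using span_in_H[OF orthonormalD(1)[OF B(1)]] T[OF EH[OF that]] .
  have "((\<lambda>e. \<Sum>f\<in>B. (cmod (ip (S f) e))\<^sup>2) has_sum (\<Sum>f\<in>B. (vnorm ip (S f))\<^sup>2)) E"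
    using B(2) parseval[OF E S[OF BH]]
    by (induction B rule: finite_induct) (auto intro!: has_sum_add)
  moreover have "(\<Sum>f\<in>B. (cmod (ip (S f) e))\<^sup>2) = (vnorm ip (T e))\<^sup>2" if "e \<in> E" for e
  proof -
    have "(vnorm ip (T e))\<^sup>2 = (\<Sum>f\<in>B. (cmod (ip (T e) f))\<^sup>2)"
      using vnorm_sq_span[OF B T[OF EH[OF that]]] .
    also have "\<dots> = (\<Sum>f\<in>B. (cmod (ip (S f) e))\<^sup>2)"
      using adj EH[OF that] BH S
      by (intro sum.cong) (auto simp: is_adjoint_def intro: cmod_ip_commute)
    finally show ?thesis by simp
  qed
  ultimately show ?thesis by (subst (asm) has_sum_cong) auto
qed

lemma hs_norm_eq:
  assumes B: "orthonormal B" "finite B" and T: "\<And>x. x \<in> H \<Longrightarrow> T x \<in> cvs.span B"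
    and S: "\<And>x. x \<in> H \<Longrightarrow> S x \<in> H" and adj: "is_adjoint H ip T S"
  shows "hs_norm H ip T = sqrt (\<Sum>f\<in>B. (vnorm ip (S f))\<^sup>2)"
proof -
  \<comment> \<open>At least one basis must exist: otherwise every real number would satisfy the
    description in \<open>hs_norm\<close> and the value would be undetermined.\<close>
  obtain E where E: "orthonormal_basis H ip E"
    using orthonormal_basis_extend[OF B(1)] by blast
  have v: "(\<Sum>\<^sub>\<infinity>e\<in>E. (vnorm ip (T e))\<^sup>2) = (\<Sum>f\<in>B. (vnorm ip (S f))\<^sup>2)"
    if "orthonormal_basis H ip E" for E
    using hs_has_sum[OF that B T S adj] by (simp add: infsumI)
  show ?thesis unfolding hs_norm_def
    by (rule the_equality) (use v E in auto)
qed

lemma hs_norm_eq_infsum: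
  assumes E: "orthonormal_basis H ip E" and B: "orthonormal B" "finite B"
    and T: "\<And>x. x \<in> H \<Longrightarrow> T x \<in> cvs.span B"
    and S: "\<And>x. x \<in> H \<Longrightarrow> S x \<in> H" and adj: "is_adjoint H ip T S"
  shows "((\<lambda>e. (vnorm ip (T e))\<^sup>2) has_sum (hs_norm H ip T)\<^sup>2) E"
proof -
  have "(\<Sum>f\<in>B. (vnorm ip (S f))\<^sup>2) \<ge> 0" by (intro sum_nonneg) simp
  then show ?thesis using hs_has_sum[OF assms] hs_norm_eq[OF B T S adj] by simp
qed

lemma proj_self_adjoint:
  assumes B: "orthonormal B" and x: "x \<in> H" and y: "y \<in> H"
  shows "ip (proj B x) y = ip x (proj B y)"
proof -
  have e: "ip e y = cnj (ip y e)" "e \<in> H" if "e \<in> B" for e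
    using ip_commute[OF y orthonormalD(2)[OF B that]] orthonormalD(2)[OF B that] by auto
  show ?thesis
    using e(2) x y unfolding proj_def
    by (simp add: ip_sum_left ip_sum_right ip_scale_left ip_scale_right)
      (intro sum.cong, auto simp: e(1))
qed

text \<open>Gram--Schmidt on a basis of the range gives \<open>B\<close>. Self-adjointness and P e =
  e identify the coefficients of P x with those of x.\<close>

lemma finite_rank_projection_basis:
  assumes P: "finite_rank_projection H ip P"
  obtains B where "orthonormal B" "finite B" "\<And>x. x \<in> H \<Longrightarrow> P x = proj B x"
proof -
  have PH: "P x \<in> H" if "x \<in> H" for x
    using P that by (simp add: finite_rank_projection_def bounded_operators_def)
  have PP: "P (P x) = P x" for x
    using P by (metis comp_apply finite_rank_projection_def)
  have adj: "ip (P x) y = ip x (P y)" if "x \<in> H" "y \<in> H" for x y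
    using P that by (simp add: finite_rank_projection_def is_adjoint_def)
  have sub: "cvs.subspace (P ` H)"
  proof -
    have "P 0 = 0" "\<And>x y. x \<in> H \<Longrightarrow> y \<in> H \<Longrightarrow> P (x + y) = P x + P y"
      "\<And>c x. x \<in> H \<Longrightarrow> P (c *\<^sub>C x) = c *\<^sub>C P x"
      using P PH[of 0] cvs.scale_zero_left[of "0 :: 'v"] cvs.scale_zero_left[of "P 0"]
      unfolding finite_rank_projection_def bounded_operators_def
      by (auto, metis cvs.scale_zero_left mem_H(1))
    then show ?thesis
      unfolding cvs.subspace_def image_iff Ball_def
      by (metis imageE image_eqI mem_H(1,2,4))
  qed
  obtain S where S: "S \<subseteq> P ` H" "cvs.independent S" "P ` H \<subseteq> cvs.span S"
    by (rule cvs.maximal_independent_subset)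
  obtain C where "finite C" "P ` H \<subseteq> cvs.span C"
    using P by (auto simp: finite_rank_projection_def finite_dimensional_def)
  then have finS: "finite S" using cvs.independent_span_bound[of C S] S by blast
  obtain B where B: "orthonormal B" "finite B" "cvs.span B = cvs.span S"
    using gram_schmidt[OF finS] S(1) PH by blast
  have spS: "cvs.span S = P ` H" using S cvs.span_minimal[OF S(1) sub] by blast
  have Pe: "P e = e" if "e \<in> B" for e
    using cvs.span_base[OF that] B(3) spS PP by auto
  show thesis
  proof (rule that[OF B(1,2)])
    fix x assume x: "x \<in> H"
    have "P x \<in> cvs.span B" using x B(3) spS by blast
    then have "P x = proj B (P x)" using proj_eq_self[OF B(1,2)] by simp
    also have "\<dots> = proj B x"
      unfolding proj_def using adj[OF x] orthonormalD(2)[OF B(1)] Pe by (intro sum.cong) auto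
    finally show "P x = proj B x" .
  qed
qed

lemma hs_norm_projection:
  assumes B: "orthonormal B" "finite B" and P: "\<And>x. x \<in> H \<Longrightarrow> P x = proj B x"
  shows "hs_norm H ip P = sqrt (card B)"
proof -
  have "is_adjoint H ip P P" using proj_self_adjoint[OF B(1)] P by (simp add: is_adjoint_def)
  then have "hs_norm H ip P = sqrt (\<Sum>f\<in>B. (vnorm ip (P f))\<^sup>2)"
    using B P by (intro hs_norm_eq) (auto simp: proj_in_span)
  also have "(\<Sum>f\<in>B. (vnorm ip (P f))\<^sup>2) = (\<Sum>f\<in>B. 1)"
    using proj_eq_self[OF B cvs.span_base] P orthonormalD[OF B(1)] by (intro sum.cong) auto
  finally show ?thesis by simp
qed

text \<open>TP - PT splits into (1-P)TP and -PT(1-P), which live on the basis vectors inside and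
  outside \<open>B\<close>. The norm of the second equals that of its adjoint (1-P)SP up to sign, so
  only the leakage of T and of its adjoint out of the range of P has to be estimated.\<close>

lemma hs_norm_commutator:
  assumes B: "orthonormal B" "finite B" and P: "\<And>x. x \<in> H \<Longrightarrow> P x = proj B x"
    and T: "T \<in> bounded_operators H ip" "S \<in> bounded_operators H ip" "is_adjoint H ip T S"
  shows "hs_norm H ip ((T \<circ> P) - (P \<circ> T)) =
    sqrt ((\<Sum>e\<in>B. (vnorm ip (T e - proj B (T e)))\<^sup>2) + (\<Sum>e\<in>B. (vnorm ip (S e - proj B (S e)))\<^sup>2))"
proof -
  let ?D = "(T \<circ> P) - (P \<circ> T)"
  have TH: "T x \<in> H" "S x \<in> H" if "x \<in> H" for x
    using T that by (simp_all add: bounded_operators_def)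
  have Tadd: "T (x + y) = T x + T y" if "x \<in> H" "y \<in> H" for x y
    using T that by (simp add: bounded_operators_def)
  have Tsc: "T (c *\<^sub>C x) = c *\<^sub>C T x" if "x \<in> H" for c x
    using T that by (simp add: bounded_operators_def)
  have T0: "T 0 = 0" using Tsc[of 0 0] by simp
  have adj: "ip (T x) y = ip x (S y)" if "x \<in> H" "y \<in> H" for x y
    using T(3) that by (simp add: is_adjoint_def)
  note BD = orthonormalD[OF B(1)]
  have TB: "T ` B \<subseteq> H" using TH BD by auto
  \<comment> \<open>\<open>C\<close> spans a finite dimensional space containing the range of the
    commutator, as needed for its Hilbert--Schmidt norm to be meaningful.\<close>
  obtain C where C: "orthonormal C" "finite C" "cvs.span C = cvs.span (B \<union> T ` B)"
    using gram_schmidt[of "B \<union> T ` B"] B(2) TB BD(1) by auto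
  have Tsp: "T x \<in> cvs.span (T ` B)" if "x \<in> cvs.span B" for x
    using linear_image_span[OF subspace BD(1) Tadd Tsc that] by blast
  have Dr: "?D x \<in> cvs.span C" if "x \<in> H" for x
  proof -
    have "T (proj B x) \<in> cvs.span C" "proj B (T x) \<in> cvs.span C"
      using Tsp[OF proj_in_span[of B x]] proj_in_span[of B "T x"] C(3)
        cvs.span_mono[of B "B \<union> T ` B"] cvs.span_mono[of "T ` B" "B \<union> T ` B"] by auto
    then show ?thesis using that TH by (simp add: P cvs.span_diff)
  qed
  have PH: "P x \<in> H" if "x \<in> H" for x using P that B by simp
  have Dadj: "is_adjoint H ip ?D ((P \<circ> S) - (S \<circ> P))"
    using TH PH by (simp add: is_adjoint_def ip_diff_left ip_diff_right adj)
      (simp add: P adj proj_self_adjoint[OF B(1)] TH B)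
  obtain E where E: "B \<subseteq> E" "orthonormal_basis H ip E"
    using orthonormal_basis_extend[OF B(1)] .
  have onE: "orthonormal E" using E by (simp add: orthonormal_basis_iff)
  have DaH: "((P \<circ> S) - (S \<circ> P)) x \<in> H" if "x \<in> H" for x using TH PH that by simp
  have h0: "hs_norm H ip ?D \<ge> 0"
    using hs_norm_eq[OF C(1,2) Dr DaH Dadj] by (simp add: sum_nonneg)
  have hs_sum: "((\<lambda>e. (vnorm ip (?D e))\<^sup>2) has_sum (hs_norm H ip ?D)\<^sup>2) E"
    by (rule hs_norm_eq_infsum[OF E(2) C(1,2) Dr DaH Dadj])
  have "((\<lambda>e. (vnorm ip (?D e))\<^sup>2) has_sum
      ((\<Sum>e\<in>B. (vnorm ip (T e - proj B (T e)))\<^sup>2) + (\<Sum>e\<in>B. (vnorm ip (S e - proj B (S e)))\<^sup>2))) (B \<union> (E - B))"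
  proof (rule has_sum_Un_disjoint)
    have "(\<Sum>e\<in>B. (vnorm ip (?D e))\<^sup>2) = (\<Sum>e\<in>B. (vnorm ip (T e - proj B (T e)))\<^sup>2)"
      using BD TH proj_eq_self[OF B cvs.span_base] by (intro sum.cong) (auto simp: P)
    then show "((\<lambda>e. (vnorm ip (?D e))\<^sup>2) has_sum (\<Sum>e\<in>B. (vnorm ip (T e - proj B (T e)))\<^sup>2)) B"
      using B(2) by (intro has_sum_finiteI) auto
    have eq: "(vnorm ip (?D e))\<^sup>2 = (\<Sum>f\<in>B. (cmod (ip (S f) e))\<^sup>2)" if e: "e \<in> E - B" for e
    proof -
      have eH: "e \<in> H" using e orthonormalD(2)[OF onE] by blast
      have "proj B e = 0"
        unfolding proj_def using orthonormalD(3)[OF onE, of e] e E(1)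
        by (intro sum.neutral) (auto simp: subset_iff)
      then have "?D e = - proj B (T e)" using eH TH T0 by (simp add: P)
      then have "vnorm ip (?D e) = vnorm ip (proj B (T e))"
        using vnorm_scale[of "proj B (T e)" "-1"] B by (simp add: cvs.scale_minus_left scaleC_one)
      then have "(vnorm ip (?D e))\<^sup>2 = (\<Sum>f\<in>B. (cmod (ip (T e) f))\<^sup>2)"
        using vnorm_proj[OF B TH(1)[OF eH]] by simp
      also have "\<dots> = (\<Sum>f\<in>B. (cmod (ip (S f) e))\<^sup>2)"
        using adj[OF eH] BD TH eH by (intro sum.cong) (auto intro: cmod_ip_commute)
      finally show ?thesis .
    qed
    have hs: "((\<lambda>e. (cmod (ip (S f) e))\<^sup>2) has_sum (vnorm ip (S f - proj B (S f)))\<^sup>2) (E - B)"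
      if f: "f \<in> B" for f
    proof -
      have SH: "S f \<in> H" using TH BD f by blast
      have p: "((\<lambda>e. (cmod (ip (S f) e))\<^sup>2) has_sum (vnorm ip (S f))\<^sup>2) E"
        using parseval[OF E(2) SH] .
      have "((\<lambda>e. (cmod (ip (S f) e))\<^sup>2) has_sum
          ((vnorm ip (S f))\<^sup>2 - (\<Sum>e\<in>B. (cmod (ip (S f) e))\<^sup>2))) (E - B)"
        by (rule has_sum_Diff[OF p has_sum_finite[OF B(2)] E(1)])
      then show ?thesis using vnorm_decompose[OF B SH] by simp
    qed
    have "((\<lambda>e. \<Sum>f\<in>B. (cmod (ip (S f) e))\<^sup>2) has_sum
        (\<Sum>f\<in>B. (vnorm ip (S f - proj B (S f)))\<^sup>2)) (E - B)"
      using B(2) hs by (rule has_sum_finite_sum)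
    then show "((\<lambda>e. (vnorm ip (?D e))\<^sup>2) has_sum
        (\<Sum>e\<in>B. (vnorm ip (S e - proj B (S e)))\<^sup>2)) (E - B)"
      using eq by (subst has_sum_cong) auto
  qed auto
  moreover have "B \<union> (E - B) = E" using E(1) by blast
  ultimately have "((\<lambda>e. (vnorm ip (?D e))\<^sup>2) has_sum
      ((\<Sum>e\<in>B. (vnorm ip (T e - proj B (T e)))\<^sup>2) + (\<Sum>e\<in>B. (vnorm ip (S e - proj B (S e)))\<^sup>2))) E"
    by (simp only:)
  from has_sum_unique[OF hs_sum this] have eq: "(hs_norm H ip ?D)\<^sup>2 =
      (\<Sum>e\<in>B. (vnorm ip (T e - proj B (T e)))\<^sup>2) + (\<Sum>e\<in>B. (vnorm ip (S e - proj B (S e)))\<^sup>2)"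
    .
  show ?thesis by (rule real_sqrt_unique[OF eq h0, symmetric])
qed

section \<open>Rank estimates for almost commuting projections\<close>

text \<open>
  Both \<open>V 0\<close> and \<open>V 1\<close> carry the part of \<open>P\<close> over \<open>p\<close> almost isometrically into orthogonal pieces of
  itself, so that part is small and the rank of \<open>P\<close> is controlled by its part over \<open>q\<close>.
\<close>

lemma projection_rank_bound:
  assumes B: "orthonormal B" "finite B" and P: "\<And>x. x \<in> H \<Longrightarrow> P x = proj B x"
    and V: "\<And>i. i < 2 \<Longrightarrow> V i \<in> bounded_operators H ip" "\<And>i. i < 2 \<Longrightarrow> S i \<in> bounded_operators H ip"
      "\<And>i. i < 2 \<Longrightarrow> is_adjoint H ip (V i) (S i)"
    and iso: "\<And>i x. i < 2 \<Longrightarrow> x \<in> H \<Longrightarrow> vnorm ip (V i x) = vnorm ip (p x)"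
    and orth: "\<And>x. x \<in> H \<Longrightarrow> (vnorm ip (S 0 x))\<^sup>2 + (vnorm ip (S 1 x))\<^sup>2 \<le> (vnorm ip (p x))\<^sup>2"
    and pq: "\<And>x. x \<in> H \<Longrightarrow> (vnorm ip x)\<^sup>2 = (vnorm ip (p x))\<^sup>2 + (vnorm ip (q x))\<^sup>2"
    and q: "(\<Sum>e\<in>B. (vnorm ip (q e))\<^sup>2) \<le> M"
    and hs: "\<And>i. i < (2::nat) \<Longrightarrow> hs_norm H ip ((V i \<circ> P) - (P \<circ> V i)) \<le> \<epsilon> * hs_norm H ip P"
    and eps: "\<epsilon> \<ge> 0"
  shows "(1 - 2 * \<epsilon>\<^sup>2) * card B \<le> M"
proof -
  \<comment> \<open>\<open>a\<close> is the part of the trace of P lying over \<open>p\<close>; the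
    rank of P is \<open>a\<close> plus the part over \<open>q\<close>.\<close>
  define a where "a = (\<Sum>e\<in>B. (vnorm ip (p e))\<^sup>2)"
  have a_le: "a \<le> (\<Sum>e\<in>B. (vnorm ip (S i e))\<^sup>2) + \<epsilon>\<^sup>2 * card B" if i: "i < 2" for i
  proof -
    have VH: "V i e \<in> H" "S i e \<in> H" if "e \<in> B" for e
      using V(1,2)[OF i] orthonormalD(2)[OF B(1) that] by (simp_all add: bounded_operators_def)
    let ?h = "hs_norm H ip ((V i \<circ> P) - (P \<circ> V i))"
    have h: "?h = sqrt ((\<Sum>e\<in>B. (vnorm ip (V i e - proj B (V i e)))\<^sup>2)
        + (\<Sum>e\<in>B. (vnorm ip (S i e - proj B (S i e)))\<^sup>2))"
      using hs_norm_commutator[OF B P V(1)[OF i] V(2)[OF i] V(3)[OF i]] .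
    then have h0: "?h \<ge> 0" by (simp add: sum_nonneg)
    have h2: "?h\<^sup>2 = (\<Sum>e\<in>B. (vnorm ip (V i e - proj B (V i e)))\<^sup>2)
        + (\<Sum>e\<in>B. (vnorm ip (S i e - proj B (S i e)))\<^sup>2)"
      unfolding h by (simp add: sum_nonneg)
    have "?h\<^sup>2 \<le> (\<epsilon> * hs_norm H ip P)\<^sup>2" using hs[OF i] h0 by (intro power_mono)
    also have "\<dots> = \<epsilon>\<^sup>2 * card B"
      by (simp add: hs_norm_projection[OF B P] power_mult_distrib)
    finally have 1: "(\<Sum>e\<in>B. (vnorm ip (V i e - proj B (V i e)))\<^sup>2) \<le> \<epsilon>\<^sup>2 * card B"
      using h2 sum_nonneg[of B "\<lambda>e. (vnorm ip (S i e - proj B (S i e)))\<^sup>2"] by simp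
    \<comment> \<open>The compressions P V P and P S P are adjoint to each other and have the same
      Hilbert--Schmidt norm; Bessel then discards the compression on the side of S.\<close>
    have "(\<Sum>e\<in>B. \<Sum>f\<in>B. (cmod (ip (V i e) f))\<^sup>2) = (\<Sum>f\<in>B. \<Sum>e\<in>B. (cmod (ip (S i f) e))\<^sup>2)"
      using V(3)[OF i] orthonormalD(2)[OF B(1)] VH
      by (subst sum.swap, intro sum.cong)
        (auto simp: is_adjoint_def intro!: cmod_ip_commute)
    also have "\<dots> \<le> (\<Sum>f\<in>B. (vnorm ip (S i f))\<^sup>2)"
      using bessel[OF B] VH by (intro sum_mono) auto
    finally have 2: "(\<Sum>e\<in>B. \<Sum>f\<in>B. (cmod (ip (V i e) f))\<^sup>2) \<le> (\<Sum>f\<in>B. (vnorm ip (S i f))\<^sup>2)" .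
    have "a = (\<Sum>e\<in>B. (vnorm ip (V i e))\<^sup>2)"
      unfolding a_def using iso[OF i] orthonormalD(2)[OF B(1)] by simp
    also have "\<dots> = (\<Sum>e\<in>B. \<Sum>f\<in>B. (cmod (ip (V i e) f))\<^sup>2)
        + (\<Sum>e\<in>B. (vnorm ip (V i e - proj B (V i e)))\<^sup>2)"
      using vnorm_decompose[OF B] VH by (simp add: sum.distrib flip: sum.distrib)
    finally show ?thesis using 1 2 by linarith
  qed
  have "(\<Sum>e\<in>B. (vnorm ip (S 0 e))\<^sup>2) + (\<Sum>e\<in>B. (vnorm ip (S 1 e))\<^sup>2) \<le> a"
    unfolding a_def sum.distrib[symmetric] using orth orthonormalD(2)[OF B(1)] by (intro sum_mono) auto
  \<comment> \<open>Adding the bounds for i = 0 and i = 1 gives 2a \<le> a + 2 \<epsilon>^2 rank P,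
    because the two adjoints together see at most the part over \<open>p\<close>.\<close>
  then have a: "a \<le> 2 * \<epsilon>\<^sup>2 * card B" using a_le[of 0] a_le[of 1] by simp
  have "real (card B) = (\<Sum>e\<in>B. (vnorm ip e)\<^sup>2)" using orthonormalD(4)[OF B(1)] by simp
  also have "\<dots> = a + (\<Sum>e\<in>B. (vnorm ip (q e))\<^sup>2)"
    unfolding a_def sum.distrib[symmetric] using pq orthonormalD(2)[OF B(1)] by (intro sum.cong) auto
  finally show ?thesis using a q by (simp add: algebra_simps)
qed

text \<open>The left side is the trace of qPq when q is a projection, and it is at most the rank of
  q. The range of q is known only to lie in the closure of the span of \<open>K\<close>; that
  suffices to expand q x in an orthonormal basis \<open>C\<close> of this span and to apply Bessel
  to each q f, of norm at most 1.\<close>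

lemma sum_vnorm_projection_le_card:
  assumes B: "orthonormal B" "finite B" and K: "finite K" "K \<subseteq> H"
    and qb: "\<And>x. x \<in> H \<Longrightarrow> q x \<in> H" and qsa: "is_adjoint H ip q q"
    and qc: "\<And>x. x \<in> H \<Longrightarrow> vnorm ip (q x) \<le> vnorm ip x"
    and dense: "\<And>x \<delta>. x \<in> H \<Longrightarrow> \<delta> > 0 \<Longrightarrow> \<exists>k\<in>cvs.span K. vnorm ip (q x - k) < \<delta>"
  shows "(\<Sum>e\<in>B. (vnorm ip (q e))\<^sup>2) \<le> card K"
proof -
  obtain C where C: "orthonormal C" "finite C" "card C \<le> card K" "cvs.span C = cvs.span K"
    using gram_schmidt[OF K] by blast
  have BH: "e \<in> H" if "e \<in> B" for e using orthonormalD(2)[OF B(1) that] .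
  have CH: "f \<in> H" "vnorm ip f = 1" if "f \<in> C" for f using orthonormalD[OF C(1)] that by auto
  have "(vnorm ip (q x))\<^sup>2 \<le> (\<Sum>f\<in>C. (cmod (ip (q f) x))\<^sup>2)" if x: "x \<in> H" for x
  proof (rule field_le_epsilon)
    fix \<delta> :: real assume "\<delta> > 0"
    then obtain k where k: "k \<in> cvs.span C" "vnorm ip (q x - k) < sqrt \<delta>"
      using dense[OF x, of "sqrt \<delta>"] C(4) by auto
    have kH: "k \<in> H" using span_in_H[OF orthonormalD(1)[OF C(1)] k(1)] .
    have "(vnorm ip (q x - k))\<^sup>2 \<le> (sqrt \<delta>)\<^sup>2" using k(2) kH qb x by (intro power_mono) auto
    then have "(vnorm ip (q x))\<^sup>2 \<le> (\<Sum>f\<in>C. (cmod (ip (q x) f))\<^sup>2) + \<delta>"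
      using vnorm_decompose[OF C(1,2) qb[OF x]] best_approximation[OF C(1,2) qb[OF x] k(1)] \<open>\<delta> > 0\<close>
      by simp
    also have "(\<Sum>f\<in>C. (cmod (ip (q x) f))\<^sup>2) = (\<Sum>f\<in>C. (cmod (ip (q f) x))\<^sup>2)"
    proof (rule sum.cong)
      fix f assume f: "f \<in> C"
      have "ip (q f) x = cnj (ip (q x) f)"
        using qsa x CH(1)[OF f] ip_commute[OF x qb[OF CH(1)[OF f]]] by (simp add: is_adjoint_def)
      then show "(cmod (ip (q x) f))\<^sup>2 = (cmod (ip (q f) x))\<^sup>2" by simp
    qed simp
    finally show "(vnorm ip (q x))\<^sup>2 \<le> (\<Sum>f\<in>C. (cmod (ip (q f) x))\<^sup>2) + \<delta>" .
  qed
  then have "(\<Sum>e\<in>B. (vnorm ip (q e))\<^sup>2) \<le> (\<Sum>e\<in>B. \<Sum>f\<in>C. (cmod (ip (q f) e))\<^sup>2)"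
    using BH by (intro sum_mono) auto
  also have "\<dots> = (\<Sum>f\<in>C. \<Sum>e\<in>B. (cmod (ip (q f) e))\<^sup>2)" by (rule sum.swap)
  also have "\<dots> \<le> (\<Sum>f\<in>C. 1)"
  proof (rule sum_mono)
    fix f assume f: "f \<in> C"
    have "(\<Sum>e\<in>B. (cmod (ip (q f) e))\<^sup>2) \<le> (vnorm ip (q f))\<^sup>2"
      using bessel[OF B qb[OF CH(1)[OF f]]] .
    also have "\<dots> \<le> 1\<^sup>2" using qc[OF CH(1)[OF f]] CH[OF f] qb by (intro power_mono) auto
    finally show "(\<Sum>e\<in>B. (cmod (ip (q f) e))\<^sup>2) \<le> 1" by simp
  qed
  also have "\<dots> \<le> card K" using C(3) by simp
  finally show ?thesis .
qed

subsection \<open>Bounded operators\<close>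

lemma bounded_opD:
  assumes "T \<in> bounded_operators H ip"
  shows "x \<in> H \<Longrightarrow> T x \<in> H" "x \<notin> H \<Longrightarrow> T x = 0" "T 0 = 0"
    "x \<in> H \<Longrightarrow> y \<in> H \<Longrightarrow> T (x + y) = T x + T y" "x \<in> H \<Longrightarrow> T (c *\<^sub>C x) = c *\<^sub>C T x"
    "x \<in> H \<Longrightarrow> y \<in> H \<Longrightarrow> T (x - y) = T x - T y"
    "(\<And>i. i \<in> A \<Longrightarrow> f i \<in> H) \<Longrightarrow> T (sum f A) = (\<Sum>i\<in>A. T (f i))"
proof -
  show *: "T (c *\<^sub>C x) = c *\<^sub>C T x" if "x \<in> H" for x c
    using assms that by (simp add: bounded_operators_def)
  show T0: "T 0 = 0" using *[of 0 0] by simp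
  show add: "T (x + y) = T x + T y" if "x \<in> H" "y \<in> H" for x y
    using assms that by (simp add: bounded_operators_def)
  show "T (x - y) = T x - T y" if "x \<in> H" "y \<in> H"
    using add[of "x - y" y] that by (simp add: eq_diff_eq)
  show "T (sum f A) = (\<Sum>i\<in>A. T (f i))" if "\<And>i. i \<in> A \<Longrightarrow> f i \<in> H"
    using that by (induction A rule: infinite_finite_induct) (simp_all add: T0 add)
qed (use assms in \<open>simp_all add: bounded_operators_def\<close>)

lemma bounded_op_bound:
  assumes "T \<in> bounded_operators H ip"
  obtains K where "K > 0" "\<And>x. x \<in> H \<Longrightarrow> vnorm ip (T x) \<le> K * vnorm ip x"
proof -
  obtain K where K: "\<forall>x\<in>H. vnorm ip (T x) \<le> K * vnorm ip x"
    using assms by (auto simp: bounded_operators_def)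
  have "vnorm ip (T x) \<le> max K 1 * vnorm ip x" if "x \<in> H" for x
    using K that mult_right_mono[of K "max K 1" "vnorm ip x"] by fastforce
  then show ?thesis using that[of "max K 1"] by auto
qed

lemma bounded_operatorsI:
  assumes "\<And>x. x \<in> H \<Longrightarrow> T x \<in> H" "\<And>x. x \<notin> H \<Longrightarrow> T x = 0"
    "\<And>x y. x \<in> H \<Longrightarrow> y \<in> H \<Longrightarrow> T (x + y) = T x + T y" "\<And>x c. x \<in> H \<Longrightarrow> T (c *\<^sub>C x) = c *\<^sub>C T x"
    "\<And>x. x \<in> H \<Longrightarrow> vnorm ip (T x) \<le> K * vnorm ip x"
  shows "T \<in> bounded_operators H ip"
  unfolding bounded_operators_def mem_Collect_eq
  by (intro conjI exI[of _ K]) (use assms in simp_all)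

lemma vnorm_triangle:
  assumes "x \<in> H" "y \<in> H"
  shows "vnorm ip (x + y) \<le> vnorm ip x + vnorm ip y"
proof (rule power2_le_imp_le)
  have "Re (ip x y) \<le> vnorm ip x * vnorm ip y"
    using cauchy_schwarz[OF assms] complex_Re_le_cmod order_trans by blast
  moreover have "Re (ip y x) = Re (ip x y)" using ip_commute[OF assms] by simp
  ultimately show "(vnorm ip (x + y))\<^sup>2 \<le> (vnorm ip x + vnorm ip y)\<^sup>2"
    using assms by (simp add: vnorm_sq ip_add_left ip_add_right power2_sum)
qed (use assms in simp)

lemma bounded_op_add:
  assumes T: "T \<in> bounded_operators H ip" and S: "S \<in> bounded_operators H ip"
  shows "T + S \<in> bounded_operators H ip"
proof -
  obtain K L where KL: "\<And>x. x \<in> H \<Longrightarrow> vnorm ip (T x) \<le> K * vnorm ip x"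
    "\<And>x. x \<in> H \<Longrightarrow> vnorm ip (S x) \<le> L * vnorm ip x"
    using bounded_op_bound[OF T] bounded_op_bound[OF S] by metis
  have "vnorm ip (T x + S x) \<le> (K + L) * vnorm ip x" if "x \<in> H" for x
    using vnorm_triangle[OF bounded_opD(1)[OF T that] bounded_opD(1)[OF S that]]
      KL(1)[OF that] KL(2)[OF that] unfolding distrib_right by linarith
  then show ?thesis
    by (intro bounded_operatorsI[where K = "K + L"])
      (simp_all add: bounded_opD[OF T] bounded_opD[OF S] cvs.scale_right_distrib)
qed

lemma bounded_op_scale:
  assumes T: "T \<in> bounded_operators H ip"
  shows "c *\<^sub>C T \<in> bounded_operators H ip"
proof -
  obtain K where "\<And>x. x \<in> H \<Longrightarrow> vnorm ip (T x) \<le> K * vnorm ip x"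
    using bounded_op_bound[OF T] by metis
  then show ?thesis
    by (intro bounded_operatorsI[where K = "cmod c * K"])
      (simp_all add: bounded_opD[OF T] cvs.scale_right_distrib vnorm_scale mult_left_mono
        mult.assoc mult.commute[of c] cvs.scale_scale)
qed

lemma bounded_op_zero: "0 \<in> bounded_operators H ip"
  by (intro bounded_operatorsI[where K = 0]) simp_all

lemma bounded_op_subspace: "cvs.subspace (bounded_operators H ip)"
  by (simp add: cvs.subspace_def bounded_op_zero bounded_op_add bounded_op_scale)

lemma bounded_op_comp:
  assumes T: "T \<in> bounded_operators H ip" and S: "S \<in> bounded_operators H ip"
  shows "T \<circ> S \<in> bounded_operators H ip"
proof -
  obtain K L where KL: "K > 0" "\<And>x. x \<in> H \<Longrightarrow> vnorm ip (T x) \<le> K * vnorm ip x"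
    "\<And>x. x \<in> H \<Longrightarrow> vnorm ip (S x) \<le> L * vnorm ip x"
    using bounded_op_bound[OF T] bounded_op_bound[OF S] by metis
  have "vnorm ip (T (S x)) \<le> (K * L) * vnorm ip x" if "x \<in> H" for x
    using KL(2)[OF bounded_opD(1)[OF S that]] mult_left_mono[OF KL(3)[OF that], of K] KL(1)
    unfolding mult.assoc by linarith
  then show ?thesis
    by (intro bounded_operatorsI[where K = "K * L"])
      (simp_all add: bounded_opD[OF T] bounded_opD[OF S])
qed

lemma id_op_bounded: "id_op H \<in> bounded_operators H ip"
  by (intro bounded_operatorsI[where K = 1]) (simp_all add: id_op_def)

lemma adjoint_unique:
  assumes S: "S \<in> bounded_operators H ip" "is_adjoint H ip T S"
    and S': "S' \<in> bounded_operators H ip" "is_adjoint H ip T S'"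
    and T: "T \<in> bounded_operators H ip"
  shows "S = S'"
proof
  fix y
  show "S y = S' y"
  proof (cases "y \<in> H")
    case True
    then have m: "S y \<in> H" "S' y \<in> H" using bounded_opD S S' by auto
    let ?z = "S y - S' y"
    have z: "?z \<in> H" using m by simp
    have "ip ?z (S y) = ip ?z (S' y)"
      using S(2) S'(2) z True unfolding is_adjoint_def by metis
    then have "ip ?z ?z = 0" using z m by (simp add: ip_diff_right)
    then show ?thesis using ip_definite[OF z] by simp
  qed (simp add: bounded_opD(2)[OF S(1)] bounded_opD(2)[OF S'(1)])
qed

lemma adjoint_op_eq:
  assumes "S \<in> bounded_operators H ip" "is_adjoint H ip T S" "T \<in> bounded_operators H ip"
  shows "adjoint_op H ip T = S"
  unfolding adjoint_op_def using adjoint_unique assms by (intro the_equality) blast+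

lemma adjoint_bound:
  assumes adj: "is_adjoint H ip T S" and T: "\<And>x. x \<in> H \<Longrightarrow> T x \<in> H" and S: "\<And>x. x \<in> H \<Longrightarrow> S x \<in> H"
    and b: "\<And>x. x \<in> H \<Longrightarrow> vnorm ip (T x) \<le> c * vnorm ip x" and c: "c \<ge> 0" and y: "y \<in> H"
  shows "vnorm ip (S y) \<le> c * vnorm ip y"
proof (cases "vnorm ip (S y) = 0")
  case False
  have SH: "S y \<in> H" "T (S y) \<in> H" using S T y by auto
  have "(vnorm ip (S y))\<^sup>2 = Re (ip (T (S y)) y)"
    using adj y SH by (simp add: vnorm_sq is_adjoint_def)
  also have "\<dots> \<le> vnorm ip (T (S y)) * vnorm ip y"
    using cauchy_schwarz[OF SH(2) y] complex_Re_le_cmod order_trans by blast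
  also have "\<dots> \<le> c * vnorm ip (S y) * vnorm ip y"
    using b[OF SH(1)] y by (intro mult_right_mono) auto
  finally have "vnorm ip (S y) * vnorm ip (S y) \<le> vnorm ip (S y) * (c * vnorm ip y)"
    by (simp add: power2_eq_square mult_ac)
  then show ?thesis using False vnorm_ge_0[OF SH(1)] by simp
qed (use c y in simp)

lemma op_norm_bound:
  assumes T: "T \<in> bounded_operators H ip" and x: "x \<in> H"
  shows "vnorm ip (T x) \<le> op_norm H ip T * vnorm ip x"
proof -
  obtain K where K: "K > 0" "\<And>x. x \<in> H \<Longrightarrow> vnorm ip (T x) \<le> K * vnorm ip x"
    using bounded_op_bound[OF T] by metis
  have bdd: "bdd_above ((\<lambda>x. vnorm ip (T x)) ` {x \<in> H. vnorm ip x \<le> 1})"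
  proof (rule bdd_aboveI[of _ K])
    fix r assume "r \<in> (\<lambda>x. vnorm ip (T x)) ` {x \<in> H. vnorm ip x \<le> 1}"
    then obtain y where y: "y \<in> H" "vnorm ip y \<le> 1" "r = vnorm ip (T y)" by auto
    have "K * vnorm ip y \<le> K * 1" using y K(1) by (intro mult_left_mono) auto
    then show "r \<le> K" using K(2)[OF y(1)] y(3) by simp
  qed
  show ?thesis
  proof (cases "vnorm ip x = 0")
    case True
    then have "x = 0" using vnorm_eq_0D x by blast
    then show ?thesis by (simp add: bounded_opD[OF T])
  next
    case False
    then have n: "vnorm ip x > 0" using vnorm_ge_0[OF x] by linarith
    let ?y = "of_real (inverse (vnorm ip x)) *\<^sub>C x"
    have "vnorm ip (T ?y) \<le> op_norm H ip T"
      unfolding op_norm_def using n x by (intro cSUP_upper bdd) (auto simp: vnorm_scale norm_inverse)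
    moreover have "vnorm ip (T ?y) = vnorm ip (T x) / vnorm ip x"
      using x n bounded_opD(1)[OF T x]
      by (simp add: bounded_opD[OF T] vnorm_scale norm_inverse norm_divide divide_simps)
    ultimately show ?thesis using n by (simp add: divide_le_eq)
  qed
qed

lemma op_norm_le:
  assumes "\<And>x. x \<in> H \<Longrightarrow> vnorm ip (T x) \<le> c * vnorm ip x" "c \<ge> 0"
  shows "op_norm H ip T \<le> c"
  unfolding op_norm_def
proof (rule cSUP_least)
  show "{x \<in> H. vnorm ip x \<le> 1} \<noteq> {}" using mem_H(1) vnorm_0 by force
  fix x assume x: "x \<in> {x \<in> H. vnorm ip x \<le> 1}"
  then have "c * vnorm ip x \<le> c * 1" using assms(2) by (intro mult_left_mono) auto
  then show "vnorm ip (T x) \<le> c" using assms(1)[of x] x by simp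
qed

end

section \<open>Square summable functions, adjoints and matrix entries\<close>

section \<open>The Hilbert space of square summable functions\<close>

lemma ell2I_bounded:
  assumes "\<And>x. x \<notin> X \<Longrightarrow> f x = 0"
    and "\<And>F. finite F \<Longrightarrow> F \<subseteq> X \<Longrightarrow> (\<Sum>x\<in>F. (cmod (f x))\<^sup>2) \<le> c"
  shows "f \<in> ell2 X" "(\<Sum>\<^sub>\<infinity>x\<in>X. (cmod (f x))\<^sup>2) \<le> c"
proof -
  have s: "(\<lambda>x. (cmod (f x))\<^sup>2) summable_on X"
    using assms(2) by (intro nonneg_bdd_above_summable_on bdd_aboveI[of _ c]) auto
  then show "f \<in> ell2 X" using assms(1) by (simp add: ell2_def)
  show "(\<Sum>\<^sub>\<infinity>x\<in>X. (cmod (f x))\<^sup>2) \<le> c"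
    using assms(2) by (intro infsum_le_finite_sums[OF s]) auto
qed

lemma ell2_ip_summable:
  assumes "f \<in> ell2 X" "g \<in> ell2 X"
  shows "(\<lambda>x. f x * cnj (g x)) summable_on X"
proof -
  have "(\<lambda>x. norm (f x * cnj (g x))) summable_on X"
  proof (rule summable_on_comparison_test)
    show "(\<lambda>x. (cmod (f x))\<^sup>2 + (cmod (g x))\<^sup>2) summable_on X"
      using assms by (intro summable_on_add) (simp_all add: ell2_def)
    have "cmod a * cmod b \<le> (cmod a)\<^sup>2 + (cmod b)\<^sup>2" for a b
      using sum_squares_bound[of "cmod a" "cmod b"] mult_nonneg_nonneg[of "cmod a" "cmod b"]
      unfolding mult.assoc by (smt (verit) norm_ge_zero)
    then show "norm (f x * cnj (g x)) \<le> (cmod (f x))\<^sup>2 + (cmod (g x))\<^sup>2" if "x \<in> X" for x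
      by (simp add: norm_mult)
  qed simp
  then show ?thesis by (rule abs_summable_summable)
qed

lemma ell2_subspace: "cvs.subspace (ell2 X)"
  unfolding cvs.subspace_def
proof (intro conjI ballI allI)
  show "0 \<in> ell2 X" by (simp add: ell2_def)
next
  fix f g assume fg: "f \<in> ell2 X" "g \<in> ell2 X"
  have "(\<lambda>x. (cmod (f x + g x))\<^sup>2) summable_on X"
  proof (rule summable_on_comparison_test)
    show "(\<lambda>x. 2 * (cmod (f x))\<^sup>2 + 2 * (cmod (g x))\<^sup>2) summable_on X"
      using fg by (intro summable_on_add summable_on_cmult_right) (simp_all add: ell2_def)
    fix x
    have "(cmod (f x + g x))\<^sup>2 \<le> (cmod (f x) + cmod (g x))\<^sup>2"
      by (intro power_mono norm_triangle_ineq) simp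
    also have "\<dots> \<le> 2 * (cmod (f x))\<^sup>2 + 2 * (cmod (g x))\<^sup>2"
      using sum_squares_bound[of "cmod (f x)" "cmod (g x)"] by (simp add: power2_sum)
    finally show "(cmod (f x + g x))\<^sup>2 \<le> 2 * (cmod (f x))\<^sup>2 + 2 * (cmod (g x))\<^sup>2" .
  qed simp
  then show "f + g \<in> ell2 X" using fg by (simp add: ell2_def)
next
  fix f c assume "f \<in> ell2 X"
  then show "c *\<^sub>C f \<in> ell2 X"
    by (auto simp: ell2_def norm_mult scaleC_complex_def power_mult_distrib intro: summable_on_cmult_right)
qed

text \<open>The identity holds for every function: if the squares are not summable, both infinite
  sums take their default value 0.\<close>

lemma ell2_ip_self: "ell2_ip X f f = of_real (\<Sum>\<^sub>\<infinity>x\<in>X. (cmod (f x))\<^sup>2)"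
proof -
  let ?g = "\<lambda>x. (cmod (f x))\<^sup>2"
  have "ell2_ip X f f = (\<Sum>\<^sub>\<infinity>x\<in>X. complex_of_real (?g x))"
    by (simp add: ell2_ip_def complex_norm_square del: of_real_power)
  also have "\<dots> = of_real (infsum ?g X)"
  proof (cases "?g summable_on X")
    case True
    then show ?thesis by (intro infsumI has_sum_of_real has_sum_infsum)
  next
    case False
    then have "\<not> (\<lambda>x. complex_of_real (?g x)) summable_on X"
      using summable_on_Re[of "\<lambda>x. complex_of_real (?g x)" X] by auto
    then show ?thesis using False by (simp add: infsum_not_exists del: of_real_power)
  qed
  finally show ?thesis .
qed

lemma ell2_vnorm_sq: "(vnorm (ell2_ip X) f)\<^sup>2 = (\<Sum>\<^sub>\<infinity>x\<in>X. (cmod (f x))\<^sup>2)"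
  by (simp add: vnorm_def ell2_ip_self infsum_nonneg)

lemma ell2_finite_sum_le:
  assumes "f \<in> ell2 X" "finite F" "F \<subseteq> X"
  shows "(\<Sum>x\<in>F. (cmod (f x))\<^sup>2) \<le> (vnorm (ell2_ip X) f)\<^sup>2"
  unfolding ell2_vnorm_sq using assms by (intro finite_sum_le_infsum) (auto simp: ell2_def)

lemma ell2_cmod_le: "f \<in> ell2 X \<Longrightarrow> cmod (f x) \<le> vnorm (ell2_ip X) f"
proof (cases "x \<in> X")
  case True
  assume "f \<in> ell2 X"
  then have "(cmod (f x))\<^sup>2 \<le> (vnorm (ell2_ip X) f)\<^sup>2"
    using ell2_finite_sum_le[of f X "{x}"] True by simp
  then show ?thesis by (rule power2_le_imp_le) (simp add: vnorm_def ell2_ip_self infsum_nonneg)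
qed (simp add: ell2_def vnorm_def ell2_ip_self infsum_nonneg)

text \<open>Point evaluations are contractive, so the sequence converges pointwise. Bounds on finite
  partial sums of s n - s m survive the limit in m and yield both membership of the limit and
  convergence in norm.\<close>

lemma ell2_complete:
  assumes s: "\<forall>n. s n \<in> ell2 X"
    and c: "\<forall>e>0. \<exists>N. \<forall>m\<ge>N. \<forall>n\<ge>N. vnorm (ell2_ip X) (s m - s n) < e"
  shows "\<exists>l\<in>ell2 X. (\<lambda>n::nat. vnorm (ell2_ip X) (s n - l)) \<longlonglongrightarrow> 0"
proof -
  let ?n = "vnorm (ell2_ip X)"
  have sd: "s m - s n \<in> ell2 X" for m n using s ell2_subspace cvs.subspace_diff by blast
  have n0: "?n f \<ge> 0" for f by (simp add: vnorm_def ell2_ip_self infsum_nonneg)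
  have "Cauchy (\<lambda>n. s n x)" for x
    unfolding Cauchy_def dist_norm
  proof (intro allI impI)
    fix e :: real assume "e > 0"
    then obtain N where N: "\<forall>m\<ge>N. \<forall>n\<ge>N. ?n (s m - s n) < e" using c by blast
    then have "norm (s m x - s n x) < e" if "m \<ge> N" "n \<ge> N" for m n
      using ell2_cmod_le[OF sd, of m n x] that by fastforce
    then show "\<exists>N. \<forall>m\<ge>N. \<forall>n\<ge>N. norm (s m x - s n x) < e" by blast
  qed
  then have "\<forall>x. \<exists>l. (\<lambda>n. s n x) \<longlonglongrightarrow> l" using Cauchy_convergent_iff convergent_def by metis
  then obtain l where l: "\<And>x. (\<lambda>n. s n x) \<longlonglongrightarrow> l x" by metis
  have l0: "l x = 0" if "x \<notin> X" for x
    using l[of x] s that by (simp add: ell2_def LIMSEQ_const_iff)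
  have sum_le: "(\<Sum>x\<in>F. (cmod ((s n - l) x))\<^sup>2) \<le> e\<^sup>2"
    if N: "\<forall>m\<ge>N. \<forall>n\<ge>N. ?n (s m - s n) < e" and n: "n \<ge> N" and F: "finite F" "F \<subseteq> X" for e N n F
  proof (rule LIMSEQ_le_const2)
    show "(\<lambda>m. \<Sum>x\<in>F. (cmod ((s n - s m) x))\<^sup>2) \<longlonglongrightarrow> (\<Sum>x\<in>F. (cmod ((s n - l) x))\<^sup>2)"
      unfolding fun_diff_def by (intro tendsto_intros l)
    have "(\<Sum>x\<in>F. (cmod ((s n - s m) x))\<^sup>2) \<le> e\<^sup>2" if "m \<ge> N" for m
    proof -
      have "?n (s n - s m) \<le> e" using N n that by (simp add: less_imp_le)
      then have "(?n (s n - s m))\<^sup>2 \<le> e\<^sup>2" using n0 by (intro power_mono)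
      then show ?thesis using ell2_finite_sum_le[OF sd F, of n m] by linarith
    qed
    then show "\<exists>M. \<forall>m\<ge>M. (\<Sum>x\<in>F. (cmod ((s n - s m) x))\<^sup>2) \<le> e\<^sup>2" by blast
  qed
  have conv: "s n - l \<in> ell2 X" "?n (s n - l) \<le> e"
    if N: "\<forall>m\<ge>N. \<forall>n\<ge>N. ?n (s m - s n) < e" and n: "n \<ge> N" and e: "e > 0" for e N n
  proof -
    have z: "(s n - l) x = 0" if "x \<notin> X" for x using that l0 s by (simp add: ell2_def)
    show "s n - l \<in> ell2 X" by (rule ell2I_bounded(1), erule z, erule (1) sum_le[OF N n])
    have "(?n (s n - l))\<^sup>2 \<le> e\<^sup>2"
      unfolding ell2_vnorm_sq by (rule ell2I_bounded(2), erule z, erule (1) sum_le[OF N n])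
    then show "?n (s n - l) \<le> e" by (rule power2_le_imp_le) (rule less_imp_le[OF e])
  qed
  show ?thesis
  proof (intro bexI[of _ l] LIMSEQ_I)
    obtain N where N: "\<forall>m\<ge>N. \<forall>n\<ge>N. ?n (s m - s n) < 1" using c zero_less_one by blast
    have "s N - (s N - l) \<in> ell2 X"
      using conv(1)[OF N, of N] s ell2_subspace cvs.subspace_diff by (metis order_refl zero_less_one)
    then show "l \<in> ell2 X" by simp
    fix r :: real assume r: "r > 0"
    then obtain M where M: "\<forall>m\<ge>M. \<forall>n\<ge>M. ?n (s m - s n) < r / 2" using c half_gt_zero by blast
    have "norm (?n (s n - l) - 0) < r" if "n \<ge> M" for n
      using conv(2)[OF M that] r n0[of "s n - l"] by simp
    then show "\<exists>M. \<forall>n\<ge>M. norm (?n (s n - l) - 0) < r" by blast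
  qed
qed

lemma ell2_hilbert: "complex_hilbert_space (ell2 X) (ell2_ip X)"
proof
  show "cvs.subspace (ell2 X)" by (rule ell2_subspace)
  show "ell2_ip X (f + g) h = ell2_ip X f h + ell2_ip X g h"
    if "f \<in> ell2 X" "g \<in> ell2 X" "h \<in> ell2 X" for f g h
    using that by (simp add: ell2_ip_def distrib_right infsum_add ell2_ip_summable)
  show "ell2_ip X (c *\<^sub>C f) g = c * ell2_ip X f g" for c f g
    by (simp add: ell2_ip_def scaleC_complex_def mult.assoc infsum_cmult_right')
  show "ell2_ip X g f = cnj (ell2_ip X f g)" for f g
    unfolding ell2_ip_def infsum_cnj[symmetric] by (simp add: mult.commute)
  show "0 \<le> Re (ell2_ip X f f)" for f by (simp add: ell2_ip_self infsum_nonneg)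
  show "f = 0" if "f \<in> ell2 X" "ell2_ip X f f = 0" for f
  proof
    fix x
    have "vnorm (ell2_ip X) f = 0" using that by (simp add: vnorm_def)
    then show "f x = 0 x" using ell2_cmod_le[OF that(1), of x] by simp
  qed
qed (rule ell2_complete)

interpretation ell2: complex_hilbert_space "ell2 X" "ell2_ip X" for X by (rule ell2_hilbert)

lemma ell2_delta_apply: "ell2_delta x y = (if y = x then 1 else 0)"
  by (simp add: ell2_delta_def)

lemma sum_fun_apply: "sum f A x = (\<Sum>i\<in>A. f i x)"
  by (induction A rule: infinite_finite_induct) simp_all

lemma ell2_finite_support:
  assumes "finite S" "S \<subseteq> X" "\<And>x. x \<notin> S \<Longrightarrow> f x = 0"
  shows "f \<in> ell2 X" "(vnorm (ell2_ip X) f)\<^sup>2 = (\<Sum>x\<in>S. (cmod (f x))\<^sup>2)"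
    "f = (\<Sum>x\<in>S. f x *\<^sub>C ell2_delta x)"
proof -
  have h: "((\<lambda>x. (cmod (f x))\<^sup>2) has_sum (\<Sum>x\<in>S. (cmod (f x))\<^sup>2)) X"
    using assms by (intro has_sum_finite_neutralI[of S]) auto
  then show "f \<in> ell2 X" using assms by (auto simp: ell2_def has_sum_imp_summable)
  show "(vnorm (ell2_ip X) f)\<^sup>2 = (\<Sum>x\<in>S. (cmod (f x))\<^sup>2)"
    using h by (simp add: ell2_vnorm_sq infsumI)
  show "f = (\<Sum>x\<in>S. f x *\<^sub>C ell2_delta x)"
  proof
    fix y
    have "(\<Sum>x\<in>S. f x *\<^sub>C ell2_delta x) y = (\<Sum>x\<in>S. if y = x then f x else 0)"
      unfolding sum_fun_apply
      by (intro sum.cong) (auto simp: scaleC_complex_def ell2_delta_apply)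
    then show "f y = (\<Sum>x\<in>S. f x *\<^sub>C ell2_delta x) y" using assms by simp
  qed
qed

lemma ell2_delta_in [simp, intro]: "x \<in> X \<Longrightarrow> ell2_delta x \<in> ell2 X"
  using ell2_finite_support(1)[of "{x}" X "ell2_delta x"] by (simp add: ell2_delta_apply)

lemma ell2_ip_delta: "x \<in> X \<Longrightarrow> ell2_ip X f (ell2_delta x) = f x"
proof -
  assume x: "x \<in> X"
  have "((\<lambda>y. f y * cnj (ell2_delta x y)) has_sum f x) X"
    using x by (intro has_sum_finite_neutralI[of "{x}"]) (auto simp: ell2_delta_apply)
  then show ?thesis by (simp add: ell2_ip_def infsumI)
qed

lemma ell2_delta_inj: "ell2_delta x = ell2_delta y \<longleftrightarrow> x = y"
  by (auto simp: ell2_delta_def fun_eq_iff split: if_splits)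

lemma ell2_orthonormal: "S \<subseteq> X \<Longrightarrow> ell2.orthonormal X (ell2_delta ` S)"
  by (auto simp: ell2.orthonormal_def ell2_ip_delta ell2_delta_apply ell2_delta_inj subset_iff)

lemma ell2_proj:
  assumes S: "finite S" "S \<subseteq> X"
  shows "ell2.proj X (ell2_delta ` S) f = (\<lambda>x. if x \<in> S then f x else 0)"
proof -
  have "ell2.proj X (ell2_delta ` S) f = (\<Sum>x\<in>S. f x *\<^sub>C ell2_delta x)"
    unfolding ell2.proj_def using S
    by (subst sum.reindex) (auto simp: inj_on_def ell2_delta_inj ell2_ip_delta subset_iff intro!: sum.cong)
  also have "\<dots> = (\<Sum>x\<in>S. (\<lambda>x. if x \<in> S then f x else 0) x *\<^sub>C ell2_delta x)" by (intro sum.cong) auto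
  also have "\<dots> = (\<lambda>x. if x \<in> S then f x else 0)"
    using S by (intro ell2_finite_support(3)[symmetric]) auto
  finally show ?thesis .
qed

lemma ell2_finite_approx:
  assumes f: "f \<in> ell2 X" and \<delta>: "\<delta> > 0"
  obtains F where "finite F" "F \<subseteq> X" "vnorm (ell2_ip X) (f - (\<lambda>x. if x \<in> F then f x else 0)) < \<delta>"
proof -
  have "(\<lambda>x. (cmod (f x))\<^sup>2) summable_on X" using f by (simp add: ell2_def)
  then obtain F where F: "finite F" "F \<subseteq> X"
    "dist (\<Sum>x\<in>F. (cmod (f x))\<^sup>2) (\<Sum>\<^sub>\<infinity>x\<in>X. (cmod (f x))\<^sup>2) \<le> \<delta>\<^sup>2 / 2"
    using infsum_finite_approximation[of _ X "\<delta>\<^sup>2 / 2"] \<delta> by (metis half_gt_zero zero_less_power)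
  have "(\<Sum>e\<in>ell2_delta ` F. (cmod (ell2_ip X f e))\<^sup>2) = (\<Sum>x\<in>F. (cmod (f x))\<^sup>2)"
    using F by (subst sum.reindex) (auto simp: inj_on_def ell2_delta_inj ell2_ip_delta subset_iff intro!: sum.cong)
  then have "(vnorm (ell2_ip X) (f - (\<lambda>x. if x \<in> F then f x else 0)))\<^sup>2 \<le> \<delta>\<^sup>2 / 2"
    using ell2.vnorm_decompose[OF ell2_orthonormal[OF F(2)] _ f] F
    by (simp add: ell2_proj ell2_vnorm_sq[of X f] dist_real_def)
  also have "\<dots> < \<delta>\<^sup>2" using \<delta> by simp
  finally show ?thesis using that F \<delta> by (meson less_imp_le power_less_imp_less_base)
qed

text \<open>The adjoint is written down by its coordinates, (S g) x being the inner product of g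
  with T applied to the delta at x. The adjoint relation is clear for finitely supported vectors;
  boundedness and approximation extend it.\<close>

lemma ell2_adjoint_exists:
  assumes T: "T \<in> bounded_operators (ell2 X) (ell2_ip X)"
  shows "\<exists>S. S \<in> bounded_operators (ell2 X) (ell2_ip X) \<and> is_adjoint (ell2 X) (ell2_ip X) T S"
proof -
  let ?H = "ell2 X" and ?ip = "ell2_ip X"
  note TD = ell2.bounded_opD[OF T]
  obtain K where K: "K > 0" "\<And>x. x \<in> ?H \<Longrightarrow> vnorm ?ip (T x) \<le> K * vnorm ?ip x"
    using ell2.bounded_op_bound[OF T] by metis
  define S where "S g = (\<lambda>x. if g \<in> ?H \<and> x \<in> X then ?ip g (T (ell2_delta x)) else 0)" for g
  have finite_ip: "?ip (T h) g = ?ip h (S g)"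
    if g: "g \<in> ?H" and F: "finite F" "F \<subseteq> X" and h: "\<And>x. x \<notin> F \<Longrightarrow> h x = 0" for g F h
  proof -
    have heq: "h = (\<Sum>x\<in>F. h x *\<^sub>C ell2_delta x)" and hH: "h \<in> ?H" using ell2_finite_support[of F X h, OF F h] by auto
    have d: "ell2_delta x \<in> ?H" if "x \<in> F" for x using that F by blast
    have "T h = (\<Sum>x\<in>F. h x *\<^sub>C T (ell2_delta x))"
      using d by (subst heq) (simp add: TD ell2.mem_H)
    then have "?ip (T h) g = (\<Sum>x\<in>F. h x * ?ip (T (ell2_delta x)) g)"
      using d g TD(1) by (simp add: ell2.ip_sum_left ell2.ip_scale_left ell2.mem_H)
    also have "\<dots> = (\<Sum>x\<in>F. h x * cnj (S g x))"
      using d g TD(1) F ell2.ip_commute[OF g] by (intro sum.cong) (auto simp: S_def subset_iff)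
    also have "\<dots> = ?ip h (S g)"
      unfolding ell2_ip_def using F h
      by (intro infsumI[symmetric] has_sum_finite_neutralI[of F]) auto
    finally show ?thesis .
  qed
  have fs: "(\<Sum>x\<in>F. (cmod (S g x))\<^sup>2) \<le> (K * vnorm ?ip g)\<^sup>2"
    if g: "g \<in> ?H" and F: "finite F" "F \<subseteq> X" for g F
  proof -
    \<comment> \<open>Testing T on the truncation h of S g to \<open>F\<close> gives r^2 \<le> K r
      ||g|| with r = ||h||, hence a bound on the partial sums independent of
      \<open>F\<close>.\<close>
    define h where "h x = (if x \<in> F then S g x else 0)" for x
    have hz: "\<And>x. x \<notin> F \<Longrightarrow> h x = 0" by (simp add: h_def)
    note hf = ell2_finite_support[of F X h, OF F hz]
    define r where "r = vnorm ?ip h"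
    have r2: "r\<^sup>2 = (\<Sum>x\<in>F. (cmod (S g x))\<^sup>2)" using hf(2) by (simp add: h_def r_def)
    have "?ip h (S g) = (\<Sum>x\<in>F. h x * cnj (S g x))"
      unfolding ell2_ip_def using F hz by (intro infsumI has_sum_finite_neutralI[of F]) auto
    also have "\<dots> = of_real (r\<^sup>2)"
      unfolding r2 of_real_sum by (intro sum.cong) (simp_all add: h_def complex_norm_square del: of_real_power)
    finally have "?ip (T h) g = of_real (r\<^sup>2)" using finite_ip[OF g F hz] by simp
    then have "r\<^sup>2 \<le> vnorm ?ip (T h) * vnorm ?ip g"
      using ell2.cauchy_schwarz[OF TD(1)[OF hf(1)] g] by (simp del: of_real_power)
    also have "\<dots> \<le> K * r * vnorm ?ip g"
      using K(2)[OF hf(1)] g by (intro mult_right_mono) (auto simp: r_def)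
    finally have "r * r \<le> r * (K * vnorm ?ip g)" by (simp add: power2_eq_square mult_ac)
    moreover have "r \<ge> 0" using hf(1) by (simp add: r_def)
    ultimately have "r \<le> K * vnorm ?ip g" using K(1) g by (cases "r = 0") auto
    then show ?thesis using r2 \<open>r \<ge> 0\<close> power_mono by metis
  qed
  have SH: "S g \<in> ?H" "vnorm ?ip (S g) \<le> K * vnorm ?ip g" if g: "g \<in> ?H" for g
  proof -
    have z: "\<And>x. x \<notin> X \<Longrightarrow> S g x = 0" by (simp add: S_def)
    show m: "S g \<in> ?H" by (rule ell2I_bounded(1), erule z, erule (1) fs[OF g])
    have "(vnorm ?ip (S g))\<^sup>2 \<le> (K * vnorm ?ip g)\<^sup>2"
      unfolding ell2_vnorm_sq[of X "S g"] by (rule ell2I_bounded(2), erule z, erule (1) fs[OF g])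
    then show "vnorm ?ip (S g) \<le> K * vnorm ?ip g" by (rule power2_le_imp_le) (use K(1) g in simp)
  qed
  have "?ip (T f) g = ?ip f (S g)" if f: "f \<in> ?H" and g: "g \<in> ?H" for f g
  proof -
    have "cmod (?ip (T f) g - ?ip f (S g)) \<le> 0 + e" if e: "e > 0" for e
    proof -
      \<comment> \<open>2 K ||g|| bounds the two error terms; the added 1 keeps the divisor positive
        when g = 0.\<close>
      let ?C = "2 * (K * vnorm ?ip g) + 1"
      have C: "?C > 0" using K(1) g by (simp add: add_nonneg_pos)
      obtain F where F: "finite F" "F \<subseteq> X"
        "vnorm ?ip (f - (\<lambda>x. if x \<in> F then f x else 0)) < e / ?C"
        using ell2_finite_approx[OF f, of "e / ?C"] e C by auto
      define h where "h = (\<lambda>x. if x \<in> F then f x else 0)"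
      have hz: "\<And>x. x \<notin> F \<Longrightarrow> h x = 0" by (simp add: h_def)
      have hH: "h \<in> ?H" using ell2_finite_support(1)[of F X h, OF F(1,2) hz] .
      have rH: "f - h \<in> ?H" using f hH by blast
      have "?ip (T f) g - ?ip f (S g) = ?ip (T (f - h)) g - ?ip (f - h) (S g)"
        unfolding TD(6)[OF f hH] ell2.ip_diff_left[OF TD(1)[OF f] TD(1)[OF hH] g]
          ell2.ip_diff_left[OF f hH SH(1)[OF g]]
        using finite_ip[of g F h, OF g F(1,2) hz] by simp
      also have "cmod \<dots> \<le> cmod (?ip (T (f - h)) g) + cmod (?ip (f - h) (S g))"
        by (rule norm_triangle_ineq4)
      also have "\<dots> \<le> vnorm ?ip (T (f - h)) * vnorm ?ip g + vnorm ?ip (f - h) * vnorm ?ip (S g)"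
        using ell2.cauchy_schwarz rH TD(1) g SH(1) by (intro add_mono) auto
      also have "\<dots> \<le> (K * vnorm ?ip (f - h)) * vnorm ?ip g + vnorm ?ip (f - h) * (K * vnorm ?ip g)"
        using K(2)[OF rH] SH(2)[OF g] g rH by (intro add_mono mult_right_mono mult_left_mono) auto
      also have "\<dots> \<le> ?C * vnorm ?ip (f - h)" using rH by (simp add: algebra_simps)
      also have "\<dots> \<le> ?C * (e / ?C)"
        using F(3) C by (intro mult_left_mono) (auto simp: h_def)
      also have "\<dots> = e" using C by simp
      finally show ?thesis by simp
    qed
    then have "cmod (?ip (T f) g - ?ip f (S g)) \<le> 0" by (rule field_le_epsilon)
    then show ?thesis by simp
  qed
  then have "is_adjoint ?H ?ip T S" by (simp add: is_adjoint_def)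
  moreover have "S \<in> bounded_operators ?H ?ip"
  proof (rule ell2.bounded_operatorsI[where K = K])
    have d: "T (ell2_delta x) \<in> ?H" if "x \<in> X" for x using TD(1) that by blast
    show "S (f + g) = S f + S g" if "f \<in> ?H" "g \<in> ?H" for f g
      using that d by (auto simp: S_def fun_eq_iff ell2.ip_add_left)
    show "S (c *\<^sub>C f) = c *\<^sub>C S f" if "f \<in> ?H" for f c
      using that d by (auto simp: S_def fun_eq_iff ell2.ip_scale_left scaleC_complex_def)
  qed (use SH in \<open>auto simp: S_def fun_eq_iff\<close>)
  ultimately show ?thesis by blast
qed

lemma ell2_adjoint_op:
  assumes "T \<in> bounded_operators (ell2 X) (ell2_ip X)"
  shows "adjoint_op (ell2 X) (ell2_ip X) T \<in> bounded_operators (ell2 X) (ell2_ip X)"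
    "is_adjoint (ell2 X) (ell2_ip X) T (adjoint_op (ell2 X) (ell2_ip X) T)"
  using ell2_adjoint_exists[OF assms] ell2.adjoint_op_eq assms by metis+

lemma ell2_adjoint_entry:
  assumes "is_adjoint (ell2 X) (ell2_ip X) T S" "T \<in> bounded_operators (ell2 X) (ell2_ip X)"
    "S \<in> bounded_operators (ell2 X) (ell2_ip X)" "x \<in> X" "y \<in> X"
  shows "S (ell2_delta x) y = cnj (T (ell2_delta y) x)"
proof -
  have m: "ell2_delta y \<in> ell2 X" "S (ell2_delta x) \<in> ell2 X"
    using assms ell2.bounded_opD(1)[OF assms(3)] by auto
  have "S (ell2_delta x) y = ell2_ip X (S (ell2_delta x)) (ell2_delta y)"
    using assms(5) by (simp add: ell2_ip_delta)
  also have "\<dots> = cnj (ell2_ip X (ell2_delta y) (S (ell2_delta x)))"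
    using ell2.ip_commute[OF m] .
  also have "ell2_ip X (ell2_delta y) (S (ell2_delta x)) = ell2_ip X (T (ell2_delta y)) (ell2_delta x)"
    using assms by (simp add: is_adjoint_def)
  also have "\<dots> = T (ell2_delta y) x" using assms(4) by (rule ell2_ip_delta)
  finally show ?thesis .
qed

text \<open>Row x of T is the conjugate of the adjoint applied to the delta at x. It is therefore
  square summable, which makes the series converge without a finiteness assumption on f.\<close>

lemma ell2_matrix:
  assumes T: "T \<in> bounded_operators (ell2 X) (ell2_ip X)" and f: "f \<in> ell2 X" and x: "x \<in> X"
  shows "((\<lambda>y. f y * T (ell2_delta y) x) has_sum T f x) X"
proof -
  obtain S where S: "S \<in> bounded_operators (ell2 X) (ell2_ip X)" "is_adjoint (ell2 X) (ell2_ip X) T S"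
    using ell2_adjoint_exists[OF T] by blast
  have m: "S (ell2_delta x) \<in> ell2 X" using ell2.bounded_opD(1)[OF S(1)] x by blast
  have "T f x = ell2_ip X (T f) (ell2_delta x)" using ell2_ip_delta[OF x] by simp
  also have "\<dots> = ell2_ip X f (S (ell2_delta x))" using S(2) f x by (simp add: is_adjoint_def)
  finally have "T f x = ell2_ip X f (S (ell2_delta x))" .
  moreover have "((\<lambda>y. f y * cnj (S (ell2_delta x) y)) has_sum ell2_ip X f (S (ell2_delta x))) X"
    unfolding ell2_ip_def using ell2_ip_summable[OF f m] by (rule has_sum_infsum)
  ultimately have h: "((\<lambda>y. f y * cnj (S (ell2_delta x) y)) has_sum T f x) X" by (simp only:)
  have "f y * cnj (S (ell2_delta x) y) = f y * T (ell2_delta y) x" if "y \<in> X" for y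
    by (simp only: ell2_adjoint_entry[OF S(2) T S(1) x that] complex_cnj_cnj)
  from iffD1[OF has_sum_cong[OF this] h] show ?thesis .
qed

section \<open>Boundaries, expansion and paradoxical decompositions\<close>

section \<open>Spaces of bounded geometry\<close>

locale bounded_geometry_space = ext_metric_space +
  assumes bounded_geometry: "bounded_geometry X d"
begin

definition nbhd :: "real \<Rightarrow> 'a set \<Rightarrow> 'a set" where
  "nbhd R F = {x \<in> X. \<exists>y\<in>F. d y x \<le> ennreal R}"

lemma ball_card:
  assumes "R > 0"
  obtains N where "N > 0" "\<And>x. x \<in> X \<Longrightarrow> finite {y \<in> X. d x y \<le> ennreal R}"
    "\<And>x. x \<in> X \<Longrightarrow> card {y \<in> X. d x y \<le> ennreal R} \<le> N"
proof -
  obtain N where N: "\<forall>x\<in>X. finite {y \<in> X. d x y \<le> ennreal R} \<and> card {y \<in> X. d x y \<le> ennreal R} \<le> N"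
    using bounded_geometry assms unfolding bounded_geometry_def by blast
  show ?thesis by (rule that[of "Suc N"]) (use N in \<open>auto intro: le_SucI\<close>)
qed

lemma finite_ball: "R > 0 \<Longrightarrow> x \<in> X \<Longrightarrow> finite {y \<in> X. d x y \<le> ennreal R}"
  using ball_card by metis

lemma dist_self [simp]: "x \<in> X \<Longrightarrow> d x x = 0"
  using zero_iff by blast

text \<open>The infimum is attained because balls are finite. Radius R + 1 is used since an infimum
  of at most R only guarantees points at distance below R + 1.\<close>

lemma set_distance_le_iff:
  assumes x: "x \<in> X" and A: "A \<subseteq> X" and R: "R > 0"
  shows "set_distance d x A \<le> ennreal R \<longleftrightarrow> (\<exists>y\<in>A. d x y \<le> ennreal R)"
proof
  assume le: "set_distance d x A \<le> ennreal R"
  also have "ennreal R < ennreal (R + 1)" using R by (simp add: ennreal_less_iff)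
  finally obtain y where y: "y \<in> A" "d x y < ennreal (R + 1)"
    by (auto simp: set_distance_def INF_less_iff)
  let ?S = "{y \<in> A. d x y \<le> ennreal (R + 1)}"
  have fS: "finite ?S" using finite_ball[of "R + 1" x] R x A by (auto elim!: finite_subset[rotated])
  have yS: "y \<in> ?S" using y by auto
  have fi: "finite (d x ` ?S)" "d x ` ?S \<noteq> {}" using fS yS by blast+
  obtain z where z: "z \<in> ?S" "d x z = Min (d x ` ?S)" using Min_in[OF fi] by auto
  have "d x z \<le> d x w" if "w \<in> A" for w
  proof (cases "w \<in> ?S")
    case True
    then show ?thesis using z fi by simp
  next
    case False
    then have "ennreal (R + 1) \<le> d x w" using that by auto
    then show ?thesis using z(1) by auto
  qed
  then have "d x z \<le> set_distance d x A" unfolding set_distance_def by (intro INF_greatest)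
  then show "\<exists>y\<in>A. d x y \<le> ennreal R" using z(1) order_trans[OF _ le] by blast
next
  assume "\<exists>y\<in>A. d x y \<le> ennreal R"
  then show "set_distance d x A \<le> ennreal R"
    unfolding set_distance_def by (meson INF_lower order_trans)
qed

lemma R_boundary_iff:
  assumes "F \<subseteq> X" "R > 0"
  shows "x \<in> R_boundary X d R F \<longleftrightarrow>
    x \<in> X \<and> (\<exists>y\<in>F. d x y \<le> ennreal R) \<and> (\<exists>y\<in>X - F. d x y \<le> ennreal R)"
  using assms by (auto simp: R_boundary_def set_distance_le_iff)

lemma nbhd_subset: "nbhd R F \<subseteq> X"
  by (auto simp: nbhd_def)

lemma finite_nbhd: "finite F \<Longrightarrow> F \<subseteq> X \<Longrightarrow> R > 0 \<Longrightarrow> finite (nbhd R F)"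
proof -
  assume "finite F" "F \<subseteq> X" "R > 0"
  moreover have "nbhd R F \<subseteq> (\<Union>y\<in>F. {x \<in> X. d y x \<le> ennreal R})" by (auto simp: nbhd_def)
  ultimately show ?thesis using finite_ball by (meson finite_UN_I finite_subset subsetD)
qed

lemma subset_nbhd: "F \<subseteq> X \<Longrightarrow> F \<subseteq> nbhd R F"
  by (force simp: nbhd_def)

lemma R_boundary_subset_nbhd: "F \<subseteq> X \<Longrightarrow> R > 0 \<Longrightarrow> R_boundary X d R F \<subseteq> nbhd R F"
  using sym by (auto simp: R_boundary_iff nbhd_def subset_iff)

lemma finite_R_boundary: "finite F \<Longrightarrow> F \<subseteq> X \<Longrightarrow> R > 0 \<Longrightarrow> finite (R_boundary X d R F)"
  using R_boundary_subset_nbhd finite_nbhd finite_subset by metis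

lemma nbhd_diff_subset_R_boundary:
  "F \<subseteq> X \<Longrightarrow> R > 0 \<Longrightarrow> nbhd R F - F \<subseteq> R_boundary X d R F"
  using sym by (force simp: R_boundary_iff nbhd_def subset_iff)

lemma R_boundary_mono:
  assumes "F \<subseteq> X" "0 < R" "R \<le> R'"
  shows "R_boundary X d R F \<subseteq> R_boundary X d R' F"
proof -
  have "ennreal R \<le> ennreal R'" using assms by (simp add: ennreal_leI)
  then have "u \<le> ennreal R'" if "u \<le> ennreal R" for u using that by (rule order_trans[rotated])
  then show ?thesis using assms by (simp add: R_boundary_iff subset_iff) blast
qed

lemma R_boundary_Un:
  "F \<subseteq> X \<Longrightarrow> G \<subseteq> X \<Longrightarrow> R > 0 \<Longrightarrow> R_boundary X d R (F \<union> G) \<subseteq> R_boundary X d R F \<union> R_boundary X d R G"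
  by (auto simp: R_boundary_iff)

lemma R_boundary_whole: "R > 0 \<Longrightarrow> R_boundary X d R X = {}"
  by (auto simp: R_boundary_iff)

lemma finite_imp_properly_amenable:
  assumes "finite X" "X \<noteq> {}"
  shows "properly_amenable X d"
  unfolding properly_amenable_def using assms by (auto intro!: exI[of _ X] simp: R_boundary_whole)

text \<open>If R, \<epsilon> and \<open>A\<close> witness the failure, a large set with relative
  boundary at most \<epsilon>/2 could be united with \<open>A\<close>: the boundary grows by at most
  that of \<open>A\<close>, which a large cardinality absorbs. Hence all such sets have bounded
  size.\<close>

lemma not_properly_amenable_cases:
  assumes "\<not> properly_amenable X d"
  obtains R \<epsilon> :: real and n where "R > 0" "\<epsilon> > 0"
    "\<And>F. finite F \<Longrightarrow> F \<subseteq> X \<Longrightarrow> card (R_boundary X d R F) \<le> \<epsilon> * card F \<Longrightarrow> card F < n"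
proof -
  obtain R \<epsilon> A where R: "R > 0" and \<epsilon>: "\<epsilon> > (0::real)" and A: "finite A" "A \<subseteq> X"
    and no': "\<forall>F. \<not> (finite F \<and> F \<noteq> {} \<and> F \<subseteq> X \<and> A \<subseteq> F \<and> finite (R_boundary X d R F) \<and>
      real (card (R_boundary X d R F)) \<le> \<epsilon> * real (card F))"
    using assms unfolding properly_amenable_def not_all not_imp not_ex by (elim exE conjE)
  have no: "\<not> card (R_boundary X d R F) \<le> \<epsilon> * card F"
    if "finite F" "F \<noteq> {}" "F \<subseteq> X" "A \<subseteq> F" for F
    using no'[rule_format, of F] that finite_R_boundary[OF that(1,3) R] by blast
  obtain m :: nat where m: "2 * card (R_boundary X d R A) / \<epsilon> \<le> real m"
    using real_arch_simple by blast
  \<comment> \<open>The successor makes \<open>n\<close> positive, so a set with at least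
    \<open>n\<close> elements is nonempty, as the failing condition requires.\<close>
  define n where "n = Suc m"
  have n: "n > 0" "2 * card (R_boundary X d R A) / \<epsilon> \<le> real n" using m by (simp_all add: n_def)
  have "card F < n"
    if F: "finite F" "F \<subseteq> X" and le: "card (R_boundary X d R F) \<le> \<epsilon> / 2 * card F" for F
  proof (rule ccontr)
    assume "\<not> card F < n"
    then have nF: "n \<le> card F" by simp
    have "card (R_boundary X d R (F \<union> A)) \<le> card (R_boundary X d R F \<union> R_boundary X d R A)"
      using R_boundary_Un[OF F(2) A(2) R] finite_R_boundary[OF F R] finite_R_boundary[OF A R]
      by (intro card_mono) auto
    also have "\<dots> \<le> card (R_boundary X d R F) + card (R_boundary X d R A)" by (rule card_Un_le)
    finally have 1: "real (card (R_boundary X d R (F \<union> A))) \<le>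
        card (R_boundary X d R F) + card (R_boundary X d R A)" by simp
    have "card (R_boundary X d R A) \<le> \<epsilon> / 2 * n" using n(2) \<epsilon> by (simp add: field_simps)
    also have "\<dots> \<le> \<epsilon> / 2 * card F" using nF \<epsilon> by (intro mult_left_mono) auto
    finally have "card (R_boundary X d R (F \<union> A)) \<le> \<epsilon> * card F" using 1 le by simp
    also have "\<dots> \<le> \<epsilon> * card (F \<union> A)"
      using F A \<epsilon> by (intro mult_left_mono) (auto intro: card_mono)
    finally show False using no[of "F \<union> A"] F A nF n(1) by (cases "F \<union> A = {}") auto
  qed
  then show ?thesis using that[of R "\<epsilon> / 2" n] R \<epsilon> by simp
qed

text \<open>Foelner sets at scales R \<ge> R0 turn out to have no boundary at all. At each scale
  they have a largest member, as unions again have empty boundary and sizes are bounded; the least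
  such maximum over all scales is \<open>Y\<close>. Outside \<open>Y\<close> every nonempty finite
  set therefore has a proportional boundary.\<close>

lemma not_properly_amenable_expanding:
  assumes np: "\<not> properly_amenable X d"
  obtains Y R and c :: real where "finite Y" "Y \<subseteq> X" "\<And>x y. x \<in> Y \<Longrightarrow> y \<in> X - Y \<Longrightarrow> d x y = \<infinity>" "R > 0" "c > 0"
    "\<And>F. finite F \<Longrightarrow> F \<subseteq> X - Y \<Longrightarrow> (1 + c) * card F \<le> card (nbhd R F)"
proof -
  obtain R0 and \<epsilon>0 :: real and n0 where R0: "R0 > 0" and \<epsilon>0: "\<epsilon>0 > 0"
    and small0: "\<And>F. finite F \<Longrightarrow> F \<subseteq> X \<Longrightarrow> card (R_boundary X d R0 F) \<le> \<epsilon>0 * card F \<Longrightarrow> card F < n0"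
    using not_properly_amenable_cases[OF np] by metis
  have "R_boundary X d R0 {} = {}" using R0 by (auto simp: R_boundary_iff)
  then have n0: "n0 > 0" using small0[of "{}"] by simp
  \<comment> \<open>With fewer than n0 points and tolerance at most 1/n0 the boundary has fewer than
    one element, hence is empty.\<close>
  define \<epsilon> where "\<epsilon> = min \<epsilon>0 (1 / n0)"
  have \<epsilon>: "\<epsilon> > 0" using \<epsilon>0 n0 by (simp add: \<epsilon>_def)
  have small: "card F < n0 \<and> R_boundary X d R F = {}"
    if F: "finite F" "F \<subseteq> X" and R: "R \<ge> R0" and le: "card (R_boundary X d R F) \<le> \<epsilon> * card F" for F R
  proof
    have fin: "finite (R_boundary X d R F)" using finite_R_boundary F R R0 by simp
    have "real (card (R_boundary X d R0 F)) \<le> card (R_boundary X d R F)"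
      using R_boundary_mono[OF F(2) R0 R] fin by (simp add: card_mono)
    also have "\<dots> \<le> \<epsilon> * card F" by fact
    also have "\<dots> \<le> \<epsilon>0 * card F" by (intro mult_right_mono) (simp_all add: \<epsilon>_def)
    finally show lt: "card F < n0" using small0 F by blast
    have "real (card (R_boundary X d R F)) \<le> 1 / n0 * card F"
      using le mult_right_mono[of \<epsilon> "1 / n0" "card F"] by (simp add: \<epsilon>_def)
    also have "\<dots> < 1" using lt by simp
    finally show "R_boundary X d R F = {}" using fin by simp
  qed
  define \<K> where "\<K> R = {F. finite F \<and> F \<subseteq> X \<and> R_boundary X d R F = {}}" for R
  have "\<exists>M\<in>\<K> R. \<forall>F\<in>\<K> R. F \<subseteq> M" if R: "R \<ge> R0" for R
  proof -
    have "{} \<in> \<K> R" using R R0 by (auto simp: \<K>_def R_boundary_iff)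
    moreover have bnd: "card F < n0" if "F \<in> \<K> R" for F
      using that small[of F R] R \<epsilon> by (simp add: \<K>_def)
    ultimately obtain M where M: "M \<in> \<K> R" "\<And>F. F \<in> \<K> R \<Longrightarrow> card F \<le> card M"
      using ex_has_greatest_nat[of "\<lambda>F. F \<in> \<K> R" "{}" card n0] by (metis less_imp_le)
    have "F \<subseteq> M" if F: "F \<in> \<K> R" for F
    proof -
      have "M \<union> F \<in> \<K> R" using M(1) F R_boundary_Un[of M F R] R R0 by (auto simp: \<K>_def)
      then have "card (M \<union> F) \<le> card M" using M(2) by blast
      moreover have "finite (M \<union> F)" using M F by (simp add: \<K>_def)
      ultimately show ?thesis using card_seteq[of "M \<union> F" M] by blast
    qed
    then show ?thesis using M(1) by blast
  qed
  then obtain M where M: "\<And>R. R \<ge> R0 \<Longrightarrow> M R \<in> \<K> R" "\<And>R F. R \<ge> R0 \<Longrightarrow> F \<in> \<K> R \<Longrightarrow> F \<subseteq> M R"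
    by metis
  \<comment> \<open>The maximal sets shrink as the scale grows. At a scale where the cardinality is
    minimal they have stabilised, so \<open>Y\<close> has empty boundary at every larger scale and
    is infinitely far from its complement.\<close>
  obtain R where R: "R \<ge> R0" "\<And>R'. R' \<ge> R0 \<Longrightarrow> card (M R) \<le> card (M R')"
    using ex_has_least_nat[of "\<lambda>R. R \<ge> R0" R0 "\<lambda>R. card (M R)"] by auto
  have Rpos: "R > 0" using R R0 by simp
  define Y where "Y = M R"
  have Y: "finite Y" "Y \<subseteq> X" using M(1)[OF R(1)] by (auto simp: Y_def \<K>_def)
  have stable: "R_boundary X d R' Y = {}" if R': "R' \<ge> R" for R'
  proof -
    have R'0: "R' \<ge> R0" using R R' by simp
    have "M R' \<in> \<K> R" using M(1)[OF R'0] R_boundary_mono[of "M R'" R R'] Rpos R' by (auto simp: \<K>_def)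
    then have "M R' \<subseteq> Y" using M(2)[OF R(1)] by (simp add: Y_def)
    then have "M R' = Y" using R(2)[OF R'0] Y(1) by (simp add: card_seteq Y_def)
    then show ?thesis using M(1)[OF R'0] by (simp add: \<K>_def)
  qed
  have inf: "d x y = \<infinity>" if xy: "x \<in> Y" "y \<in> X - Y" for x y
  proof (rule ccontr)
    assume "d x y \<noteq> \<infinity>"
    then obtain r where r: "r \<ge> 0" "d x y = ennreal r" by (cases "d x y") auto
    have "d x y \<le> ennreal (max R r)" using r by (simp add: ennreal_leI)
    then have "x \<in> R_boundary X d (max R r) Y"
      using xy Y Rpos dist_self[of x] unfolding R_boundary_iff[OF Y(2), of "max R r", OF less_max_iff_disj[THEN iffD2, OF disjI1, OF Rpos]]
      by (metis subsetD zero_le)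
    then show False using stable[of "max R r"] by simp
  qed
  obtain N where N: "N > 0" "\<And>x. x \<in> X \<Longrightarrow> finite {y \<in> X. d x y \<le> ennreal R}"
    "\<And>x. x \<in> X \<Longrightarrow> card {y \<in> X. d x y \<le> ennreal R} \<le> N"
    using ball_card[OF Rpos] by blast
  have expand: "(1 + \<epsilon> / N) * card F \<le> card (nbhd R F)" if F: "finite F" "F \<subseteq> X - Y" for F
  proof (cases "F = {}")
    case False
    have FX: "F \<subseteq> X" using F by blast
    have "R_boundary X d R F \<noteq> {}"
      using M(2)[OF R(1), of F] F False by (auto simp: \<K>_def Y_def)
    then have gt: "\<epsilon> * card F < card (R_boundary X d R F)"
      using small[OF F(1) FX R(1)] by fastforce
    let ?O = "nbhd R F - F"
    have fO: "finite (nbhd R F)" using finite_nbhd F FX Rpos by blast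
    \<comment> \<open>Every boundary point, inside or outside \<open>F\<close>, lies in the R-ball
      of a point of the outer layer \<open>?O\<close>. Balls have at most \<open>N\<close> points,
      so the outer layer has at least \<epsilon>/N times as many points as \<open>F\<close>.\<close>
    have "R_boundary X d R F \<subseteq> (\<Union>y\<in>?O. {x \<in> X. d y x \<le> ennreal R})"
    proof
      fix x assume "x \<in> R_boundary X d R F"
      then obtain y z where x: "x \<in> X" and y: "y \<in> F" "d x y \<le> ennreal R"
        and z: "z \<in> X - F" "d x z \<le> ennreal R"
        using FX Rpos by (auto simp: R_boundary_iff)
      have dyx: "d y x \<le> ennreal R" "d z x \<le> ennreal R" using sym x y z FX by auto
      show "x \<in> (\<Union>y\<in>?O. {x \<in> X. d y x \<le> ennreal R})"
      proof (cases "x \<in> F")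
        case True
        then have "z \<in> ?O" using z by (auto simp: nbhd_def)
        then show ?thesis using x dyx by blast
      next
        case False
        then have "x \<in> ?O" using x y dyx by (auto simp: nbhd_def)
        then show ?thesis using x by (intro UN_I[of x]) auto
      qed
    qed
    then have "card (R_boundary X d R F) \<le> card (\<Union>y\<in>?O. {x \<in> X. d y x \<le> ennreal R})"
      using fO by (intro card_mono finite_UN_I N(2)) (auto dest: subsetD[OF nbhd_subset])
    also have "\<dots> \<le> (\<Sum>y\<in>?O. card {x \<in> X. d y x \<le> ennreal R})"
      using fO by (intro card_UN_le) auto
    also have "\<dots> \<le> card ?O * N"
      using sum_bounded_above[of ?O "\<lambda>y. card {x \<in> X. d y x \<le> ennreal R}" N] N(3)
        subsetD[OF nbhd_subset] by auto
    finally have "real (card (R_boundary X d R F)) \<le> real (card ?O) * real N"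
      by (simp flip: of_nat_mult)
    then have "\<epsilon> / N * card F \<le> card ?O" using gt N(1) by (simp add: field_simps)
    moreover have "card (nbhd R F) = card ?O + card F"
      using fO subset_nbhd[OF FX] by (metis add.commute card_Diff_subset card_mono finite_subset le_add_diff_inverse)
    ultimately show ?thesis by (simp add: algebra_simps)
  qed simp
  show ?thesis
    by (rule that[of Y R "\<epsilon> / N"]) (use Y inf Rpos \<epsilon> N(1) expand in auto)
qed

text \<open>Iterating the expansion until the factor exceeds 2 verifies Hall's condition for two
  copies of the complement of \<open>Y\<close>, each point being joined to all points within a fixed
  distance. The restrictions of one matching to the two copies are the two injections.\<close>

lemma not_properly_amenable_paradoxical:
  assumes np: "\<not> properly_amenable X d"
  obtains Y r \<phi> where "finite Y" "Y \<subseteq> X" "\<And>x y. x \<in> Y \<Longrightarrow> y \<in> X - Y \<Longrightarrow> d x y = \<infinity>"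
    "\<And>i. i < (2::nat) \<Longrightarrow> inj_on (\<phi> i) (X - Y)" "\<And>i x. i < 2 \<Longrightarrow> x \<in> X - Y \<Longrightarrow> \<phi> i x \<in> X - Y"
    "\<And>x y. x \<in> X - Y \<Longrightarrow> y \<in> X - Y \<Longrightarrow> \<phi> 0 x \<noteq> \<phi> 1 y"
    "\<And>i x. i < 2 \<Longrightarrow> x \<in> X - Y \<Longrightarrow> d x (\<phi> i x) \<le> ennreal r"
proof -
  obtain Y R and c :: real where Y: "finite Y" "Y \<subseteq> X" and inf: "\<And>x y. x \<in> Y \<Longrightarrow> y \<in> X - Y \<Longrightarrow> d x y = \<infinity>"
    and R: "R > 0" and c: "c > 0"
    and exp: "\<And>F. finite F \<Longrightarrow> F \<subseteq> X - Y \<Longrightarrow> (1 + c) * card F \<le> card (nbhd R F)"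
    using not_properly_amenable_expanding[OF np] by metis
  have nY: "nbhd R F \<subseteq> X - Y" if "F \<subseteq> X - Y" for F
  proof
    fix x assume "x \<in> nbhd R F"
    then obtain y where y: "y \<in> F" "x \<in> X" "d y x \<le> ennreal R" by (auto simp: nbhd_def)
    then have "d x y \<le> ennreal R" using sym that by auto
    then show "x \<in> X - Y" using inf[of x y] y that by (auto simp: top_unique)
  qed
  have iter: "finite ((nbhd R ^^ k) F) \<and> (nbhd R ^^ k) F \<subseteq> X - Y \<and>
      (1 + c) ^ k * card F \<le> card ((nbhd R ^^ k) F) \<and>
      (\<forall>y\<in>(nbhd R ^^ k) F. \<exists>x\<in>F. d x y \<le> ennreal (k * R))"
    if F: "finite F" "F \<subseteq> X - Y" for F k
  proof (induction k)
    case 0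
    have "\<exists>x\<in>F. d x y \<le> ennreal (real 0 * R)" if "y \<in> F" for y
      using F that by (intro bexI[of _ y]) auto
    then show ?case using F by simp
  next
    case (Suc k)
    let ?G = "(nbhd R ^^ k) F"
    have G: "finite ?G" "?G \<subseteq> X - Y" using Suc by blast+
    have "(1 + c) ^ Suc k * card F \<le> (1 + c) * card ?G"
      using Suc c by (simp add: mult.assoc mult_left_mono)
    also have "\<dots> \<le> card (nbhd R ?G)" using exp[OF G] .
    finally have 1: "(1 + c) ^ Suc k * card F \<le> card (nbhd R ?G)" .
    have 2: "finite (nbhd R ?G)" using finite_nbhd[OF G(1) _ R] G(2) by blast
    have 3: "\<exists>x\<in>F. d x y \<le> ennreal (Suc k * R)" if y: "y \<in> nbhd R ?G" for y
    proof -
      obtain z where z: "z \<in> ?G" "d z y \<le> ennreal R" "y \<in> X" using y by (auto simp: nbhd_def)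
      obtain x where x: "x \<in> F" "d x z \<le> ennreal (k * R)" using Suc z by blast
      have "d x y \<le> d x z + d z y" using x z F G by (intro triangle) auto
      also have "\<dots> \<le> ennreal (k * R) + ennreal R" using x z by (intro add_mono)
      also have "\<dots> = ennreal (Suc k * R)" using R by (simp add: ennreal_plus[symmetric] algebra_simps del: ennreal_plus)
      finally show ?thesis using x by blast
    qed
    show ?case using 1 2 3 nY[OF G(2)] by simp
  qed
  obtain k where k: "2 < (1 + c) ^ k" using real_arch_pow[of "1 + c" 2] c by auto
  \<comment> \<open>k R is the displacement of the k-fold neighbourhood; the further summand R makes
    positivity immediate.\<close>
  define r where "r = k * R + R"
  have r: "r > 0" using R by (simp add: r_def add_nonneg_pos)
  define E where "E = {((x, i), y) |x i y. x \<in> X - Y \<and> i < (2::nat) \<and> y \<in> X - Y \<and> d x y \<le> ennreal r}"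
  have "finite (E `` {p})" if "p \<in> (X - Y) \<times> {..<2}" for p
  proof -
    have "E `` {p} \<subseteq> {y \<in> X. d (fst p) y \<le> ennreal r}" by (auto simp: E_def)
    then show ?thesis using finite_ball[OF r, of "fst p"] that finite_subset by auto
  qed
  moreover have "card S \<le> card (E `` S)" if S: "finite S" "S \<subseteq> (X - Y) \<times> {..<2}" for S
  proof -
    let ?F = "fst ` S"
    have F: "finite ?F" "?F \<subseteq> X - Y" using S by auto
    have "S \<subseteq> ?F \<times> {..<2}" using S by force
    then have "card S \<le> card (?F \<times> {..<2::nat})" using F by (intro card_mono) auto
    then have 1: "card S \<le> 2 * card ?F" by (simp add: card_cartesian_product)
    have "2 * real (card ?F) \<le> (1 + c) ^ k * card ?F" using k by (intro mult_right_mono) auto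
    also have "\<dots> \<le> card ((nbhd R ^^ k) ?F)" using iter[OF F] by blast
    finally have 2: "2 * card ?F \<le> card ((nbhd R ^^ k) ?F)" by linarith
    have "(nbhd R ^^ k) ?F \<subseteq> E `` S"
    proof
      fix y assume y: "y \<in> (nbhd R ^^ k) ?F"
      then obtain x where x: "x \<in> ?F" "d x y \<le> ennreal (k * R)" using iter[OF F, of k] by blast
      have "d x y \<le> ennreal r" using x(2) R by (elim order_trans) (auto simp: r_def intro: ennreal_leI)
      moreover have "y \<in> X - Y" using y iter[OF F, of k] by blast
      moreover obtain i where "(x, i) \<in> S" using x by auto
      ultimately show "y \<in> E `` S" using S by (force simp: E_def)
    qed
    moreover have "finite (E `` S)"
    proof (rule finite_subset)
      show "E `` S \<subseteq> (\<Union>x\<in>?F. {y \<in> X. d x y \<le> ennreal r})" by (force simp: E_def)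
      show "finite (\<Union>x\<in>?F. {y \<in> X. d x y \<le> ennreal r})" using F finite_ball[OF r] by (intro finite_UN_I) blast+
    qed
    ultimately show ?thesis using 1 2 card_mono le_trans by metis
  qed
  ultimately obtain f where f: "inj_on f ((X - Y) \<times> {..<2})"
    "\<And>p. p \<in> (X - Y) \<times> {..<2} \<Longrightarrow> (p, f p) \<in> E"
    using Hall_locally_finite[of "(X - Y) \<times> {..<2}" E] by blast
  show ?thesis
  proof (rule that[of Y "\<lambda>i x. f (x, i)" r])
    show "inj_on (\<lambda>x. f (x, i)) (X - Y)" if "i < 2" for i :: nat
      using f(1) that by (auto simp: inj_on_def)
    show "f (x, 0) \<noteq> f (y, 1)" if "x \<in> X - Y" "y \<in> X - Y" for x y
      using inj_onD[OF f(1), of "(x, 0)" "(y, 1)"] that by auto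
  qed (use Y inf f(2) in \<open>auto simp: E_def\<close>)
qed

end

section \<open>Propagation, norm closure and components\<close>

section \<open>Uniform Roe algebras\<close>

text \<open>Weighted composition with an injective partial map: the common form of translation,
  diagonal and cut-off operators. Injectivity lets reindexed partial sums be bounded by the norm of
  f.\<close>

lemma pullback_op_bounded:
  assumes s: "inj_on s B" "s ` B \<subseteq> X" and B: "B \<subseteq> X" and g: "\<And>y. y \<in> B \<Longrightarrow> cmod (g y) \<le> K"
  shows "(\<lambda>f. if f \<in> ell2 X then (\<lambda>y. if y \<in> B then g y * f (s y) else 0) else 0)
    \<in> bounded_operators (ell2 X) (ell2_ip X)" (is "?T \<in> _")
\<comment> \<open>If \<open>B\<close> is empty, nothing forces \<open>K\<close> to be nonnegative;
  the operator is then zero.\<close>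
proof (cases "B = {}")
  case True
  then have "?T = 0" by (auto simp: fun_eq_iff)
  then show ?thesis by (simp only: ell2.bounded_op_zero)
next
  case False
  then have K: "K \<ge> 0" using g norm_ge_zero order_trans by blast
  have b: "(\<Sum>y\<in>F. (cmod (?T f y))\<^sup>2) \<le> (K * vnorm (ell2_ip X) f)\<^sup>2"
    if f: "f \<in> ell2 X" and F: "finite F" "F \<subseteq> X" for f F
  proof -
    have "(\<Sum>y\<in>F. (cmod (?T f y))\<^sup>2) = (\<Sum>y\<in>F \<inter> B. (cmod (g y * f (s y)))\<^sup>2)"
      using F f by (intro sum.mono_neutral_cong_right) auto
    also have "\<dots> \<le> (\<Sum>y\<in>F \<inter> B. K\<^sup>2 * (cmod (f (s y)))\<^sup>2)"
      using g by (intro sum_mono) (auto simp: norm_mult power_mult_distrib intro!: mult_right_mono power_mono)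
    also have "\<dots> = K\<^sup>2 * (\<Sum>x\<in>s ` (F \<inter> B). (cmod (f x))\<^sup>2)"
      using s(1) by (subst sum.reindex) (auto simp: sum_distrib_left intro: inj_on_subset)
    also have "\<dots> \<le> K\<^sup>2 * (vnorm (ell2_ip X) f)\<^sup>2"
      using F s by (intro mult_left_mono ell2_finite_sum_le f) auto
    finally show ?thesis by (simp add: power_mult_distrib)
  qed
  have z: "?T f x = 0" if "x \<notin> X" for f x using that B by auto
  have mem: "?T f \<in> ell2 X" if "f \<in> ell2 X" for f
    by (rule ell2I_bounded(1), erule z, erule (1) b[OF that])
  show ?thesis
  proof (rule ell2.bounded_operatorsI[where K = K])
    show "vnorm (ell2_ip X) (?T f) \<le> K * vnorm (ell2_ip X) f" if f: "f \<in> ell2 X" for f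
    proof (rule power2_le_imp_le)
      show "(vnorm (ell2_ip X) (?T f))\<^sup>2 \<le> (K * vnorm (ell2_ip X) f)\<^sup>2"
        unfolding ell2_vnorm_sq[of X "?T f"]
        by (rule ell2I_bounded(2), erule z, erule (1) b[OF f])
    qed (use K f in simp)
    show "?T (f + g') = ?T f + ?T g'" if "f \<in> ell2 X" "g' \<in> ell2 X" for f g'
      using that ell2.mem_H(2)[OF that] by (auto simp: fun_eq_iff algebra_simps)
    show "?T (c *\<^sub>C f) = c *\<^sub>C ?T f" if "f \<in> ell2 X" for f c
      using that ell2.mem_H(4)[OF that] by (auto simp: fun_eq_iff scaleC_complex_def)
  qed (use mem in auto)
qed

definition chi :: "'a set \<Rightarrow> 'a set \<Rightarrow> ('a \<Rightarrow> complex) \<Rightarrow> 'a \<Rightarrow> complex" where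
  "chi X S = diagonal_op X (\<lambda>x. if x \<in> S then 1 else 0)"

text \<open>The unit at row x and column y, encoded as the partial translation moving y to x, so
  that it lies in the algebraic Roe algebra as soon as d x y is finite.\<close>

definition matrix_unit :: "'a set \<Rightarrow> 'a \<Rightarrow> 'a \<Rightarrow> ('a \<Rightarrow> complex) \<Rightarrow> 'a \<Rightarrow> complex" where
  "matrix_unit X x y = translation_op X {y} (\<lambda>_. x)"

lemma chi_apply: "f \<in> ell2 X \<Longrightarrow> chi X S f = (\<lambda>x. if x \<in> S then f x else 0)"
  by (auto simp: chi_def diagonal_op_def fun_eq_iff)

lemma matrix_unit_apply: "f \<in> ell2 X \<Longrightarrow> matrix_unit X x y f = f y *\<^sub>C ell2_delta x"
  using inv_into_f_f[of "\<lambda>_. x" "{y}" y]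
  by (auto simp: matrix_unit_def translation_op_def fun_eq_iff ell2_delta_apply scaleC_complex_def)

lemma translation_op_apply:
  "f \<in> ell2 X \<Longrightarrow> translation_op X A t f = (\<lambda>y. if y \<in> t ` A then f (inv_into A t y) else 0)"
  by (simp add: translation_op_def)

lemma ell2_mono:
  assumes g: "g \<in> ell2 X" and f: "\<And>x. x \<notin> X \<Longrightarrow> f x = 0" and le: "\<And>x. x \<in> X \<Longrightarrow> cmod (f x) \<le> cmod (g x)"
  shows "f \<in> ell2 X" "(vnorm (ell2_ip X) f)\<^sup>2 \<le> (vnorm (ell2_ip X) g)\<^sup>2"
proof -
  have b: "(\<Sum>x\<in>F. (cmod (f x))\<^sup>2) \<le> (vnorm (ell2_ip X) g)\<^sup>2" if "finite F" "F \<subseteq> X" for F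
  proof -
    have "(\<Sum>x\<in>F. (cmod (f x))\<^sup>2) \<le> (\<Sum>x\<in>F. (cmod (g x))\<^sup>2)"
      using le that by (intro sum_mono power_mono) auto
    also have "\<dots> \<le> (vnorm (ell2_ip X) g)\<^sup>2" by (rule ell2_finite_sum_le[OF g that])
    finally show ?thesis .
  qed
  show "f \<in> ell2 X" by (rule ell2I_bounded(1), erule f, erule (1) b)
  show "(vnorm (ell2_ip X) f)\<^sup>2 \<le> (vnorm (ell2_ip X) g)\<^sup>2"
    unfolding ell2_vnorm_sq[of X f] by (rule ell2I_bounded(2), erule f, erule (1) b)
qed

lemma chi_bounded_operator:
  assumes "S \<subseteq> X"
  shows "chi X S \<in> bounded_operators (ell2 X) (ell2_ip X)"
proof -
  have "chi X S = (\<lambda>f. if f \<in> ell2 X then (\<lambda>x. if x \<in> S then 1 * f (id x) else 0) else 0)"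
    by (auto simp: fun_eq_iff chi_def diagonal_op_def)
  also have "\<dots> \<in> bounded_operators (ell2 X) (ell2_ip X)"
    using assms by (intro pullback_op_bounded[where K = 1]) auto
  finally show ?thesis .
qed

lemma chi_finite_rank_projection:
  assumes S: "finite S" "S \<subseteq> X"
  shows "finite_rank_projection (ell2 X) (ell2_ip X) (chi X S)"
    "f \<in> ell2 X \<Longrightarrow> chi X S f = ell2.proj X (ell2_delta ` S) f"
proof -
  show proj: "chi X S f = ell2.proj X (ell2_delta ` S) f" if "f \<in> ell2 X" for f
    using that by (simp add: chi_apply ell2_proj[OF S])
  note b = chi_bounded_operator[OF S(2)]
  have "chi X S \<circ> chi X S = chi X S"
  proof
    fix f show "(chi X S \<circ> chi X S) f = chi X S f"
    proof (cases "f \<in> ell2 X")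
      case True
      then show ?thesis using ell2.bounded_opD(1)[OF b True] by (simp add: chi_apply fun_eq_iff)
    qed (simp add: ell2.bounded_opD(2)[OF b] ell2.bounded_opD(3)[OF b])
  qed
  moreover have "is_adjoint (ell2 X) (ell2_ip X) (chi X S) (chi X S)"
    unfolding is_adjoint_def ell2_ip_def by (intro ballI infsum_cong) (simp add: chi_apply)
  moreover have "chi X S ` ell2 X \<subseteq> cvs.span (ell2_delta ` S)"
    using proj ell2.proj_in_span by (intro image_subsetI) simp
  then have "finite_dimensional (chi X S ` ell2 X)"
    unfolding finite_dimensional_def using S(1) by (intro exI[of _ "ell2_delta ` S"]) simp
  ultimately show "finite_rank_projection (ell2 X) (ell2_ip X) (chi X S)"
    using b by (simp add: finite_rank_projection_def)
qed

context bounded_geometry_space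
begin

abbreviation "BH \<equiv> bounded_operators (ell2 X) (ell2_ip X)"
abbreviation "adj \<equiv> adjoint_op (ell2 X) (ell2_ip X)"
abbreviation "is_adj \<equiv> is_adjoint (ell2 X) (ell2_ip X)"
abbreviation "Alg \<equiv> carr (alg_uniform_roe X d)"
abbreviation "Roe \<equiv> carr (uniform_roe X d)"
abbreviation "norm2 \<equiv> vnorm (ell2_ip X)"

definition "generators = {translation_op X A t |A B t. partial_translation X d A B t} \<union>
  {diagonal_op X g |g. bounded (g ` X)}"

text \<open>Operators of finite propagation. They form a unital star subalgebra containing the
  generators and therefore bound the algebraic Roe algebra from above, which gives control over
  entries of elements known only through a hull.\<close>

definition "band_ops = {T \<in> BH. \<exists>R>0. \<forall>x\<in>X. \<forall>y\<in>X. T (ell2_delta y) x \<noteq> 0 \<longrightarrow> d x y \<le> ennreal R}"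

lemma Alg_hull: "Alg = unital_star_subalgebra (operator_algebra (ell2 X) (ell2_ip X)) hull generators"
  by (simp add: alg_uniform_roe_def generators_def operator_algebra_def)

lemma Roe_closure: "Roe = operator_norm_closure (ell2 X) (ell2_ip X) Alg"
  by (simp add: uniform_roe_def operator_algebra_def)

lemma band_opsI:
  assumes "T \<in> BH" "R \<ge> 0" "\<And>x y. x \<in> X \<Longrightarrow> y \<in> X \<Longrightarrow> T (ell2_delta y) x \<noteq> 0 \<Longrightarrow> d x y \<le> ennreal R"
  shows "T \<in> band_ops"
proof -
  have "ennreal R \<le> ennreal (R + 1)" by (rule ennreal_leI) simp
  then have "\<forall>x\<in>X. \<forall>y\<in>X. T (ell2_delta y) x \<noteq> 0 \<longrightarrow> d x y \<le> ennreal (R + 1)"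
    using assms(3) order_trans by blast
  moreover have "R + 1 > 0" using assms(2) by simp
  ultimately show ?thesis using assms(1) unfolding band_ops_def by blast
qed

lemma band_opsD: "T \<in> band_ops \<Longrightarrow> T \<in> BH"
  by (simp add: band_ops_def)

lemma band_opsE:
  assumes "T \<in> band_ops"
  obtains R where "R > 0" "\<And>x y. x \<in> X \<Longrightarrow> y \<in> X \<Longrightarrow> T (ell2_delta y) x \<noteq> 0 \<Longrightarrow> d x y \<le> ennreal R"
  using assms unfolding band_ops_def by blast

lemma translation_op_bounded:
  assumes "partial_translation X d A B t"
  shows "translation_op X A t \<in> BH"
proof -
  have t: "inj_on t A" "t ` A \<subseteq> X" "A \<subseteq> X"
    using assms by (auto simp: partial_translation_def bij_betw_def)
  have "translation_op X A t =
      (\<lambda>f. if f \<in> ell2 X then (\<lambda>y. if y \<in> t ` A then 1 * f (inv_into A t y) else 0) else 0)"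
    by (auto simp: translation_op_def fun_eq_iff)
  also have "\<dots> \<in> BH"
    using t by (intro pullback_op_bounded[where K = 1]) (auto simp: inj_on_inv_into)
  finally show ?thesis .
qed

lemma diagonal_op_bounded:
  assumes "bounded (g ` X)"
  shows "diagonal_op X g \<in> BH"
proof -
  obtain K where K: "\<forall>x\<in>X. cmod (g x) \<le> K" using assms by (auto simp: bounded_iff)
  have "diagonal_op X g = (\<lambda>f. if f \<in> ell2 X then (\<lambda>y. if y \<in> X then g y * f (id y) else 0) else 0)"
    by (auto simp: diagonal_op_def fun_eq_iff ell2_def)
  also have "\<dots> \<in> BH" using K by (intro pullback_op_bounded[where K = K]) auto
  finally show ?thesis .
qed

lemma generators_band: "generators \<subseteq> band_ops"
proof
  fix T assume "T \<in> generators"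
  then consider A B t where "partial_translation X d A B t" "T = translation_op X A t"
    | g where "bounded (g ` X)" "T = diagonal_op X g" by (auto simp: generators_def)
  then show "T \<in> band_ops"
  proof cases
    case 1
    have sup: "(SUP x\<in>A. d x (t x)) < \<infinity>" and A: "A \<subseteq> X" "t ` A \<subseteq> X"
      using 1(1) by (auto simp: partial_translation_def bij_betw_def)
    obtain r where r: "r \<ge> 0" "(SUP x\<in>A. d x (t x)) = ennreal r"
      using sup by (cases "SUP x\<in>A. d x (t x)") auto
    show ?thesis
    proof (rule band_opsI[OF _ r(1)])
      show "T \<in> BH" using 1 translation_op_bounded by simp
      fix x y assume xy: "x \<in> X" "y \<in> X" "T (ell2_delta y) x \<noteq> 0"
      then have "y \<in> A" "x = t y"
        using translation_op_delta[OF 1(1) xy(2)] 1(2) by (auto simp: ell2_delta_apply split: if_splits)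
      moreover from this have "d y (t y) \<le> ennreal r" unfolding r(2)[symmetric] by (intro SUP_upper)
      ultimately show "d x y \<le> ennreal r" using sym[OF xy(1,2)] by simp
    qed
  next
    case 2
    show ?thesis
    proof (rule band_opsI[of _ 0])
      show "T \<in> BH" using 2 diagonal_op_bounded by simp
      show "d x y \<le> ennreal 0" if "x \<in> X" "y \<in> X" "T (ell2_delta y) x \<noteq> 0" for x y
        using that 2 by (auto simp: diagonal_op_def ell2_delta_apply split: if_splits)
    qed simp
  qed
qed

text \<open>The entry of a product is a convergent series over intermediate points; if all its terms
  vanished, so would the entry. This is why propagation adds up under composition.\<close>

lemma entry_comp_nonzero:
  assumes "T \<in> BH" "S \<in> BH" "x \<in> X" "y \<in> X" "(T \<circ> S) (ell2_delta y) x \<noteq> 0"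
  shows "\<exists>z\<in>X. S (ell2_delta y) z \<noteq> 0 \<and> T (ell2_delta z) x \<noteq> 0"
proof (rule ccontr)
  assume no: "\<not> ?thesis"
  have m: "S (ell2_delta y) \<in> ell2 X" using assms ell2.bounded_opD(1) by blast
  have "((\<lambda>z. S (ell2_delta y) z * T (ell2_delta z) x) has_sum T (S (ell2_delta y)) x) X"
    by (rule ell2_matrix[OF assms(1) m assms(3)])
  moreover have "((\<lambda>z. S (ell2_delta y) z * T (ell2_delta z) x) has_sum 0) X"
    using no by (intro has_sum_0) auto
  ultimately show False using assms(5) has_sum_unique by force
qed

lemma band_ops_subalgebra:
  "unital_star_subalgebra (operator_algebra (ell2 X) (ell2_ip X)) band_ops"
  unfolding unital_star_subalgebra_def operator_algebra_def cvs.subspace_def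
proof (simp, intro conjI ballI allI)
  show "band_ops \<subseteq> BH" using band_opsD by blast
  show "0 \<in> band_ops" by (rule band_opsI[of _ 0]) (simp_all add: ell2.bounded_op_zero)
  show "id_op (ell2 X) \<in> band_ops"
  proof (rule band_opsI[of _ 0])
    show "d x y \<le> ennreal 0" if "x \<in> X" "y \<in> X" "id_op (ell2 X) (ell2_delta y) x \<noteq> 0" for x y
      using that by (auto simp: id_op_def ell2_delta_apply split: if_splits)
  qed (simp_all add: ell2.id_op_bounded)
next
  fix T S assume TS: "T \<in> band_ops" "S \<in> band_ops"
  obtain R where R: "R > 0" "\<And>x y. x \<in> X \<Longrightarrow> y \<in> X \<Longrightarrow> T (ell2_delta y) x \<noteq> 0 \<Longrightarrow> d x y \<le> ennreal R"
    using band_opsE[OF TS(1)] by metis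
  obtain Q where Q: "Q > 0" "\<And>x y. x \<in> X \<Longrightarrow> y \<in> X \<Longrightarrow> S (ell2_delta y) x \<noteq> 0 \<Longrightarrow> d x y \<le> ennreal Q"
    using band_opsE[OF TS(2)] by metis
  have le: "ennreal R \<le> ennreal (R + Q)" "ennreal Q \<le> ennreal (R + Q)"
    using R Q by (auto intro: ennreal_leI)
  show "T + S \<in> band_ops"
  proof (rule band_opsI[of _ "R + Q"])
    show "T + S \<in> BH" using TS band_opsD ell2.bounded_op_add by blast
    show "d x y \<le> ennreal (R + Q)" if "x \<in> X" "y \<in> X" "(T + S) (ell2_delta y) x \<noteq> 0" for x y
    proof -
      have "T (ell2_delta y) x \<noteq> 0 \<or> S (ell2_delta y) x \<noteq> 0" using that(3) by auto
      then show ?thesis using R(2) Q(2) that(1,2) le order_trans by blast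
    qed
  qed (use R Q in simp)
  show "T \<circ> S \<in> band_ops"
  proof (rule band_opsI[of _ "R + Q"])
    show "T \<circ> S \<in> BH" using TS band_opsD ell2.bounded_op_comp by blast
    show "d x y \<le> ennreal (R + Q)" if xy: "x \<in> X" "y \<in> X" "(T \<circ> S) (ell2_delta y) x \<noteq> 0" for x y
    proof -
      obtain z where z: "z \<in> X" "S (ell2_delta y) z \<noteq> 0" "T (ell2_delta z) x \<noteq> 0"
        using entry_comp_nonzero[OF band_opsD[OF TS(1)] band_opsD[OF TS(2)] xy] by blast
      have "d x y \<le> d x z + d z y" using triangle xy z by blast
      also have "\<dots> \<le> ennreal R + ennreal Q" using R(2) Q(2) xy z by (intro add_mono) auto
      also have "\<dots> = ennreal (R + Q)" using R(1) Q(1) by simp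
      finally show ?thesis .
    qed
  qed (use R Q in simp)
next
  fix T and c :: complex assume T: "T \<in> band_ops"
  obtain R where R: "R > 0" "\<And>x y. x \<in> X \<Longrightarrow> y \<in> X \<Longrightarrow> T (ell2_delta y) x \<noteq> 0 \<Longrightarrow> d x y \<le> ennreal R"
    using band_opsE[OF T] by metis
  show "c *\<^sub>C T \<in> band_ops"
  proof (rule band_opsI[of _ R])
    show "c *\<^sub>C T \<in> BH" using T band_opsD ell2.bounded_op_scale by blast
    show "d x y \<le> ennreal R" if "x \<in> X" "y \<in> X" "(c *\<^sub>C T) (ell2_delta y) x \<noteq> 0" for x y
      using that R(2) by (auto simp: scaleC_complex_def)
  qed (use R in simp)
  show "adj T \<in> band_ops"
  proof (rule band_opsI[of _ R])
    note a = ell2_adjoint_op[OF band_opsD[OF T]]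
    show "adj T \<in> BH" by (rule a(1))
    show "d x y \<le> ennreal R" if xy: "x \<in> X" "y \<in> X" "adj T (ell2_delta y) x \<noteq> 0" for x y
    proof -
      have "T (ell2_delta x) y \<noteq> 0"
        using ell2_adjoint_entry[OF a(2) band_opsD[OF T] a(1) xy(2,1)] xy(3) by auto
      then show ?thesis using R(2)[OF xy(2,1)] sym xy by simp
    qed
  qed (use R in simp)
qed

lemma Alg_subset_band: "Alg \<subseteq> band_ops"
  unfolding Alg_hull by (rule hull_minimal[where S = "unital_star_subalgebra _"])
    (rule generators_band, rule band_ops_subalgebra)

text \<open>An intersection of subalgebras is a subalgebra once the family is nonempty, since
  otherwise it would be the whole type; \<open>band_ops\<close> is a member.\<close>

lemma Alg_subalgebra: "unital_star_subalgebra (operator_algebra (ell2 X) (ell2_ip X)) Alg"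
proof -
  let ?\<F> = "{t. unital_star_subalgebra (operator_algebra (ell2 X) (ell2_ip X)) t \<and> generators \<subseteq> t}"
  have "Alg = \<Inter>?\<F>" by (simp add: Alg_hull hull_def)
  moreover have "band_ops \<in> ?\<F>" using generators_band band_ops_subalgebra by blast
  ultimately show ?thesis
    unfolding unital_star_subalgebra_def by (auto simp: cvs.subspace_def)
qed

lemma
  shows Alg_bounded: "T \<in> Alg \<Longrightarrow> T \<in> BH" and Alg_subspace: "cvs.subspace Alg"
    and Alg_id: "id_op (ell2 X) \<in> Alg"
    and Alg_comp: "T \<in> Alg \<Longrightarrow> S \<in> Alg \<Longrightarrow> T \<circ> S \<in> Alg" and Alg_adj: "T \<in> Alg \<Longrightarrow> adj T \<in> Alg"
  using Alg_subalgebra by (auto simp: unital_star_subalgebra_def operator_algebra_def)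

lemma generators_Alg: "generators \<subseteq> Alg"
  unfolding Alg_hull by (rule hull_subset)

lemma chi_Alg: "chi X S \<in> Alg"
proof -
  have "bounded ((\<lambda>x. if x \<in> S then 1 else 0 :: complex) ` X)"
    by (rule finite_imp_bounded, rule finite_subset[of _ "{0, 1}"]) auto
  then show ?thesis using generators_Alg unfolding chi_def generators_def by blast
qed

lemma translation_op_Alg: "partial_translation X d A B t \<Longrightarrow> translation_op X A t \<in> Alg"
  using generators_Alg unfolding generators_def by blast

lemma matrix_unit_Alg:
  assumes "x \<in> X" "y \<in> X" "d x y < \<infinity>"
  shows "matrix_unit X x y \<in> Alg"
proof -
  have "partial_translation X d {y} {x} (\<lambda>_. x)"
    using assms sym by (auto simp: partial_translation_def bij_betw_def)
  then show ?thesis unfolding matrix_unit_def by (rule translation_op_Alg)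
qed

lemma chi_bounded: "chi X S \<in> BH"
  using chi_Alg Alg_bounded by blast

lemma chi_comp: "chi X S \<circ> chi X T = chi X (S \<inter> T)"
proof
  fix f
  show "(chi X S \<circ> chi X T) f = chi X (S \<inter> T) f"
  proof (cases "f \<in> ell2 X")
    case True
    then show ?thesis
      using ell2.bounded_opD(1)[OF chi_bounded, of f T] by (auto simp: chi_apply fun_eq_iff)
  qed (simp add: ell2.bounded_opD[OF chi_bounded])
qed

lemma Alg_subset_Roe: "Alg \<subseteq> Roe"
proof
  fix T assume T: "T \<in> Alg"
  have "op_norm (ell2 X) (ell2_ip X) (T - T) \<le> 0" by (rule ell2.op_norm_le) auto
  then have "op_norm (ell2 X) (ell2_ip X) (T - T) < e" if "e > 0" for e using that by linarith
  then show "T \<in> Roe"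
    using T Alg_bounded unfolding Roe_closure operator_norm_closure_def by blast
qed

lemma Roe_bounded: "T \<in> Roe \<Longrightarrow> T \<in> BH"
  by (simp add: Roe_closure operator_norm_closure_def)

lemma Roe_approx:
  assumes "T \<in> Roe" "e > 0"
  obtains S where "S \<in> Alg" "T - S \<in> BH" "\<And>f. f \<in> ell2 X \<Longrightarrow> norm2 ((T - S) f) \<le> e * norm2 f"
proof -
  obtain S where S: "S \<in> Alg" "op_norm (ell2 X) (ell2_ip X) (T - S) < e"
    using assms unfolding Roe_closure operator_norm_closure_def by blast
  have b: "T - S \<in> BH"
    using cvs.subspace_diff[OF ell2.bounded_op_subspace Roe_bounded[OF assms(1)] Alg_bounded[OF S(1)]] .
  have "norm2 ((T - S) f) \<le> e * norm2 f" if "f \<in> ell2 X" for f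
    using ell2.op_norm_bound[OF b that] mult_right_mono[OF less_imp_le[OF S(2)] ell2.vnorm_ge_0[OF that]]
    by linarith
  then show ?thesis using that S(1) b by blast
qed

lemma RoeI:
  assumes "T \<in> BH" "\<And>e. e > 0 \<Longrightarrow> \<exists>S\<in>Alg. \<forall>f\<in>ell2 X. norm2 ((T - S) f) \<le> e * norm2 f"
  shows "T \<in> Roe"
  unfolding Roe_closure operator_norm_closure_def
proof (safe)
  fix e :: real assume "e > 0"
  then obtain S where S: "S \<in> Alg" "\<forall>f\<in>ell2 X. norm2 ((T - S) f) \<le> e / 2 * norm2 f"
    using assms(2)[of "e / 2"] by auto
  have "op_norm (ell2 X) (ell2_ip X) (T - S) \<le> e / 2"
    using S(2) \<open>e > 0\<close> by (intro ell2.op_norm_le) auto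
  then show "\<exists>S\<in>Alg. op_norm (ell2 X) (ell2_ip X) (T - S) < e" using S(1) \<open>e > 0\<close> by force
qed (rule assms(1))

lemma Roe_subspace: "cvs.subspace Roe"
  unfolding cvs.subspace_def
proof (intro conjI ballI allI)
  show "0 \<in> Roe" using Alg_subset_Roe cvs.subspace_0[OF Alg_subspace] by blast
next
  fix T S assume TS: "T \<in> Roe" "S \<in> Roe"
  show "T + S \<in> Roe"
  proof (rule RoeI)
    show "T + S \<in> BH" using ell2.bounded_op_add Roe_bounded TS by blast
    fix e :: real assume e: "e > 0"
    then have e2: "e / 2 > 0" by simp
    obtain T' where T': "T' \<in> Alg" "T - T' \<in> BH" "\<And>f. f \<in> ell2 X \<Longrightarrow> norm2 ((T - T') f) \<le> e / 2 * norm2 f"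
      using Roe_approx[OF TS(1) e2] by metis
    obtain S' where S': "S' \<in> Alg" "S - S' \<in> BH" "\<And>f. f \<in> ell2 X \<Longrightarrow> norm2 ((S - S') f) \<le> e / 2 * norm2 f"
      using Roe_approx[OF TS(2) e2] by metis
    have "norm2 ((T + S - (T' + S')) f) \<le> e * norm2 f" if f: "f \<in> ell2 X" for f
    proof -
      have "(T + S - (T' + S')) f = (T - T') f + (S - S') f" by simp
      then have "norm2 ((T + S - (T' + S')) f) \<le> norm2 ((T - T') f) + norm2 ((S - S') f)"
        using ell2.vnorm_triangle[OF ell2.bounded_opD(1)[OF T'(2) f] ell2.bounded_opD(1)[OF S'(2) f]]
        by (simp only:)
      then show ?thesis using T'(3)[OF f] S'(3)[OF f] by (simp add: field_simps)
    qed
    moreover have "T' + S' \<in> Alg" using cvs.subspace_add[OF Alg_subspace] T'(1) S'(1) by blast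
    ultimately show "\<exists>U\<in>Alg. \<forall>f\<in>ell2 X. norm2 ((T + S - U) f) \<le> e * norm2 f" by blast
  qed
next
  fix T and c :: complex assume T: "T \<in> Roe"
  show "c *\<^sub>C T \<in> Roe"
  proof (rule RoeI)
    show "c *\<^sub>C T \<in> BH" using ell2.bounded_op_scale Roe_bounded T by blast
    fix e :: real assume e: "e > 0"
    define r where "r = e / (cmod c + 1)"
    have r: "r > 0" "cmod c * r \<le> e" using e by (simp_all add: r_def divide_simps add_nonneg_pos)
    obtain T' where T': "T' \<in> Alg" "T - T' \<in> BH" "\<And>f. f \<in> ell2 X \<Longrightarrow> norm2 ((T - T') f) \<le> r * norm2 f"
      using Roe_approx[OF T r(1)] by metis
    have "norm2 ((c *\<^sub>C T - c *\<^sub>C T') f) \<le> e * norm2 f" if f: "f \<in> ell2 X" for f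
    proof -
      have "(c *\<^sub>C T - c *\<^sub>C T') f = c *\<^sub>C ((T - T') f)" by (simp add: cvs.scale_right_diff_distrib)
      then have "norm2 ((c *\<^sub>C T - c *\<^sub>C T') f) = cmod c * norm2 ((T - T') f)"
        using ell2.vnorm_scale[OF ell2.bounded_opD(1)[OF T'(2) f]] by simp
      also have "\<dots> \<le> cmod c * (r * norm2 f)" using T'(3)[OF f] by (intro mult_left_mono) auto
      also have "\<dots> \<le> e * norm2 f"
        using mult_right_mono[OF r(2) ell2.vnorm_ge_0[OF f]] by (simp add: mult.assoc)
      finally show ?thesis .
    qed
    moreover have "c *\<^sub>C T' \<in> Alg" using cvs.subspace_scale[OF Alg_subspace] T'(1) by blast
    ultimately show "\<exists>U\<in>Alg. \<forall>f\<in>ell2 X. norm2 ((c *\<^sub>C T - U) f) \<le> e * norm2 f" by blast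
  qed
qed

text \<open>The adjoint of T - S satisfies the same norm bound as T - S, so adjoints of approximants
  approximate the adjoint.\<close>

lemma Roe_adj:
  assumes T: "T \<in> Roe"
  shows "adj T \<in> Roe"
proof (rule RoeI)
  note aT = ell2_adjoint_op[OF Roe_bounded[OF T]]
  show "adj T \<in> BH" by (rule aT(1))
  fix e :: real assume e: "e > 0"
  obtain S where S: "S \<in> Alg" "T - S \<in> BH" "\<And>f. f \<in> ell2 X \<Longrightarrow> norm2 ((T - S) f) \<le> e * norm2 f"
    using Roe_approx[OF T e] by metis
  note aS = ell2_adjoint_op[OF Alg_bounded[OF S(1)]]
  have aD: "adj T - adj S \<in> BH" using cvs.subspace_diff[OF ell2.bounded_op_subspace aT(1) aS(1)] .
  have TH: "T f \<in> ell2 X" "S f \<in> ell2 X" "adj T f \<in> ell2 X" "adj S f \<in> ell2 X" if "f \<in> ell2 X" for f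
    using ell2.bounded_opD(1)[OF _ that] Roe_bounded[OF T] Alg_bounded[OF S(1)] aT(1) aS(1) by auto
  have "is_adj (T - S) (adj T - adj S)"
    using aT(2) aS(2) TH by (simp add: is_adjoint_def ell2.ip_diff_left ell2.ip_diff_right)
  then have "norm2 ((adj T - adj S) f) \<le> e * norm2 f" if "f \<in> ell2 X" for f
    by (rule ell2.adjoint_bound[where T = "T - S" and S = "adj T - adj S",
        OF _ ell2.bounded_opD(1)[OF S(2)] ell2.bounded_opD(1)[OF aD] S(3) less_imp_le[OF e] that])
  then show "\<exists>U\<in>Alg. \<forall>f\<in>ell2 X. norm2 ((adj T - U) f) \<le> e * norm2 f" using Alg_adj[OF S(1)] by blast
qed

lemma ell2_delta_norm: "x \<in> X \<Longrightarrow> norm2 (ell2_delta x) = 1"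
  using ell2.orthonormalD(4)[OF ell2_orthonormal[of "{x}" X]] by simp

text \<open>Entries are norm continuous and vanish for band operators. Hence every element of the
  Roe algebra respects the decomposition of \<open>X\<close> into components of mutually finite
  distance.\<close>

lemma Roe_entry_infinite:
  assumes T: "T \<in> Roe" and xy: "x \<in> X" "y \<in> X" "d x y = \<infinity>"
  shows "T (ell2_delta y) x = 0"
proof -
  have "cmod (T (ell2_delta y) x) \<le> 0 + e" if e: "e > 0" for e
  proof -
    obtain S where S: "S \<in> Alg" "T - S \<in> BH" "\<And>f. f \<in> ell2 X \<Longrightarrow> norm2 ((T - S) f) \<le> e * norm2 f"
      using Roe_approx[OF T e] by metis
    obtain R where "R > 0" and R: "\<And>x y. x \<in> X \<Longrightarrow> y \<in> X \<Longrightarrow> S (ell2_delta y) x \<noteq> 0 \<Longrightarrow> d x y \<le> ennreal R"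
      using band_opsE[OF subsetD[OF Alg_subset_band S(1)]] by metis
    have "S (ell2_delta y) x = 0" using R[OF xy(1,2)] xy(3) by (auto simp: top_unique)
    then have "cmod (T (ell2_delta y) x) = cmod ((T - S) (ell2_delta y) x)" by simp
    also have "\<dots> \<le> norm2 ((T - S) (ell2_delta y))"
      by (rule ell2_cmod_le[OF ell2.bounded_opD(1)[OF S(2) ell2_delta_in[OF xy(2)]]])
    also have "\<dots> \<le> e" using S(3)[of "ell2_delta y"] xy by (simp add: ell2_delta_norm)
    finally show ?thesis by simp
  qed
  then have "cmod (T (ell2_delta y) x) \<le> 0" by (rule field_le_epsilon)
  then show ?thesis by simp
qed

lemma Roe_component:
  assumes T: "T \<in> Roe" and f: "f \<in> ell2 X" and x: "x \<in> X" and C: "\<And>y. y \<in> X \<Longrightarrow> f y \<noteq> 0 \<Longrightarrow> d x y = \<infinity>"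
  shows "T f x = 0"
proof -
  have "((\<lambda>y. f y * T (ell2_delta y) x) has_sum T f x) X"
    by (rule ell2_matrix[OF Roe_bounded[OF T] f x])
  moreover have "((\<lambda>y. f y * T (ell2_delta y) x) has_sum 0) X"
    using Roe_entry_infinite[OF T x] C by (intro has_sum_0) force
  ultimately show ?thesis by (rule has_sum_unique)
qed

subsection \<open>Matrix units\<close>

lemma finite_distance_trans:
  assumes "x \<in> X" "y \<in> X" "z \<in> X" "d x y < \<infinity>" "d y z < \<infinity>"
  shows "d x z < \<infinity>"
proof -
  have "d x z \<le> d x y + d y z" using assms triangle by blast
  also have "\<dots> < \<infinity>" using assms by simp
  finally show ?thesis .
qed

text \<open>Being at finite distance is an equivalence relation. For equivalent points the
  predicates under the choice operator coincide, so the same representative is chosen.\<close>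

lemma component_representatives:
  obtains c where "\<And>x. x \<in> X \<Longrightarrow> c x \<in> X" "\<And>x. x \<in> X \<Longrightarrow> d x (c x) < \<infinity>"
    "\<And>x y. x \<in> X \<Longrightarrow> y \<in> X \<Longrightarrow> d x y < \<infinity> \<Longrightarrow> c x = c y"
proof -
  define c where "c x = (SOME y. y \<in> X \<and> d x y < \<infinity>)" for x
  have c: "c x \<in> X \<and> d x (c x) < \<infinity>" if "x \<in> X" for x
    unfolding c_def by (rule someI[of _ x]) (simp add: that)
  have "c x = c y" if "x \<in> X" "y \<in> X" "d x y < \<infinity>" for x y
  proof -
    have "(\<lambda>z. z \<in> X \<and> d x z < \<infinity>) = (\<lambda>z. z \<in> X \<and> d y z < \<infinity>)"
      using finite_distance_trans[of x y] finite_distance_trans[of y x] that sym[of x y] by auto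
    then show ?thesis by (simp add: c_def)
  qed
  then show ?thesis using that[of c] c by blast
qed

lemma matrix_unit_delta: "z \<in> X \<Longrightarrow> matrix_unit X x y (ell2_delta z) w = (if z = y \<and> w = x then 1 else 0)"
  by (simp add: matrix_unit_apply scaleC_complex_def ell2_delta_apply)

lemma matrix_unit_inj: "c x \<in> X \<Longrightarrow> matrix_unit X x (c x) = matrix_unit X x' (c x') \<Longrightarrow> x = x'"
  using matrix_unit_delta[of "c x" x "c x" x] matrix_unit_delta[of "c x" x' "c x'" x] by (auto split: if_splits)

text \<open>The units lie in pairwise different rows, whatever the columns are, so their own entries
  are dual functionals. Used with base points as columns and, for diagonal units, with
  \<open>c x = x\<close>.\<close>

lemma matrix_unit_independent:
  assumes c: "\<And>x. x \<in> F \<Longrightarrow> c x \<in> X"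
  shows "cvs.independent ((\<lambda>x. matrix_unit X x (c x)) ` F)" "card ((\<lambda>x. matrix_unit X x (c x)) ` F) = card F"
proof -
  let ?m = "\<lambda>x. matrix_unit X x (c x)"
  have inj: "inj_on ?m F"
  proof (rule inj_onI)
    fix x x' assume "x \<in> F" "x' \<in> F" "?m x = ?m x'"
    then show "x = x'" using matrix_unit_inj[of c x x'] c by simp
  qed
  then show "card (?m ` F) = card F" by (rule card_image)
  define \<phi> where "\<phi> b T = T (ell2_delta (c (inv_into F ?m b))) (inv_into F ?m b)"
    for b and T :: "('a \<Rightarrow> complex) \<Rightarrow> 'a \<Rightarrow> complex"
  show "cvs.independent (?m ` F)"
  proof (rule independent_if_dual[where \<phi> = \<phi>])
    fix b b' assume "b \<in> ?m ` F" "b' \<in> ?m ` F"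
    then obtain x x' where x: "x \<in> F" "x' \<in> F" "b = ?m x" "b' = ?m x'" by blast
    have "\<phi> b b' = matrix_unit X x' (c x') (ell2_delta (c x)) x" using x(1,3,4) inv_into_f_f[OF inj x(1)] by (simp add: \<phi>_def)
    also have "\<dots> = (if x = x' then 1 else 0)" using matrix_unit_delta[OF c[OF x(1)]] by auto
    finally show "\<phi> b b' = (if b = b' then 1 else 0)" using x inj_on_eq_iff[OF inj x(1,2)] by simp
  qed (simp_all add: \<phi>_def scaleC_complex_def)
qed

lemma comp_matrix_unit:
  assumes a: "a \<in> BH" and x: "x \<in> X" and G: "finite G" "G \<subseteq> X"
    "\<And>z. z \<in> X - G \<Longrightarrow> a (ell2_delta x) z = 0"
  shows "a \<circ> matrix_unit X x y = (\<Sum>z\<in>G. a (ell2_delta x) z *\<^sub>C matrix_unit X z y)"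
proof
  fix f
  show "(a \<circ> matrix_unit X x y) f = (\<Sum>z\<in>G. a (ell2_delta x) z *\<^sub>C matrix_unit X z y) f"
  proof (cases "f \<in> ell2 X")
    case True
    have aH: "a (ell2_delta x) \<in> ell2 X" using ell2.bounded_opD(1)[OF a] x by blast
    have z: "a (ell2_delta x) z = 0" if "z \<notin> G" for z using that G(3) aH by (cases "z \<in> X") (auto simp: ell2_def)
    have "(a \<circ> matrix_unit X x y) f = f y *\<^sub>C a (ell2_delta x)"
      using True x ell2.bounded_opD(5)[OF a] by (simp add: matrix_unit_apply)
    also have "a (ell2_delta x) = (\<Sum>z\<in>G. a (ell2_delta x) z *\<^sub>C ell2_delta z)"
      by (rule ell2_finite_support(3)[OF G(1,2) z])
    also have "f y *\<^sub>C (\<Sum>z\<in>G. a (ell2_delta x) z *\<^sub>C ell2_delta z)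
        = (\<Sum>z\<in>G. a (ell2_delta x) z *\<^sub>C matrix_unit X z y) f"
      using True by (simp add: sum_fun_apply[of _ G f] matrix_unit_apply cvs.scale_sum_right mult.commute)
    finally show ?thesis .
  qed (simp add: matrix_unit_def translation_op_def ell2.bounded_opD(3)[OF a] sum_fun_apply[of _ G f])
qed

text \<open>If the rows over a finite \<open>Y\<close> vanish outside \<open>Y\<close>, cutting to
  these rows leaves a |Y| x |Y| matrix; this is the origin of the bound |Y|^2.\<close>

lemma chi_comp_finite:
  assumes T: "T \<in> BH" and Y: "finite Y" "Y \<subseteq> X"
    and z: "\<And>x y. x \<in> Y \<Longrightarrow> y \<in> X - Y \<Longrightarrow> T (ell2_delta y) x = 0"
  shows "chi X Y \<circ> T = (\<Sum>x\<in>Y. \<Sum>y\<in>Y. T (ell2_delta y) x *\<^sub>C matrix_unit X x y)"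
proof
  fix f
  show "(chi X Y \<circ> T) f = (\<Sum>x\<in>Y. \<Sum>y\<in>Y. T (ell2_delta y) x *\<^sub>C matrix_unit X x y) f"
  proof (cases "f \<in> ell2 X")
    case True
    have Tf: "T f x = (\<Sum>y\<in>Y. f y * T (ell2_delta y) x)" if x: "x \<in> Y" for x
    proof -
      have "((\<lambda>y. f y * T (ell2_delta y) x) has_sum T f x) X"
        using x Y by (intro ell2_matrix[OF T True]) auto
      moreover have "((\<lambda>y. f y * T (ell2_delta y) x) has_sum (\<Sum>y\<in>Y. f y * T (ell2_delta y) x)) X"
        using Y z[OF x] by (intro has_sum_finite_neutralI) auto
      ultimately show ?thesis by (rule has_sum_unique)
    qed
    have "(\<Sum>x\<in>Y. \<Sum>y\<in>Y. T (ell2_delta y) x *\<^sub>C matrix_unit X x y) f =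
        (\<Sum>x\<in>Y. (if x \<in> Y then T f x else 0) *\<^sub>C ell2_delta x)"
      using True unfolding sum_fun_apply[of _ _ f]
      by (intro sum.cong) (simp_all add: matrix_unit_apply Tf cvs.scale_sum_left scaleC_complex_def mult.commute)
    also have "\<dots> = (\<lambda>x. if x \<in> Y then T f x else 0)"
      by (rule ell2_finite_support(3)[symmetric, OF Y]) simp
    finally show ?thesis
      using ell2.bounded_opD(1)[OF T True] by (simp add: chi_apply)
  qed (simp add: ell2.bounded_opD(2)[OF T] ell2.bounded_opD(3)[OF chi_bounded] matrix_unit_def translation_op_def
      sum_fun_apply[of _ _ f])
qed

lemma left_comp_span:
  assumes a: "a \<in> BH" and S: "S \<subseteq> BH" and T: "T \<in> cvs.span S"
  shows "a \<circ> T \<in> cvs.span ((\<lambda>T. a \<circ> T) ` S)"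
proof -
  have "a \<circ> (T + T') = (a \<circ> T) + (a \<circ> T')" if "T \<in> BH" "T' \<in> BH" for T T'
  proof
    fix f show "(a \<circ> (T + T')) f = ((a \<circ> T) + (a \<circ> T')) f"
      using ell2.bounded_opD(4)[OF a, of "T f" "T' f"] ell2.bounded_opD(3)[OF a]
        ell2.bounded_opD(1,2)[OF that(1), of f] ell2.bounded_opD(1,2)[OF that(2), of f]
      by (cases "f \<in> ell2 X") simp_all
  qed
  moreover have "a \<circ> (c *\<^sub>C T) = c *\<^sub>C (a \<circ> T)" if "T \<in> BH" for c T
  proof
    fix f show "(a \<circ> (c *\<^sub>C T)) f = (c *\<^sub>C (a \<circ> T)) f"
      using ell2.bounded_opD(5)[OF a, of "T f" c] ell2.bounded_opD(3)[OF a]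
        ell2.bounded_opD(1,2)[OF that, of f]
      by (cases "f \<in> ell2 X") simp_all
  qed
  ultimately show ?thesis
    using linear_image_span[OF ell2.bounded_op_subspace S, where U = "\<lambda>T. a \<circ> T"] T by blast
qed

section \<open>Foelner sets as subspaces of matrix columns\<close>

section \<open>Proper amenability implies proper algebraic amenability\<close>

lemma band_finite_propagation:
  assumes "finite \<F>" "\<F> \<subseteq> band_ops"
  obtains R where "R > 0"
    "\<And>a x y. a \<in> \<F> \<Longrightarrow> x \<in> X \<Longrightarrow> y \<in> X \<Longrightarrow> a (ell2_delta y) x \<noteq> 0 \<Longrightarrow> d x y \<le> ennreal R"
proof -
  have "\<exists>R>0. \<forall>a\<in>\<F>. \<forall>x\<in>X. \<forall>y\<in>X. a (ell2_delta y) x \<noteq> 0 \<longrightarrow> d x y \<le> ennreal R"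
    using assms
  proof (induction \<F> rule: finite_induct)
    case empty
    then show ?case by (intro exI[of _ 1]) simp
  next
    case (insert a \<F>)
    then obtain R where R: "R > 0" "\<forall>a\<in>\<F>. \<forall>x\<in>X. \<forall>y\<in>X. a (ell2_delta y) x \<noteq> 0 \<longrightarrow> d x y \<le> ennreal R"
      by blast
    obtain Q where Q: "Q > 0" "\<And>x y. x \<in> X \<Longrightarrow> y \<in> X \<Longrightarrow> a (ell2_delta y) x \<noteq> 0 \<Longrightarrow> d x y \<le> ennreal Q"
      using band_opsE[of a] insert.prems by blast
    have le: "ennreal R \<le> ennreal (max R Q)" "ennreal Q \<le> ennreal (max R Q)"
      by (auto intro: ennreal_leI)
    then have "\<forall>a'\<in>insert a \<F>. \<forall>x\<in>X. \<forall>y\<in>X. a' (ell2_delta y) x \<noteq> 0 \<longrightarrow> d x y \<le> ennreal (max R Q)"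
      using R(2) Q(2) order_trans by (metis insert_iff)
    then show ?case using R(1) by (intro exI[of _ "max R Q"]) simp
  qed
  then show ?thesis using that by blast
qed

text \<open>The whole algebra is finite dimensional and invariant. This case stands apart because a
  finite space has no arbitrarily large Foelner sets to absorb the extra generators.\<close>

lemma finite_Alg_amenable:
  assumes X: "finite X" "X \<noteq> {}"
  shows "properly_alg_amenable (alg_uniform_roe X d)"
proof -
  have "Alg \<subseteq> cvs.span ((\<lambda>(x, y). matrix_unit X x y) ` (X \<times> X))"
  proof
    fix T assume "T \<in> Alg"
    then have T: "T \<in> BH" by (rule Alg_bounded)
    have "chi X X \<circ> T = T"
    proof
      fix f show "(chi X X \<circ> T) f = T f"
        using ell2.bounded_opD(1,2)[OF T, of f] ell2.bounded_opD(3)[OF chi_bounded]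
        by (cases "f \<in> ell2 X") (auto simp: chi_apply ell2_def fun_eq_iff)
    qed
    then have "T = (\<Sum>x\<in>X. \<Sum>y\<in>X. T (ell2_delta y) x *\<^sub>C matrix_unit X x y)"
      using chi_comp_finite[OF T X(1)] by simp
    also have "\<dots> \<in> cvs.span ((\<lambda>(x, y). matrix_unit X x y) ` (X \<times> X))"
      by (intro cvs.span_sum cvs.span_scale cvs.span_base) auto
    finally show "T \<in> cvs.span ((\<lambda>(x, y). matrix_unit X x y) ` (X \<times> X))" .
  qed
  then have fd: "finite_dimensional Alg"
    unfolding finite_dimensional_def using X(1)
    by (intro exI[of _ "(\<lambda>(x, y). matrix_unit X x y) ` (X \<times> X)"]) simp
  obtain x where x: "x \<in> X" using X by blast
  have "matrix_unit X x x \<in> Alg" using x by (intro matrix_unit_Alg) auto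
  moreover have "matrix_unit X x x \<noteq> 0" using matrix_unit_delta[OF x, of x x x] by auto
  ultimately have nz: "Alg \<noteq> {0}" by blast
  have "{mul (alg_uniform_roe X d) a v + w |v w. v \<in> Alg \<and> w \<in> Alg} = Alg" if a: "a \<in> Alg" for a
  proof -
    have mul: "mul (alg_uniform_roe X d) = (\<circ>)" by (simp add: alg_uniform_roe_def operator_algebra_def)
    have 0: "(0 :: ('a \<Rightarrow> complex) \<Rightarrow> 'a \<Rightarrow> complex) \<in> Alg" using cvs.subspace_0[OF Alg_subspace] .
    have "a \<circ> 0 = 0" using ell2.bounded_opD(3)[OF Alg_bounded[OF a]] by (auto simp: fun_eq_iff zero_fun_def)
    then have "w \<in> {(a \<circ> v) + w |v w. v \<in> Alg \<and> w \<in> Alg}" if "w \<in> Alg" for w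
      unfolding mem_Collect_eq using that 0 by (intro exI[of _ 0] exI[of _ w]) simp
    then show ?thesis
      unfolding mul using Alg_comp[OF a] cvs.subspace_add[OF Alg_subspace] by blast
  qed
  then show ?thesis
    unfolding properly_alg_amenable_def
    by (intro allI impI exI[of _ Alg]) (use Alg_subspace fd nz in \<open>simp add: subset_iff algebra_simps\<close>)
qed

text \<open>A nonzero entry of a at (z, x) means finite distance, so c z = c x and left
  multiplication by a stays among the units at (z, c z). Their index moves only to the neighbourhood
  of \<open>F\<close>, which exceeds \<open>F\<close> by at most its boundary.\<close>

theorem properly_amenable_imp_alg:
  assumes PA: "properly_amenable X d"
  shows "properly_alg_amenable (alg_uniform_roe X d)"
proof (cases "finite X")
  case True
  have "X \<noteq> {}" using PA unfolding properly_amenable_def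
    by (metis finite.emptyI subset_empty zero_less_one)
  then show ?thesis using True finite_Alg_amenable by blast
next
  case inf: False
  obtain c where c: "\<And>x. x \<in> X \<Longrightarrow> c x \<in> X" "\<And>x. x \<in> X \<Longrightarrow> d x (c x) < \<infinity>"
    "\<And>x y. x \<in> X \<Longrightarrow> y \<in> X \<Longrightarrow> d x y < \<infinity> \<Longrightarrow> c x = c y"
    using component_representatives by metis
  let ?m = "\<lambda>x. matrix_unit X x (c x)"
  have mul: "mul (alg_uniform_roe X d) = (\<circ>)" by (simp add: alg_uniform_roe_def operator_algebra_def)
  have m_Alg: "?m x \<in> Alg" if "x \<in> X" for x using matrix_unit_Alg c that by blast
  show ?thesis
    unfolding properly_alg_amenable_def mul
  proof (intro allI impI)
    fix \<epsilon> :: real and \<F> assume "\<epsilon> > 0 \<and> finite \<F> \<and> \<F> \<subseteq> Alg"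
    then have \<epsilon>: "\<epsilon> > 0" and \<F>: "finite \<F>" "\<F> \<subseteq> Alg" by auto
    obtain R where R: "R > 0"
      "\<And>a x y. a \<in> \<F> \<Longrightarrow> x \<in> X \<Longrightarrow> y \<in> X \<Longrightarrow> a (ell2_delta y) x \<noteq> 0 \<Longrightarrow> d x y \<le> ennreal R"
      using band_finite_propagation[OF \<F>(1)] \<F>(2) Alg_subset_band by (metis subset_trans)
    \<comment> \<open>The excess \<epsilon>|F| is split: one half pays for the boundary, the other
      for the at most 2 |\<F>| generators in \<F> and a \<F>. The latter needs |F| \<ge> 4 |\<F>| /
      \<epsilon>.\<close>
    obtain n :: nat where n: "4 * card \<F> / \<epsilon> < n" using reals_Archimedean2 by blast
    obtain A where A: "finite A" "card A = Suc n" "A \<subseteq> X"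
      using infinite_arbitrarily_large[OF inf] by blast
    obtain F where F: "finite F" "F \<subseteq> X" "A \<subseteq> F"
      "real (card (R_boundary X d R F)) \<le> \<epsilon> / 2 * real (card F)"
      using PA A R(1) \<epsilon> unfolding properly_amenable_def by (metis half_gt_zero)
    have cF: "2 * card \<F> \<le> \<epsilon> / 2 * card F"
    proof -
      have "n \<le> card F" using card_mono[OF F(1,3)] A(2) by simp
      then have "4 * card \<F> / \<epsilon> \<le> card F" using n by linarith
      then show ?thesis using \<epsilon> by (simp add: field_simps)
    qed
    define G where "G = nbhd R F"
    have G: "finite G" "F \<subseteq> G" "G \<subseteq> X"
      using finite_nbhd F R subset_nbhd nbhd_subset by (auto simp: G_def)
    have "card G = card F + card (G - F)"
      using G F by (metis card_Diff_subset card_mono le_add_diff_inverse)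
    also have "card (G - F) \<le> card (R_boundary X d R F)"
      using nbhd_diff_subset_R_boundary F R finite_R_boundary by (simp add: card_mono G_def)
    finally have cG: "real (card G) \<le> card F + \<epsilon> / 2 * card F" using F(4) by simp
    define W where "W = cvs.span (\<F> \<union> ?m ` F)"
    have gen_Alg: "\<F> \<union> ?m ` F \<subseteq> Alg" using \<F> m_Alg F by auto
    have WA: "W \<subseteq> Alg" unfolding W_def by (rule cvs.span_minimal[OF gen_Alg Alg_subspace])
    have fd: "finite_dimensional W" 
      unfolding finite_dimensional_def W_def using \<F> F by (intro exI[of _ "\<F> \<union> ?m ` F"]) simp
    have mW: "?m ` F \<subseteq> W" unfolding W_def by (rule order_trans[OF _ cvs.span_superset]) simp
    have dimW: "card F \<le> cvs.dim W"
    proof -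
      have "c x \<in> X" if "x \<in> F" for x using c(1) F(2) that by blast
      note mi = matrix_unit_independent[of F c, OF this]
      show ?thesis using independent_card_le_dim(2)[OF fd mW mi(1)] mi(2) by simp
    qed
    have nz: "W \<noteq> {0}"
    proof -
      obtain x where x: "x \<in> F" using F(3) A(2) by fastforce
      then have "?m x \<noteq> 0" using matrix_unit_delta[OF c(1), of x x "c x" x] F(2) by auto
      then show ?thesis using mW x by blast
    qed
    have small: "real (cvs.dim {(a \<circ> v) + w |v w. v \<in> W \<and> w \<in> W}) \<le> (1 + \<epsilon>) * real (cvs.dim W)"
      if a: "a \<in> \<F>" for a
    proof -
      have aB: "a \<in> BH" using a \<F> Alg_bounded by blast
      let ?S = "\<F> \<union> ?m ` G \<union> (\<lambda>b. a \<circ> b) ` \<F>"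
      have "a \<circ> ?m x \<in> cvs.span ?S" if x: "x \<in> F" for x
      proof -
        have xX: "x \<in> X" using x F by blast
        have "a \<circ> ?m x = (\<Sum>z\<in>G. a (ell2_delta x) z *\<^sub>C matrix_unit X z (c x))"
        proof (rule comp_matrix_unit[OF aB xX G(1,3)])
          show "a (ell2_delta x) z = 0" if "z \<in> X - G" for z
          proof (rule ccontr)
            assume "a (ell2_delta x) z \<noteq> 0"
            then have "d x z \<le> ennreal R" using R(2)[OF a, of z x] that xX sym[of x z] by simp
            then show False using that x by (auto simp: G_def nbhd_def)
          qed
        qed
        also have "\<dots> = (\<Sum>z\<in>G. a (ell2_delta x) z *\<^sub>C ?m z)"
        proof (rule sum.cong)
          fix z assume z: "z \<in> G"
          show "a (ell2_delta x) z *\<^sub>C matrix_unit X z (c x) = a (ell2_delta x) z *\<^sub>C ?m z"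
          proof (cases "a (ell2_delta x) z = 0")
            case False
            then have "d z x \<le> ennreal R" using R(2)[OF a] z G xX by blast
            then have "d z x < \<infinity>" using ennreal_less_top order_le_less_trans by fastforce
            then show ?thesis using c(3)[of z x] z G xX by auto
          qed simp
        qed simp
        also have "\<dots> \<in> cvs.span ?S" by (intro cvs.span_sum cvs.span_scale cvs.span_base) auto
        finally show ?thesis .
      qed
      then have im: "(\<lambda>b. a \<circ> b) ` (\<F> \<union> ?m ` F) \<subseteq> cvs.span ?S"
        using cvs.span_superset[of ?S] by blast
      have gB: "\<F> \<union> ?m ` F \<subseteq> BH" using gen_Alg Alg_bounded by blast
      have av: "a \<circ> v \<in> cvs.span ?S" if "v \<in> W" for v
        by (rule subsetD[OF cvs.span_minimal[OF im cvs.subspace_span]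
            left_comp_span[OF aB gB that[unfolded W_def]]])
      have "W \<subseteq> cvs.span ?S" unfolding W_def using G(2) by (intro cvs.span_mono) auto
      then have "{(a \<circ> v) + w |v w. v \<in> W \<and> w \<in> W} \<subseteq> cvs.span ?S"
        using cvs.span_add[OF av] by (auto simp only: mem_Collect_eq subset_iff)
      then have "cvs.dim {(a \<circ> v) + w |v w. v \<in> W \<and> w \<in> W} \<le> card ?S"
        using \<F> G by (intro cvs.dim_le_card) auto
      also have "\<dots> \<le> card \<F> + card G + card \<F>"
        using card_Un_le[of "\<F> \<union> ?m ` G" "(\<lambda>b. a \<circ> b) ` \<F>"] card_Un_le[of \<F> "?m ` G"]
          card_image_le[OF G(1), of ?m] card_image_le[OF \<F>(1), of "\<lambda>b. a \<circ> b"] by linarith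
      finally have "real (cvs.dim {(a \<circ> v) + w |v w. v \<in> W \<and> w \<in> W}) \<le> 2 * card \<F> + card G" by linarith
      also have "\<dots> \<le> (1 + \<epsilon>) * card F" using cF cG by (simp add: algebra_simps)
      also have "\<dots> \<le> (1 + \<epsilon>) * cvs.dim W" using dimW \<epsilon> by (intro mult_left_mono) auto
      finally show ?thesis .
    qed
    have "\<F> \<subseteq> W" unfolding W_def by (rule order_trans[OF _ cvs.span_superset]) simp
    then show "\<exists>W. cvs.subspace W \<and> W \<subseteq> Alg \<and> finite_dimensional W \<and> W \<noteq> {0} \<and> \<F> \<subseteq> W \<and>
        (\<forall>a\<in>\<F>. real (cvs.dim {(a \<circ> v) + w |v w. v \<in> W \<and> w \<in> W}) \<le> (1 + \<epsilon>) * real (cvs.dim W))"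
      using WA fd nz small by (intro exI[of _ W]) (auto simp: W_def)
  qed
qed

section \<open>Paradoxical isometries against almost invariant subspaces\<close>

section \<open>Paradoxical decompositions and the algebraic Roe algebra\<close>

lemma adj_apply:
  assumes T: "T \<in> BH" and g: "g \<in> ell2 X" and x: "x \<in> X"
  shows "adj T g x = ell2_ip X g (T (ell2_delta x))"
proof -
  note a = ell2_adjoint_op[OF T]
  have m: "adj T g \<in> ell2 X" "ell2_delta x \<in> ell2 X" "T (ell2_delta x) \<in> ell2 X"
    using ell2.bounded_opD(1)[OF a(1) g] ell2.bounded_opD(1)[OF T] x by auto
  have "adj T g x = ell2_ip X (adj T g) (ell2_delta x)" using ell2_ip_delta[OF x] by simp
  also have "\<dots> = cnj (ell2_ip X (ell2_delta x) (adj T g))" by (rule ell2.ip_commute[OF m(2,1)])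
  also have "ell2_ip X (ell2_delta x) (adj T g) = ell2_ip X (T (ell2_delta x)) g"
    using a(2) g m by (simp add: is_adjoint_def)
  also have "cnj \<dots> = ell2_ip X g (T (ell2_delta x))" by (rule ell2.ip_commute[OF m(3) g, symmetric])
  finally show ?thesis .
qed

lemma BH_eqI:
  assumes "T \<in> BH" "S \<in> BH" "\<And>f x. f \<in> ell2 X \<Longrightarrow> x \<in> X \<Longrightarrow> T f x = S f x"
  shows "T = S"
proof (intro ext)
  fix f x
  show "T f x = S f x"
  proof (cases "f \<in> ell2 X")
    case True
    then have "T f \<in> ell2 X" "S f \<in> ell2 X" using ell2.bounded_opD(1) assms by auto
    then show ?thesis using assms(3)[OF True] by (cases "x \<in> X") (auto simp: ell2_def)
  qed (simp add: ell2.bounded_opD(2)[OF assms(1)] ell2.bounded_opD(2)[OF assms(2)])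
qed

text \<open>\<open>V i\<close> moves the delta at x to the delta at \<phi> i x. All properties are
  recorded as operator identities in the algebra, so they remain available after applying an
  arbitrary representation.\<close>

lemma paradoxical_isometries:
  assumes np: "\<not> properly_amenable X d"
  obtains Y V Z where "finite Y" "Y \<subseteq> X" "\<And>x y. x \<in> Y \<Longrightarrow> y \<in> X - Y \<Longrightarrow> d x y = \<infinity>"
    "\<And>i. i < (2::nat) \<Longrightarrow> V i \<in> Alg"
    "\<And>i. i < 2 \<Longrightarrow> adj (V i) \<circ> V i = chi X (X - Y)" "\<And>i. i < 2 \<Longrightarrow> V i \<circ> chi X (X - Y) = V i"
    "adj (V 0) \<circ> V 1 = 0" "adj (V 1) \<circ> V 0 = 0"
    "\<And>i. i < 2 \<Longrightarrow> V i \<circ> adj (V i) = chi X (Z i)" "\<And>i. i < 2 \<Longrightarrow> Z i \<subseteq> X - Y" "Z 0 \<inter> Z 1 = {}"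
proof -
  obtain Y r \<phi> where Y: "finite Y" "Y \<subseteq> X" "\<And>x y. x \<in> Y \<Longrightarrow> y \<in> X - Y \<Longrightarrow> d x y = \<infinity>"
    and inj: "\<And>i. i < (2::nat) \<Longrightarrow> inj_on (\<phi> i) (X - Y)"
    and ran: "\<And>i x. i < 2 \<Longrightarrow> x \<in> X - Y \<Longrightarrow> \<phi> i x \<in> X - Y"
    and disj: "\<And>x y. x \<in> X - Y \<Longrightarrow> y \<in> X - Y \<Longrightarrow> \<phi> 0 x \<noteq> \<phi> 1 y"
    and dist: "\<And>i x. i < 2 \<Longrightarrow> x \<in> X - Y \<Longrightarrow> d x (\<phi> i x) \<le> ennreal r"
    by (rule not_properly_amenable_paradoxical[OF np]) (rule that)
  define V where "V i = translation_op X (X - Y) (\<phi> i)" for i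
  have pt: "partial_translation X d (X - Y) (\<phi> i ` (X - Y)) (\<phi> i)" if i: "i < 2" for i
  proof -
    have "(SUP x\<in>X - Y. d x (\<phi> i x)) \<le> ennreal r" using dist[OF i] by (intro SUP_least)
    also have "\<dots> < \<infinity>" by simp
    finally show ?thesis using inj[OF i] ran[OF i] by (auto simp: partial_translation_def bij_betw_def)
  qed
  have VA: "V i \<in> Alg" if "i < 2" for i unfolding V_def by (rule translation_op_Alg[OF pt[OF that]])
  have VB: "V i \<in> BH" "adj (V i) \<in> BH" if "i < 2" for i
    using Alg_bounded[OF VA[OF that]] ell2_adjoint_op(1) by auto
  have Vd: "V i (ell2_delta x) = (if x \<in> X - Y then ell2_delta (\<phi> i x) else 0)"
    if "i < 2" "x \<in> X" for i x unfolding V_def using translation_op_delta[OF pt[OF that(1)] that(2)] .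
  have Vf: "V i f = (\<lambda>y. if y \<in> \<phi> i ` (X - Y) then f (inv_into (X - Y) (\<phi> i) y) else 0)"
    if "f \<in> ell2 X" for i f unfolding V_def by (rule translation_op_apply[OF that])
  have Vphi: "V i f (\<phi> i x) = f x" if "i < 2" "f \<in> ell2 X" "x \<in> X - Y" for i f x
    using that inv_into_f_f[OF inj[OF that(1)] that(3)] by (simp add: Vf)
  have aV: "adj (V i) g x = (if x \<in> X - Y then g (\<phi> i x) else 0)"
    if "i < 2" "g \<in> ell2 X" "x \<in> X" for i g x
    using adj_apply[OF VB(1)[OF that(1)] that(2,3)] ran[OF that(1), of x] that
    by (simp add: Vd ell2_ip_delta)
  have comp: "(adj (V i) \<circ> V j) f x = (if x \<in> X - Y then V j f (\<phi> i x) else 0)"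
    if "i < 2" "j < 2" "f \<in> ell2 X" "x \<in> X" for i j f x
    using aV[OF that(1) ell2.bounded_opD(1)[OF VB(1)[OF that(2)] that(3)] that(4)] by simp
  define Z where "Z i = \<phi> i ` (X - Y)" for i
  show ?thesis
  proof (rule that[of Y V Z])
    show "adj (V i) \<circ> V i = chi X (X - Y)" if i: "i < 2" for i
      by (rule BH_eqI[OF ell2.bounded_op_comp[OF VB(2,1)[OF i]] chi_bounded])
        (use i in \<open>simp add: comp Vphi chi_apply del: comp_apply\<close>)
    show "V i \<circ> chi X (X - Y) = V i" if i: "i < 2" for i
    proof (rule BH_eqI[OF ell2.bounded_op_comp[OF VB(1)[OF i] chi_bounded] VB(1)[OF i]])
      fix f x assume f: "f \<in> ell2 X" and "x \<in> X"
      have m: "chi X (X - Y) f \<in> ell2 X" by (rule ell2.bounded_opD(1)[OF chi_bounded f])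
      have "inv_into (X - Y) (\<phi> i) x \<in> X - Y" if "x \<in> \<phi> i ` (X - Y)" using that by (rule inv_into_into)
      then show "(V i \<circ> chi X (X - Y)) f x = V i f x"
        unfolding comp_apply Vf[OF m] Vf[OF f] using f by (simp add: chi_apply)
    qed
    have no: "V j f (\<phi> i x) = 0" if "{i, j} = {0, 1::nat}" "f \<in> ell2 X" "x \<in> X - Y" for i j f x
    proof -
      have "\<phi> i x \<notin> \<phi> j ` (X - Y)"
        using that(1) disj that(3) by (auto simp: doubleton_eq_iff) (metis DiffI)+
      then show ?thesis using that(2) by (simp add: Vf)
    qed
    show "adj (V 0) \<circ> V 1 = 0"
      by (rule BH_eqI[OF ell2.bounded_op_comp[OF VB(2)[of 0] VB(1)[of 1]] ell2.bounded_op_zero])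
        (simp_all add: comp no del: comp_apply)
    show "adj (V 1) \<circ> V 0 = 0"
      by (rule BH_eqI[OF ell2.bounded_op_comp[OF VB(2)[of 1] VB(1)[of 0]] ell2.bounded_op_zero])
        (simp_all add: comp no insert_commute del: comp_apply)
    show "V i \<circ> adj (V i) = chi X (Z i)" if i: "i < 2" for i
    proof (rule BH_eqI[OF ell2.bounded_op_comp[OF VB[OF i]] chi_bounded])
      fix f x assume f: "f \<in> ell2 X" and x: "x \<in> X"
      have m: "adj (V i) f \<in> ell2 X" by (rule ell2.bounded_opD(1)[OF VB(2)[OF i] f])
      have iv: "inv_into (X - Y) (\<phi> i) x \<in> X - Y" "\<phi> i (inv_into (X - Y) (\<phi> i) x) = x" if "x \<in> Z i"
        using that inv_into_into f_inv_into_f unfolding Z_def by metis+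
      show "(V i \<circ> adj (V i)) f x = chi X (Z i) f x"
      proof (cases "x \<in> Z i")
        case True
        then show ?thesis
          using iv[OF True] aV[OF i f, of "inv_into (X - Y) (\<phi> i) x"] f
          by (simp add: Vf[OF m] chi_apply Z_def)
      next
        case False
        then show ?thesis using f by (simp add: Vf[OF m] chi_apply Z_def)
      qed
    qed
    show "Z 0 \<inter> Z 1 = {}" using disj by (auto simp: Z_def)
  qed (use Y VA ran in \<open>auto simp: Z_def\<close>)
qed

lemma comp_sum_scale:
  assumes a: "a \<in> BH" and f: "\<And>i. i \<in> A \<Longrightarrow> f i \<in> BH"
  shows "a \<circ> (\<Sum>i\<in>A. c i *\<^sub>C f i) = (\<Sum>i\<in>A. c i *\<^sub>C (a \<circ> f i))"
proof
  fix g
  show "(a \<circ> (\<Sum>i\<in>A. c i *\<^sub>C f i)) g = (\<Sum>i\<in>A. c i *\<^sub>C (a \<circ> f i)) g"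
  proof (cases "g \<in> ell2 X")
    case True
    have m: "f i g \<in> ell2 X" if "i \<in> A" for i using ell2.bounded_opD(1)[OF f[OF that] True] .
    have "a (\<Sum>i\<in>A. c i *\<^sub>C f i g) = (\<Sum>i\<in>A. a (c i *\<^sub>C f i g))"
      using m by (intro ell2.bounded_opD(7)[OF a]) blast
    also have "\<dots> = (\<Sum>i\<in>A. c i *\<^sub>C a (f i g))"
      using m by (intro sum.cong) (auto simp: ell2.bounded_opD(5)[OF a])
    finally show ?thesis by (simp add: sum_fun_apply[of _ A g])
  next
    case False
    have "f i g = 0" if "i \<in> A" for i using ell2.bounded_opD(2)[OF f[OF that] False] .
    then show ?thesis using ell2.bounded_opD(3)[OF a] by (simp add: sum_fun_apply[of _ A g])
  qed
qed

text \<open>The operator \<open>S i\<close> extracts the i-th half of a linear relation: it undoes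
  \<open>V i\<close> on \<open>b\<close> and kills the other family, leaving a relation within
  \<open>b\<close>.\<close>

lemma paradoxical_independent:
  assumes V: "\<And>i. i < 2 \<Longrightarrow> V i \<in> BH" and S: "\<And>i. i < 2 \<Longrightarrow> S i \<in> BH"
    and SV: "\<And>i. i < (2::nat) \<Longrightarrow> S i \<circ> V i = p" "S 0 \<circ> V 1 = 0" "S 1 \<circ> V 0 = 0"
    and b: "finite b" "cvs.independent b" "b \<subseteq> BH" "\<And>T. T \<in> b \<Longrightarrow> p \<circ> T = T"
  shows "cvs.independent ((\<lambda>T. V 0 \<circ> T) ` b \<union> (\<lambda>T. V 1 \<circ> T) ` b)"
    "card ((\<lambda>T. V 0 \<circ> T) ` b \<union> (\<lambda>T. V 1 \<circ> T) ` b) = 2 * card b"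
proof -
  have SVT: "S i \<circ> (V i \<circ> T) = T" if "i < 2" "T \<in> b" for i T
    using SV(1)[OF that(1)] b(4)[OF that(2)] by (simp add: comp_assoc[symmetric])
  have S0: "S 0 \<circ> (V 1 \<circ> T) = 0" "S 1 \<circ> (V 0 \<circ> T) = 0"
    for T :: "('a \<Rightarrow> complex) \<Rightarrow> 'a \<Rightarrow> complex"
    using SV(2,3) by (simp_all add: comp_assoc[symmetric]) (simp_all add: fun_eq_iff)
  have inj: "inj_on (\<lambda>T. V i \<circ> T) b" if "i < 2" for i
    using SVT[OF that] by (metis (no_types, lifting) inj_onI)
  have "0 \<notin> b" using b(2) cvs.dependent_zero by blast
  then have disj: "(\<lambda>T. V 0 \<circ> T) ` b \<inter> (\<lambda>T. V 1 \<circ> T) ` b = {}"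
  proof -
    have "V 0 \<circ> T \<noteq> V 1 \<circ> T'" if "T \<in> b" for T T'
      using SVT[of 0 T] S0(1)[of T'] that \<open>0 \<notin> b\<close> by auto
    then show ?thesis by blast
  qed
  show "card ((\<lambda>T. V 0 \<circ> T) ` b \<union> (\<lambda>T. V 1 \<circ> T) ` b) = 2 * card b"
    using card_Un_disjoint[OF _ _ disj] b(1) card_image[OF inj] by simp
  show "cvs.independent ((\<lambda>T. V 0 \<circ> T) ` b \<union> (\<lambda>T. V 1 \<circ> T) ` b)"
  proof
    have fin: "finite ((\<lambda>T. V 0 \<circ> T) ` b \<union> (\<lambda>T. V 1 \<circ> T) ` b)" using b(1) by simp
    assume "cvs.dependent ((\<lambda>T. V 0 \<circ> T) ` b \<union> (\<lambda>T. V 1 \<circ> T) ` b)"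
    then obtain u x where z: "(\<Sum>x\<in>(\<lambda>T. V 0 \<circ> T) ` b \<union> (\<lambda>T. V 1 \<circ> T) ` b. u x *\<^sub>C x) = 0"
      and x: "x \<in> (\<lambda>T. V 0 \<circ> T) ` b \<union> (\<lambda>T. V 1 \<circ> T) ` b" and ne: "u x \<noteq> 0"
      unfolding cvs.dependent_finite[OF fin] by blast
    let ?s = "\<lambda>i. \<Sum>T\<in>b. u (V i \<circ> T) *\<^sub>C (V i \<circ> T)"
    have sum0: "?s 0 + ?s 1 = 0"
      using z b(1) by (subst (asm) sum.union_disjoint[OF _ _ disj]) (simp_all add: sum.reindex inj)
    have VT: "V i \<circ> T \<in> BH" if "i < 2" "T \<in> b" for i T
      using ell2.bounded_op_comp V that b(3) by blast
    have Ss: "S i \<circ> ?s j = (\<Sum>T\<in>b. u (V j \<circ> T) *\<^sub>C (S i \<circ> (V j \<circ> T)))" if "i < 2" "j < 2" for i j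
      using S[OF that(1)] VT[OF that(2)] by (rule comp_sum_scale)
    have same: "S i \<circ> ?s i = (\<Sum>T\<in>b. u (V i \<circ> T) *\<^sub>C T)" if i: "i < 2" for i
      unfolding Ss[OF i i] using SVT[OF i] by simp
    have cross: "S 0 \<circ> ?s 1 = 0" "S 1 \<circ> ?s 0 = 0"
      using Ss[of 0 1] Ss[of 1 0] S0 by simp_all
    have sB: "?s i \<in> BH" if "i < 2" for i
      using VT[OF that] by (intro cvs.subspace_sum[OF ell2.bounded_op_subspace]
          cvs.subspace_scale[OF ell2.bounded_op_subspace])
    have add: "S i \<circ> (?s 0 + ?s 1) = (S i \<circ> ?s 0) + (S i \<circ> ?s 1)" if i: "i < 2" for i
    proof
      fix f
      show "(S i \<circ> (?s 0 + ?s 1)) f = ((S i \<circ> ?s 0) + (S i \<circ> ?s 1)) f"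
      proof (cases "f \<in> ell2 X")
        case True
        have "?s 0 f \<in> ell2 X" "?s 1 f \<in> ell2 X"
          using ell2.bounded_opD(1)[OF sB True] by auto
        then show ?thesis using ell2.bounded_opD(4)[OF S[OF i]] by simp
      next
        case False
        then show ?thesis
          using ell2.bounded_opD(2)[OF sB False] ell2.bounded_opD(3)[OF S[OF i]] by simp
      qed
    qed
    have Si0: "S i \<circ> (0 :: ('a \<Rightarrow> complex) \<Rightarrow> 'a \<Rightarrow> complex) = 0" if "i < 2" for i
      using ell2.bounded_opD(3)[OF S[OF that]] by (simp add: fun_eq_iff zero_fun_def)
    have zero: "(\<Sum>T\<in>b. u (V i \<circ> T) *\<^sub>C T) = 0" if "i = 0 \<or> i = 1" for i
      using that add[of i] sum0 Si0[of i] same[of i] cross by auto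
    have uz: "u (V i \<circ> T) = 0" if "T \<in> b" "i = 0 \<or> i = 1" for i T
      by (rule cvs.independentD[OF b(2,1) order_refl _ that(1), where u = "\<lambda>T. u (V i \<circ> T)"])
        (rule zero[OF that(2)])
    have uk: "u x = 0" if xi: "x \<in> (\<lambda>T. V i \<circ> T) ` b" and i: "i = 0 \<or> i = 1" for i x
    proof -
      from xi obtain T where T: "x = V i \<circ> T" "T \<in> b" by (rule imageE)
      show ?thesis unfolding T(1) by (rule uz[OF T(2) i])
    qed
    from x show False using uk[of x 0] uk[of x 1] ne by blast
  qed
qed

text \<open>With \<open>b\<close> a basis of pW, the 2|b| operators V i T lie in the sum of V 0 W +
  W and V 1 W + W. Both contain W, so 2|b| + dim W \<le> 2 (5/4) dim W. Since dim W \<le> |b| + M,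
  this gives dim W \<le> 4M.\<close>

theorem alg_imp_properly_amenable:
  assumes AA: "properly_alg_amenable (alg_uniform_roe X d)"
  shows "properly_amenable X d"
proof (rule ccontr)
  assume np: "\<not> properly_amenable X d"
  have mul: "mul (alg_uniform_roe X d) = (\<circ>)" by (simp add: alg_uniform_roe_def operator_algebra_def)
  have amen: "\<exists>W. cvs.subspace W \<and> W \<subseteq> Alg \<and> finite_dimensional W \<and> W \<noteq> {0} \<and> F \<subseteq> W \<and>
        (\<forall>a\<in>F. real (cvs.dim {(a \<circ> v) + w |v w. v \<in> W \<and> w \<in> W}) \<le> (1 + 1 / 4) * real (cvs.dim W))"
    if "finite F" "F \<subseteq> Alg" for F
    using AA[unfolded properly_alg_amenable_def mul, rule_format, of "1 / 4" F] that by simp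
  \<comment> \<open>Over the empty set the only operator is 0, which leaves no nonzero
    subspace.\<close>
  have "X \<noteq> {}"
  proof
    assume "X = {}"
    then have "T = 0" if "T \<in> BH" for T by (intro BH_eqI[OF that ell2.bounded_op_zero]) auto
    moreover obtain W where "cvs.subspace W" "W \<subseteq> Alg" "W \<noteq> {0}" using amen[of "{}"] by auto
    ultimately show False using Alg_bounded cvs.subspace_0 by blast
  qed
  then have inf: "infinite X" using np finite_imp_properly_amenable by blast
  obtain Y V Z where Y: "finite Y" "Y \<subseteq> X" "\<And>x y. x \<in> Y \<Longrightarrow> y \<in> X - Y \<Longrightarrow> d x y = \<infinity>"
    and VA: "\<And>i. i < (2::nat) \<Longrightarrow> V i \<in> Alg"
    and V: "\<And>i. i < 2 \<Longrightarrow> adj (V i) \<circ> V i = chi X (X - Y)" "\<And>i. i < 2 \<Longrightarrow> V i \<circ> chi X (X - Y) = V i"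
      "adj (V 0) \<circ> V 1 = 0" "adj (V 1) \<circ> V 0 = 0"
    using paradoxical_isometries[OF np] by metis
  let ?p = "chi X (X - Y)"
  let ?E = "(\<lambda>(x, y). matrix_unit X x y) ` (Y \<times> Y)"
  define M where "M = card (Y \<times> Y)"
  \<comment> \<open>4M + 1 independent diagonal units, forced into W, contradict dim W \<le>
    4M.\<close>
  obtain A where A: "finite A" "card A = Suc (4 * M)" "A \<subseteq> X"
    using infinite_arbitrarily_large[OF inf] by blast
  let ?D = "(\<lambda>x. matrix_unit X x x) ` A"
  have DA: "?D \<subseteq> Alg" using A(3) by (auto intro!: matrix_unit_Alg)
  obtain W where W: "cvs.subspace W" "W \<subseteq> Alg" "finite_dimensional W" "{V 0, V 1} \<union> ?D \<subseteq> W"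
    and dimW: "\<And>a. a \<in> {V 0, V 1} \<union> ?D \<Longrightarrow>
      real (cvs.dim {(a \<circ> v) + w |v w. v \<in> W \<and> w \<in> W}) \<le> (1 + 1 / 4) * real (cvs.dim W)"
  proof -
    have "finite ({V 0, V 1} \<union> ?D)" "{V 0, V 1} \<union> ?D \<subseteq> Alg" using A(1) DA VA by auto
    from amen[OF this] show ?thesis using that by (elim exE conjE) (rule that, auto)
  qed
  have "card A \<le> cvs.dim W"
  proof -
    have "x \<in> X" if "x \<in> A" for x using A(3) that by blast
    note mi = matrix_unit_independent[of A "\<lambda>x. x", OF this]
    show ?thesis using independent_card_le_dim(2)[OF W(3) _ mi(1)] W(4) mi(2) by simp
  qed
  then have big: "4 * M < cvs.dim W" using A(2) by simp
  obtain b where b: "b \<subseteq> (\<lambda>T. ?p \<circ> T) ` W" "cvs.independent b" "(\<lambda>T. ?p \<circ> T) ` W \<subseteq> cvs.span b"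
    by (rule cvs.maximal_independent_subset)
  obtain B where B: "finite B" "B \<subseteq> W" "W \<subseteq> cvs.span B" using finite_dimensional_basis[OF W(3)] by metis
  have WB: "W \<subseteq> BH" using W(2) Alg_bounded by blast
  have left: "a \<circ> T \<in> cvs.span ((\<lambda>T. a \<circ> T) ` B)" if "a \<in> BH" "T \<in> W" for a T
    by (rule left_comp_span[OF that(1)]) (use B WB that in auto)
  have "b \<subseteq> cvs.span ((\<lambda>T. ?p \<circ> T) ` B)" using b(1) left[OF chi_bounded] by blast
  then have finb: "finite b"
    using cvs.independent_span_bound[OF finite_imageI[OF B(1)] b(2)] by blast
  have bB: "b \<subseteq> BH" using b(1) ell2.bounded_op_comp[OF chi_bounded] WB by blast
  have pb: "?p \<circ> T = T" if T: "T \<in> b" for T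
  proof -
    obtain T' where "T = ?p \<circ> T'" using b(1) T by blast
    then show ?thesis by (simp add: comp_assoc[symmetric] chi_comp)
  qed
  have "W \<subseteq> cvs.span (b \<union> ?E)"
  proof
    fix T assume T: "T \<in> W"
    then have TA: "T \<in> Alg" "T \<in> BH" using W WB by auto
    have "?p \<circ> T \<in> cvs.span (b \<union> ?E)"
      using b(3) T cvs.span_mono[of b "b \<union> ?E"] by blast
    moreover have "chi X Y \<circ> T \<in> cvs.span (b \<union> ?E)"
    proof -
      have "chi X Y \<circ> T = (\<Sum>x\<in>Y. \<Sum>y\<in>Y. T (ell2_delta y) x *\<^sub>C matrix_unit X x y)"
        using Roe_entry_infinite[OF subsetD[OF Alg_subset_Roe TA(1)]] Y
        by (intro chi_comp_finite[OF TA(2) Y(1,2)]) auto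
      also have "\<dots> \<in> cvs.span (b \<union> ?E)"
        by (intro cvs.span_sum cvs.span_scale cvs.span_base) auto
      finally show ?thesis .
    qed
    \<comment> \<open>Splitting T by rows separates the paradoxical part from the finite matrices
      over \<open>Y\<close>.\<close>
    moreover have "T = (?p \<circ> T) + (chi X Y \<circ> T)"
    proof (rule BH_eqI[OF TA(2) ell2.bounded_op_add])
      show "?p \<circ> T \<in> BH" "chi X Y \<circ> T \<in> BH" using ell2.bounded_op_comp[OF chi_bounded TA(2)] by auto
      show "T f x = ((?p \<circ> T) + (chi X Y \<circ> T)) f x" if "f \<in> ell2 X" "x \<in> X" for f x
        using ell2.bounded_opD(1)[OF TA(2) that(1)] that by (simp add: chi_apply)
    qed
    ultimately show "T \<in> cvs.span (b \<union> ?E)" using cvs.span_add by metis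
  qed
  then have "cvs.dim W \<le> card (b \<union> ?E)"
    by (rule cvs.dim_le_card) (use finb Y(1) in simp)
  also have "\<dots> \<le> card b + M"
    using card_Un_le[of b ?E] card_image_le[of "Y \<times> Y" "\<lambda>(x, y). matrix_unit X x y"] Y(1)
    by (simp add: M_def)
  finally have dim_le: "cvs.dim W \<le> card b + M" .
  let ?W = "\<lambda>i. {(V i \<circ> v) + w |v w. v \<in> W \<and> w \<in> W}"
  let ?I = "(\<lambda>T. V 0 \<circ> T) ` b \<union> (\<lambda>T. V 1 \<circ> T) ` b"
  have VB: "V i \<in> BH" "adj (V i) \<in> BH" if "i < 2" for i
    using Alg_bounded[OF VA[OF that]] ell2_adjoint_op(1) by auto
  have indep: "cvs.independent ?I" "card ?I = 2 * card b"
    using paradoxical_independent[of V "\<lambda>i. adj (V i)" ?p b, OF VB V(1,3,4) finb b(2) bB pb] by blast+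
  have 0: "(0 :: ('a \<Rightarrow> complex) \<Rightarrow> 'a \<Rightarrow> complex) \<in> W" using W(1) cvs.subspace_0 by blast
  have V0: "V i \<circ> (0 :: ('a \<Rightarrow> complex) \<Rightarrow> 'a \<Rightarrow> complex) = 0" if "i < 2" for i
    using ell2.bounded_opD(3)[OF VB(1)[OF that]] by (simp add: fun_eq_iff zero_fun_def)
  have WW: "W \<subseteq> ?W i" if "i < 2" for i
  proof
    fix w assume "w \<in> W"
    then show "w \<in> ?W i" unfolding mem_Collect_eq using 0 V0[OF that]
      by (intro exI[of _ 0] exI[of _ w]) simp
  qed
  have VW: "V i \<circ> T \<in> ?W i" if "i < 2" "T \<in> W" for i T
    unfolding mem_Collect_eq using 0 that by (intro exI[of _ T] exI[of _ 0]) simp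
  have fdW: "finite_dimensional (?W i)" if i: "i < 2" for i
  proof -
    have "(V i \<circ> v) + w \<in> cvs.span (B \<union> (\<lambda>T. V i \<circ> T) ` B)" if "v \<in> W" "w \<in> W" for v w
    proof (rule cvs.span_add)
      show "V i \<circ> v \<in> cvs.span (B \<union> (\<lambda>T. V i \<circ> T) ` B)"
        using left[OF VB(1)[OF i] that(1)] cvs.span_mono[of "(\<lambda>T. V i \<circ> T) ` B" "B \<union> (\<lambda>T. V i \<circ> T) ` B"] by blast
      show "w \<in> cvs.span (B \<union> (\<lambda>T. V i \<circ> T) ` B)"
        using B(3) that(2) cvs.span_mono[of B "B \<union> (\<lambda>T. V i \<circ> T) ` B"] by blast
    qed
    then have "?W i \<subseteq> cvs.span (B \<union> (\<lambda>T. V i \<circ> T) ` B)" by blast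
    then show ?thesis unfolding finite_dimensional_def using B(1)
      by (intro exI[of _ "B \<union> (\<lambda>T. V i \<circ> T) ` B"]) simp
  qed
  have "?I \<subseteq> ?W 0 \<union> ?W 1"
  proof -
    have "V i \<circ> T \<in> ?W i" if i: "i < 2" and T: "T \<in> b" for i T
    proof -
      \<comment> \<open>An element of \<open>b\<close> need not lie in W itself, but
        \<open>V i\<close> absorbs the cut-off: V i p T' = V i T'.\<close>
      obtain T' where T': "T' \<in> W" "T = ?p \<circ> T'" using b(1) T by blast
      then have "V i \<circ> T = V i \<circ> T'" using V(2)[OF i] by (simp add: comp_assoc[symmetric])
      then show ?thesis using VW[OF i T'(1)] by simp
    qed
    from this[of 0] this[of 1] show ?thesis by (auto simp del: comp_apply)
  qed
  then have "?I \<subseteq> cvs.span (?W 0 \<union> ?W 1)" using cvs.span_superset[of "?W 0 \<union> ?W 1"] by (rule order_trans)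
  then have "card ?I + cvs.dim W \<le> cvs.dim (?W 0) + cvs.dim (?W 1)"
    by (intro independent_card_in_sum fdW WW indep(1)) simp_all
  moreover have "real (cvs.dim (?W 0)) \<le> (1 + 1 / 4) * real (cvs.dim W)" by (rule dimW) simp
  moreover have "real (cvs.dim (?W 1)) \<le> (1 + 1 / 4) * real (cvs.dim W)" by (rule dimW) simp
  ultimately show False using dim_le big indep(2) by simp
qed

section \<open>Paradoxical isometries against almost commuting projections\<close>

section \<open>Properly Foelner Roe algebras\<close>

lemma chi_self_adjoint: "adj (chi X S) = chi X S"
proof (rule ell2.adjoint_op_eq[OF chi_bounded _ chi_bounded])
  show "is_adj (chi X S) (chi X S)"
    unfolding is_adjoint_def ell2_ip_def by (intro ballI infsum_cong) (simp add: chi_apply)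
qed

lemma chi_disjoint_Un: "S \<inter> T = {} \<Longrightarrow> chi X (S \<union> T) = chi X S + chi X T"
  by (rule BH_eqI[OF chi_bounded ell2.bounded_op_add[OF chi_bounded chi_bounded]])
    (auto simp: chi_apply)

lemma chi_whole: "chi X X = id_op (ell2 X)"
  by (rule BH_eqI[OF chi_bounded ell2.id_op_bounded]) (simp add: chi_apply id_op_def)

lemma uniform_roe_simps:
  "mul (uniform_roe X d) = (\<circ>)" "star (uniform_roe X d) = adj" "unit (uniform_roe X d) = id_op (ell2 X)"
  by (simp_all add: uniform_roe_def operator_algebra_def)

text \<open>With tolerance 1/2 the rank bound reads (1 - 2/4) rank P \<le> M, so the rank is at most
  2M, while injectivity on the span of 2M + 1 diagonal units makes it at least 2M + 1.\<close>

theorem foelner_imp_properly_amenable: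
  assumes PF: "properly_foelner (uniform_roe X d)"
  shows "properly_amenable X d"
proof (rule ccontr)
  assume np: "\<not> properly_amenable X d"
  obtain Y V Z where Y: "finite Y" "Y \<subseteq> X" "\<And>x y. x \<in> Y \<Longrightarrow> y \<in> X - Y \<Longrightarrow> d x y = \<infinity>"
    and VA: "\<And>i. i < (2::nat) \<Longrightarrow> V i \<in> Alg"
    and V: "\<And>i. i < 2 \<Longrightarrow> adj (V i) \<circ> V i = chi X (X - Y)" "\<And>i. i < 2 \<Longrightarrow> V i \<circ> adj (V i) = chi X (Z i)"
    and Z: "\<And>i. i < 2 \<Longrightarrow> Z i \<subseteq> X - Y" "Z 0 \<inter> Z 1 = {}"
    by (rule paradoxical_isometries[OF np]) (rule that)
  define M where "M = card (Y \<times> Y)"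
  obtain A where A: "finite A" "A \<subseteq> X" "X \<noteq> {} \<Longrightarrow> card A = Suc (2 * M)"
  proof (cases "X = {}")
    case False
    then have "infinite X" using np finite_imp_properly_amenable by blast
    then obtain A where "finite A" "card A = Suc (2 * M)" "A \<subseteq> X" using infinite_arbitrarily_large by blast
    then show ?thesis using that by blast
  qed (use that[of "{}"] in simp)
  let ?D = "(\<lambda>x. matrix_unit X x x) ` A"
  let ?F = "{V 0, V 1} \<union> ?D"
  have A': "x \<in> X" if "x \<in> A" for x using A(2) that by blast
  have D_Alg: "?D \<subseteq> Alg" using A' by (auto intro!: matrix_unit_Alg)
  have "finite ?F \<and> ?F \<subseteq> Roe \<and> (1 / 2 :: real) > 0" using A(1) D_Alg VA Alg_subset_Roe by auto
  from PF[unfolded properly_foelner_def, rule_format, OF this]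
  obtain H :: "((('a \<Rightarrow> complex) \<Rightarrow> 'a \<Rightarrow> complex) \<Rightarrow> complex) set" and ip \<pi> \<Omega> P
    where data: "proper_foelner_data (uniform_roe X d) ?F (1 / 2) H ip \<pi> \<Omega> P"
    by (elim exE)
  have rep: "unital_star_rep (uniform_roe X d) H ip \<pi>" and cyc: "cyclic_vector (uniform_roe X d) H ip \<pi> \<Omega>"
    and P: "finite_rank_projection H ip P" "P \<noteq> 0"
    and hs: "\<And>T. T \<in> ?F \<Longrightarrow> hs_norm H ip ((\<pi> T \<circ> P) - (P \<circ> \<pi> T)) \<le> 1 / 2 * hs_norm H ip P"
    and inj: "inj_on (\<lambda>a. P (\<pi> a \<Omega>)) (cvs.span ?F)"
    using data unfolding proper_foelner_data_def by (blast+)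
  interpret hs: complex_hilbert_space H ip using rep by (simp add: unital_star_rep_def)
  have \<Omega>: "\<Omega> \<in> H" using cyc by (simp add: cyclic_vector_def)
  have \<pi>b: "\<pi> a \<in> bounded_operators H ip" if "a \<in> Roe" for a
    using rep that by (simp add: unital_star_rep_def)
  have \<pi>add: "\<pi> (a + b) = \<pi> a + \<pi> b" if "a \<in> Roe" "b \<in> Roe" for a b
    using rep that by (simp add: unital_star_rep_def)
  have \<pi>scale: "\<pi> (c *\<^sub>C a) = c *\<^sub>C \<pi> a" if "a \<in> Roe" for c a
    using rep that by (simp add: unital_star_rep_def)
  have \<pi>mul: "\<pi> (a \<circ> b) = \<pi> a \<circ> \<pi> b" if "a \<in> Roe" "b \<in> Roe" for a b
    using rep that by (simp add: unital_star_rep_def uniform_roe_simps)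
  have \<pi>adj: "is_adjoint H ip (\<pi> a) (\<pi> (adj a))" if "a \<in> Roe" for a
    using rep that by (simp add: unital_star_rep_def uniform_roe_simps)
  have \<pi>id: "\<pi> (id_op (ell2 X)) = id_op H"
    using rep by (simp add: unital_star_rep_def uniform_roe_simps)
  have chiR: "chi X S \<in> Roe" for S using chi_Alg Alg_subset_Roe by blast
  have VR: "V i \<in> Roe" "adj (V i) \<in> Roe" if "i < 2" for i
    using VA[OF that] Alg_adj Alg_subset_Roe by blast+
  \<comment> \<open>For fixed x in \<open>H\<close> this is a nonnegative, finitely additive
    function of S with value ||x||^2 at \<open>X\<close>. It carries the comparison of source and
    range projections over to the representation.\<close>
  define N where "N S x = (vnorm ip (\<pi> (chi X S) x))\<^sup>2" for S x
  have N_eq: "N S x = Re (ip (\<pi> (chi X S) x) x)" if x: "x \<in> H" for S x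
  proof -
    have rx: "\<pi> (chi X S) x \<in> H" by (rule hs.bounded_opD(1)[OF \<pi>b[OF chiR] x])
    have "\<pi> (chi X S) (\<pi> (chi X S) x) = \<pi> (chi X S) x"
      using fun_cong[OF \<pi>mul[OF chiR chiR, of S S], of x] by (simp add: chi_comp)
    moreover have "ip (\<pi> (chi X S) (\<pi> (chi X S) x)) x = ip (\<pi> (chi X S) x) (\<pi> (chi X S) x)"
      using \<pi>adj[OF chiR, of S] x rx by (simp add: chi_self_adjoint is_adjoint_def)
    ultimately show ?thesis using rx by (simp add: N_def hs.vnorm_sq)
  qed
  have N_Un: "N (S \<union> T) x = N S x + N T x" if "x \<in> H" "S \<inter> T = {}" for S T x
    using that hs.bounded_opD(1)[OF \<pi>b[OF chiR] that(1)]
    by (simp add: N_eq chi_disjoint_Un \<pi>add chiR hs.ip_add_left)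
  have N_nonneg: "N S x \<ge> 0" for S x by (simp add: N_def)
  have N_X: "N X x = (vnorm ip x)\<^sup>2" if "x \<in> H" for x
    unfolding N_def chi_whole \<pi>id using that by (simp add: id_op_def)
  obtain B where B: "hs.orthonormal B" "finite B" "\<And>x. x \<in> H \<Longrightarrow> P x = hs.proj B x"
    using hs.finite_rank_projection_basis[OF P(1)] by metis
  have split: "(vnorm ip x)\<^sup>2 = N (X - Y) x + N Y x" if x: "x \<in> H" for x
  proof -
    have "(X - Y) \<union> Y = X" "(X - Y) \<inter> Y = {}" using Y(2) by blast+
    then show ?thesis using N_Un[OF x, of "X - Y" Y] N_X[OF x] by (simp only:)
  qed
  have iso: "(vnorm ip (\<pi> (V i) x))\<^sup>2 = N (X - Y) x" if i: "i < 2" and x: "x \<in> H" for i x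
  proof -
    have Vx: "\<pi> (V i) x \<in> H" by (rule hs.bounded_opD(1)[OF \<pi>b[OF VR(1)[OF i]] x])
    have px: "\<pi> (chi X (X - Y)) x \<in> H" by (rule hs.bounded_opD(1)[OF \<pi>b[OF chiR] x])
    have "\<pi> (adj (V i)) (\<pi> (V i) x) = \<pi> (chi X (X - Y)) x"
      using fun_cong[OF \<pi>mul[OF VR(2,1)[OF i]], of x] V(1)[OF i] by simp
    then have "ip (\<pi> (V i) x) (\<pi> (V i) x) = ip x (\<pi> (chi X (X - Y)) x)"
      using \<pi>adj[OF VR(1)[OF i]] x Vx by (simp add: is_adjoint_def)
    then show ?thesis using Vx x px hs.ip_commute[OF x px] by (simp add: hs.vnorm_sq N_eq)
  qed
  have iso': "(vnorm ip (\<pi> (adj (V i)) x))\<^sup>2 = N (Z i) x" if i: "i < 2" and x: "x \<in> H" for i x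
  proof -
    have Sx: "\<pi> (adj (V i)) x \<in> H" by (rule hs.bounded_opD(1)[OF \<pi>b[OF VR(2)[OF i]] x])
    have "\<pi> (V i) (\<pi> (adj (V i)) x) = \<pi> (chi X (Z i)) x"
      using fun_cong[OF \<pi>mul[OF VR(1,2)[OF i]], of x] V(2)[OF i] by simp
    moreover have "ip (\<pi> (V i) (\<pi> (adj (V i)) x)) x = ip (\<pi> (adj (V i)) x) (\<pi> (adj (V i)) x)"
      using \<pi>adj[OF VR(1)[OF i]] x Sx unfolding is_adjoint_def by blast
    ultimately have "ip (\<pi> (adj (V i)) x) (\<pi> (adj (V i)) x) = ip (\<pi> (chi X (Z i)) x) x"
      by simp
    then show ?thesis using Sx x by (simp add: hs.vnorm_sq N_eq)
  qed
  have orth: "N (Z 0) x + N (Z 1) x \<le> N (X - Y) x" if x: "x \<in> H" for x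
  proof -
    let ?R = "X - Y - (Z 0 \<union> Z 1)"
    have "Z 0 \<union> Z 1 \<union> ?R = X - Y" "(Z 0 \<union> Z 1) \<inter> ?R = {}"
      using Z(1)[of 0] Z(1)[of 1] by auto
    then have "N (X - Y) x = N (Z 0) x + N (Z 1) x + N ?R x"
      using N_Un[OF x Z(2)] N_Un[OF x, of "Z 0 \<union> Z 1" ?R] by (simp only:)
    then show ?thesis using N_nonneg[of ?R x] by simp
  qed
  \<comment> \<open>A matrix unit between points at infinite distance is outside the Roe algebra,
    where nothing is known about \<pi>. It is replaced by 0, and the corresponding coefficient
    vanishes anyway.\<close>
  define m where "m x y = (if d x y < \<infinity> then matrix_unit X x y else 0)" for x y
  have mR: "m x y \<in> Roe" if "x \<in> Y" "y \<in> Y" for x y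
    unfolding m_def using matrix_unit_Alg[of x y] that Y(2) Alg_subset_Roe cvs.subspace_0[OF Roe_subspace] by auto
  \<comment> \<open>Cyclicity enters here: vectors \<pi>(a) \<Omega> are dense, and cutting them to
    \<open>Y\<close> lands in the span of at most |Y|^2 vectors. So the range of \<pi>(chi X Y) is
    bounded in dimension although the representation is arbitrary.\<close>
  define K where "K = (\<lambda>z. \<pi> (m (fst z) (snd z)) \<Omega>) ` (Y \<times> Y)"
  have q_range: "\<pi> (chi X Y) (\<pi> a \<Omega>) \<in> cvs.span K" if a: "a \<in> Roe" for a
  proof -
    have ent: "a (ell2_delta y) x = 0" if "x \<in> Y" "y \<in> X" "d x y = \<infinity>" for x y
      using Roe_entry_infinite[OF a] that Y(2) by blast
    have "chi X Y \<circ> a = (\<Sum>x\<in>Y. \<Sum>y\<in>Y. a (ell2_delta y) x *\<^sub>C matrix_unit X x y)"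
      using ent Y by (intro chi_comp_finite[OF Roe_bounded[OF a] Y(1,2)]) auto
    also have "\<dots> = (\<Sum>x\<in>Y. \<Sum>y\<in>Y. a (ell2_delta y) x *\<^sub>C m x y)"
    proof (intro sum.cong refl)
      fix x y assume xy: "x \<in> Y" "y \<in> Y"
      have "a (ell2_delta y) x = 0" if "\<not> d x y < \<infinity>"
        using ent[of x y] xy Y(2) that by (auto simp flip: less_top)
      then show "a (ell2_delta y) x *\<^sub>C matrix_unit X x y = a (ell2_delta y) x *\<^sub>C m x y"
        unfolding m_def by auto
    qed
    also have "\<dots> = (\<Sum>z\<in>Y \<times> Y. a (ell2_delta (snd z)) (fst z) *\<^sub>C m (fst z) (snd z))"
      by (simp add: sum.cartesian_product case_prod_beta)
    finally have eq: "chi X Y \<circ> a = (\<Sum>z\<in>Y \<times> Y. a (ell2_delta (snd z)) (fst z) *\<^sub>C m (fst z) (snd z))" .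
    have "\<pi> (chi X Y \<circ> a) =
        (\<Sum>z\<in>Y \<times> Y. a (ell2_delta (snd z)) (fst z) *\<^sub>C \<pi> (m (fst z) (snd z)))"
      unfolding eq by (rule linear_on_sum[where U = \<pi>, OF Roe_subspace])
        (use \<pi>add \<pi>scale mR in auto)
    then have "\<pi> (chi X Y) (\<pi> a \<Omega>) =
        (\<Sum>z\<in>Y \<times> Y. a (ell2_delta (snd z)) (fst z) *\<^sub>C \<pi> (m (fst z) (snd z)) \<Omega>)"
      using fun_cong[OF \<pi>mul[OF chiR a, of Y], of \<Omega>] by (simp add: sum_fun_apply[of _ _ \<Omega>])
    also have "\<dots> \<in> cvs.span K"
      by (intro cvs.span_sum cvs.span_scale cvs.span_base) (simp add: K_def)
    finally show ?thesis .
  qed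
  let ?q = "\<pi> (chi X Y)"
  have qH: "?q x \<in> H" if "x \<in> H" for x by (rule hs.bounded_opD(1)[OF \<pi>b[OF chiR] that])
  have q_le: "vnorm ip (?q x) \<le> vnorm ip x" if x: "x \<in> H" for x
  proof (rule power2_le_imp_le)
    show "(vnorm ip (?q x))\<^sup>2 \<le> (vnorm ip x)\<^sup>2"
      using split[OF x] N_nonneg[of "X - Y" x] by (simp add: N_def)
  qed (use x in simp)
  have KH: "finite K" "K \<subseteq> H"
    using Y(1) mR hs.bounded_opD(1)[OF \<pi>b \<Omega>] by (auto simp: K_def)
  have "(\<Sum>e\<in>B. (vnorm ip (?q e))\<^sup>2) \<le> card K"
  proof (rule hs.sum_vnorm_projection_le_card[OF B(1,2) KH qH _ q_le])
    show "is_adjoint H ip ?q ?q" using \<pi>adj[OF chiR, of Y] by (simp add: chi_self_adjoint)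
    show "\<exists>k\<in>cvs.span K. vnorm ip (?q x - k) < \<delta>" if x: "x \<in> H" and \<delta>: "\<delta> > 0" for x \<delta>
    proof -
      obtain a where a: "a \<in> Roe" "vnorm ip (x - \<pi> a \<Omega>) < \<delta>"
        using cyc x \<delta> unfolding cyclic_vector_def by blast
      have aH: "\<pi> a \<Omega> \<in> H" by (rule hs.bounded_opD(1)[OF \<pi>b[OF a(1)] \<Omega>])
      have "?q x - ?q (\<pi> a \<Omega>) = ?q (x - \<pi> a \<Omega>)"
        by (rule hs.bounded_opD(6)[OF \<pi>b[OF chiR] x aH, symmetric])
      then have "vnorm ip (?q x - ?q (\<pi> a \<Omega>)) < \<delta>"
        using q_le[of "x - \<pi> a \<Omega>"] x aH a(2) by simp
      then show ?thesis using q_range[OF a(1)] by blast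
    qed
  qed
  also have "card K \<le> M" unfolding K_def M_def using Y(1) by (intro card_image_le) simp
  finally have qM: "(\<Sum>e\<in>B. (vnorm ip (?q e))\<^sup>2) \<le> M" by simp
  have "(1 - 2 * (1 / 2)\<^sup>2) * card B \<le> real M"
  proof (rule hs.projection_rank_bound[OF B, where V = "\<lambda>i. \<pi> (V i)" and S = "\<lambda>i. \<pi> (adj (V i))"
        and p = "\<pi> (chi X (X - Y))" and q = ?q])
    show "\<pi> (V i) \<in> bounded_operators H ip" "\<pi> (adj (V i)) \<in> bounded_operators H ip"
      "is_adjoint H ip (\<pi> (V i)) (\<pi> (adj (V i)))" if "i < 2" for i
      using \<pi>b VR[OF that] \<pi>adj by auto
    show "vnorm ip (\<pi> (V i) x) = vnorm ip (\<pi> (chi X (X - Y)) x)" if "i < 2" "x \<in> H" for i x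
      using iso[OF that] hs.bounded_opD(1)[OF \<pi>b that(2)] VR[OF that(1)] chiR
      by (simp add: N_def power2_eq_iff_nonneg)
    show "(vnorm ip (\<pi> (adj (V 0)) x))\<^sup>2 + (vnorm ip (\<pi> (adj (V 1)) x))\<^sup>2
        \<le> (vnorm ip (\<pi> (chi X (X - Y)) x))\<^sup>2" if "x \<in> H" for x
      using orth[OF that] iso'[of 0 x] iso'[of 1 x] that by (simp add: N_def)
    show "(vnorm ip x)\<^sup>2 = (vnorm ip (\<pi> (chi X (X - Y)) x))\<^sup>2 + (vnorm ip (?q x))\<^sup>2" if "x \<in> H" for x
      using split[OF that] by (simp add: N_def)
    show "hs_norm H ip ((\<pi> (V i) \<circ> P) - (P \<circ> \<pi> (V i))) \<le> 1 / 2 * hs_norm H ip P" if "i < 2" for i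
    proof (rule hs)
      show "V i \<in> ?F" using that by (auto simp: less_2_cases_iff)
    qed
  qed (use qM in auto)
  then have cB: "card B \<le> 2 * M" by (simp add: power2_eq_square)
  have PH: "P x \<in> cvs.span B" if "x \<in> H" for x using B(3)[OF that] hs.proj_in_span by simp
  \<comment> \<open>For empty \<open>X\<close> the unit of the algebra is 0, hence \<open>H\<close>
    is trivial and P = 0. Otherwise the diagonal units are counted.\<close>
  show False
  proof (cases "X = {}")
    case True
    have "id_op (ell2 X) = 0"
      by (rule BH_eqI[OF ell2.id_op_bounded ell2.bounded_op_zero]) (use True in simp)
    moreover have "\<pi> 0 = 0" using \<pi>scale[OF cvs.subspace_0[OF Roe_subspace], of 0] by simp
    ultimately have "id_op H = 0" using \<pi>id by simp
    then have H0: "x = 0" if "x \<in> H" for x using that fun_cong[of "id_op H" 0 x]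
      by (metis id_op_def zero_fun_def)
    have Pb: "P \<in> bounded_operators H ip" using P(1) by (simp add: finite_rank_projection_def)
    have "P x = 0" for x using H0[of "P x"] hs.bounded_opD(1,2)[OF Pb, of x] by blast
    then show False using P(2) by (auto simp: fun_eq_iff)
  next
    case False
    have Pb: "P \<in> bounded_operators H ip" using P(1) by (simp add: finite_rank_projection_def)
    have \<pi>H: "\<pi> a \<Omega> \<in> H" if "a \<in> Roe" for a by (rule hs.bounded_opD(1)[OF \<pi>b[OF that] \<Omega>])
    have DR: "?D \<subseteq> Roe" using D_Alg Alg_subset_Roe by blast
    note mi = matrix_unit_independent[of A "\<lambda>x. x", OF A']
    have injD: "inj_on (\<lambda>a. P (\<pi> a \<Omega>)) (cvs.span ?D)"
      by (rule inj_on_subset[OF inj cvs.span_mono]) blast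
    have Uadd: "P (\<pi> (a + b) \<Omega>) = P (\<pi> a \<Omega>) + P (\<pi> b \<Omega>)" if "a \<in> Roe" "b \<in> Roe" for a b
      using hs.bounded_opD(4)[OF Pb \<pi>H[OF that(1)] \<pi>H[OF that(2)]] \<pi>add[OF that] by simp
    have Usc: "P (\<pi> (c *\<^sub>C a) \<Omega>) = c *\<^sub>C P (\<pi> a \<Omega>)" if "a \<in> Roe" for c a
      using hs.bounded_opD(5)[OF Pb \<pi>H[OF that]] \<pi>scale[OF that] by simp
    have "cvs.independent ((\<lambda>a. P (\<pi> a \<Omega>)) ` ?D)"
    proof (rule independent_image_on[where U = "\<lambda>a. P (\<pi> a \<Omega>)" and H = Roe])
      show "cvs.subspace Roe" by (rule Roe_subspace)
      show "finite ?D" using A(1) by simp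
    qed (rule Uadd Usc DR mi(1) injD; assumption)+
    moreover have "card ((\<lambda>a. P (\<pi> a \<Omega>)) ` ?D) = card ?D"
      using card_image[OF inj_on_subset[OF injD cvs.span_superset[of ?D]]] .
    moreover have "(\<lambda>a. P (\<pi> a \<Omega>)) ` ?D \<subseteq> cvs.span B" 
      using PH[OF \<pi>H[OF subsetD[OF DR]]] by (intro image_subsetI)
    ultimately have "card ?D \<le> card B" using cvs.independent_span_bound[OF B(2)] by (metis (no_types))
    then show False using cB mi(2) A(3)[OF False] by simp
  qed
qed

section \<open>The cyclic representation over finitely many base points\<close>

text \<open>
  For a finite set \<open>Y\<close> of base points, the Roe algebra acts on \<open>\<ell>\<^sup>2\<close> of the disjoint union of the
  components of the points of \<open>Y\<close>, and the sum of the base points is cyclic.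
\<close>

definition fibre :: "'a set \<Rightarrow> ('a \<times> 'a) set" where
  "fibre Y = {(x, y). x \<in> X \<and> y \<in> Y \<and> d x y < \<infinity>}"

definition slice :: "('a \<times> 'a \<Rightarrow> complex) \<Rightarrow> 'a \<Rightarrow> 'a \<Rightarrow> complex" where
  "slice f y = (\<lambda>x. f (x, y))"

text \<open>T acts on each slice separately. Every base point has its own slice, even when several
  lie in one component, so the columns of T at different base points are stored
  independently.\<close>

definition amp :: "'a set \<Rightarrow> (('a \<Rightarrow> complex) \<Rightarrow> 'a \<Rightarrow> complex) \<Rightarrow> ('a \<times> 'a \<Rightarrow> complex) \<Rightarrow> 'a \<times> 'a \<Rightarrow> complex" where
  "amp Y T f = (if f \<in> ell2 (fibre Y)
    then (\<lambda>(x, y). if (x, y) \<in> fibre Y then T (slice f y) x else 0) else 0)"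

definition base_vector :: "'a set \<Rightarrow> 'a \<times> 'a \<Rightarrow> complex" where
  "base_vector Y = (\<lambda>(x, y). if x = y \<and> y \<in> Y then 1 else 0)"

text \<open>\<open>defect S a z\<close> is \<open>\<parallel>(1 - P) \<pi>(a) \<delta>\<^sub>z\<parallel>\<^sup>2\<close> for the projection \<open>P\<close> onto \<open>\<ell>\<^sup>2(S)\<close>.\<close>

definition defect :: "('a \<times> 'a) set \<Rightarrow> (('a \<Rightarrow> complex) \<Rightarrow> 'a \<Rightarrow> complex) \<Rightarrow> 'a \<times> 'a \<Rightarrow> real" where
  "defect S a z = (norm2 (\<lambda>x. if (x, snd z) \<in> S then 0 else a (ell2_delta (fst z)) x))\<^sup>2"

lemma slice_ell2:
  assumes f: "f \<in> ell2 (fibre Y)"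
  shows "slice f y \<in> ell2 X"
proof (rule ell2I_bounded(1))
  show "slice f y x = 0" if "x \<notin> X" for x
    using f that by (simp add: slice_def ell2_def fibre_def)
  fix F assume F: "finite F" "F \<subseteq> X"
  have "(\<Sum>x\<in>F. (cmod (slice f y x))\<^sup>2) = (\<Sum>z\<in>F \<times> {y}. (cmod (f z))\<^sup>2)"
    by (simp add: sum.cartesian_product' slice_def)
  also have "\<dots> = (\<Sum>z\<in>(F \<times> {y}) \<inter> fibre Y. (cmod (f z))\<^sup>2)"
    using F f by (intro sum.mono_neutral_right) (auto simp: ell2_def)
  also have "\<dots> \<le> (vnorm (ell2_ip (fibre Y)) f)\<^sup>2"
    using F by (intro ell2_finite_sum_le f) auto
  finally show "(\<Sum>x\<in>F. (cmod (slice f y x))\<^sup>2) \<le> (vnorm (ell2_ip (fibre Y)) f)\<^sup>2" .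
qed

lemma fibre_ell2I:
  assumes Y: "finite Y" and f: "\<And>z. z \<notin> fibre Y \<Longrightarrow> f z = 0" and s: "\<And>y. y \<in> Y \<Longrightarrow> slice f y \<in> ell2 X"
  shows "f \<in> ell2 (fibre Y)"
proof (rule ell2I_bounded(1), erule f)
  fix F assume F: "finite F" "F \<subseteq> fibre Y"
  have "(\<Sum>z\<in>F. (cmod (f z))\<^sup>2) \<le> (\<Sum>z\<in>fst ` F \<times> Y. (cmod (f z))\<^sup>2)"
    using F Y by (intro sum_mono2) (force simp: fibre_def)+
  also have "\<dots> = (\<Sum>y\<in>Y. \<Sum>x\<in>fst ` F. (cmod (slice f y x))\<^sup>2)"
    unfolding slice_def by (subst sum.swap) (simp add: sum.cartesian_product')
  also have "\<dots> \<le> (\<Sum>y\<in>Y. (norm2 (slice f y))\<^sup>2)"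
    using F by (intro sum_mono ell2_finite_sum_le s) (auto simp: fibre_def)
  finally show "(\<Sum>z\<in>F. (cmod (f z))\<^sup>2) \<le> (\<Sum>y\<in>Y. (norm2 (slice f y))\<^sup>2)" .
qed

lemma fibre_ip:
  assumes Y: "finite Y" and f: "f \<in> ell2 (fibre Y)" and g: "g \<in> ell2 (fibre Y)"
  shows "ell2_ip (fibre Y) f g = (\<Sum>y\<in>Y. ell2_ip X (slice f y) (slice g y))"
proof -
  let ?h = "\<lambda>z. f z * cnj (g z)"
  have "(?h has_sum ell2_ip X (slice f y) (slice g y)) ((\<lambda>x. (x, y)) ` X)" for y
  proof -
    have "((\<lambda>x. slice f y x * cnj (slice g y x)) has_sum ell2_ip X (slice f y) (slice g y)) X"
      unfolding ell2_ip_def by (intro has_sum_infsum ell2_ip_summable slice_ell2[OF f] slice_ell2[OF g])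
    then show ?thesis by (subst has_sum_reindex) (auto simp: inj_on_def o_def slice_def)
  qed
  then have "(?h has_sum (\<Sum>y\<in>Y. ell2_ip X (slice f y) (slice g y))) (\<Union>y\<in>Y. (\<lambda>x. (x, y)) ` X)"
    using Y by (intro sum_has_sum) auto
  also have "?this \<longleftrightarrow> (?h has_sum (\<Sum>y\<in>Y. ell2_ip X (slice f y) (slice g y))) (fibre Y)"
    using f by (intro has_sum_cong_neutral) (auto simp: fibre_def ell2_def)
  finally show ?thesis by (simp add: ell2_ip_def infsumI)
qed

lemma fibre_norm:
  assumes "finite Y" "f \<in> ell2 (fibre Y)"
  shows "(vnorm (ell2_ip (fibre Y)) f)\<^sup>2 = (\<Sum>y\<in>Y. (norm2 (slice f y))\<^sup>2)"
  using fibre_ip[OF assms(1,2,2)] by (simp add: ell2.vnorm_sq assms(2) slice_ell2[OF assms(2)])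

lemma fibre_eqI:
  assumes "f \<in> ell2 (fibre Y)" "g \<in> ell2 (fibre Y)" "\<And>y. y \<in> Y \<Longrightarrow> slice f y = slice g y"
  shows "f = g"
proof
  fix z show "f z = g z"
  proof (cases "z \<in> fibre Y")
    case True
    then have "snd z \<in> Y" by (auto simp: fibre_def)
    from fun_cong[OF assms(3)[OF this], of "fst z"] show ?thesis by (simp add: slice_def)
  next
    case False
    then show ?thesis using assms(1,2) by (cases z) (simp add: ell2_def)
  qed
qed

lemma slice_linear: "slice (f + g) y = slice f y + slice g y" "slice (c *\<^sub>C f) y = c *\<^sub>C slice f y"
  "slice (f - g) y = slice f y - slice g y"
  by (auto simp: slice_def fun_eq_iff)

lemma slice_zero: "f \<in> ell2 (fibre Y) \<Longrightarrow> (x, y) \<notin> fibre Y \<Longrightarrow> slice f y x = 0"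
  by (simp add: slice_def ell2_def)

text \<open>The truncation to the fibre in \<open>amp\<close> changes nothing: an element of the Roe
  algebra cannot move a function out of its component.\<close>

lemma slice_amp:
  assumes Y: "Y \<subseteq> X" and T: "T \<in> Roe" and f: "f \<in> ell2 (fibre Y)" and y: "y \<in> Y"
  shows "slice (amp Y T f) y = T (slice f y)"
proof
  fix x
  have yX: "y \<in> X" using y Y by blast
  have m: "T (slice f y) \<in> ell2 X" by (rule ell2.bounded_opD(1)[OF Roe_bounded[OF T] slice_ell2[OF f]])
  show "slice (amp Y T f) y x = T (slice f y) x"
  proof (cases "(x, y) \<in> fibre Y")
    case True
    then show ?thesis using f by (simp add: slice_def amp_def)
  next
    case no: False
    have "T (slice f y) x = 0"
    proof (cases "x \<in> X")
      case x: True
      show ?thesis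
      proof (rule Roe_component[OF T slice_ell2[OF f] x])
        fix x' assume x': "x' \<in> X" "slice f y x' \<noteq> 0"
        then have "(x', y) \<in> fibre Y" using slice_zero[OF f] by blast
        then have "d x' y < \<infinity>" by (simp add: fibre_def)
        moreover have "\<not> d x y < \<infinity>" using no x y by (simp add: fibre_def)
        ultimately have "\<not> d x x' < \<infinity>" using finite_distance_trans[OF x x'(1) yX] by blast
        then show "d x x' = \<infinity>" by (simp flip: less_top)
      qed
    qed (use m in \<open>simp add: ell2_def\<close>)
    then show ?thesis using no f by (simp add: slice_def amp_def)
  qed
qed

lemma amp_ell2:
  assumes Y: "finite Y" "Y \<subseteq> X" and T: "T \<in> Roe" and f: "f \<in> ell2 (fibre Y)"
  shows "amp Y T f \<in> ell2 (fibre Y)"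
proof (rule fibre_ell2I[OF Y(1)])
  show "amp Y T f z = 0" if "z \<notin> fibre Y" for z
    using that f by (cases z) (simp add: amp_def)
  show "slice (amp Y T f) y \<in> ell2 X" if "y \<in> Y" for y
    unfolding slice_amp[OF Y(2) T f that] by (rule ell2.bounded_opD(1)[OF Roe_bounded[OF T] slice_ell2[OF f]])
qed

lemma amp_bounded:
  assumes Y: "finite Y" "Y \<subseteq> X" and T: "T \<in> Roe"
  shows "amp Y T \<in> bounded_operators (ell2 (fibre Y)) (ell2_ip (fibre Y))"
proof -
  note TB = Roe_bounded[OF T]
  obtain K where K: "K > 0" "\<And>f. f \<in> ell2 X \<Longrightarrow> norm2 (T f) \<le> K * norm2 f"
    using ell2.bounded_op_bound[OF TB] by metis
  note sl = slice_amp[OF Y(2) T]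
  note me = amp_ell2[OF Y T]
  show ?thesis
  proof (rule ell2.bounded_operatorsI[where K = K])
    show "amp Y T (f + g) = amp Y T f + amp Y T g" if f: "f \<in> ell2 (fibre Y)" and g: "g \<in> ell2 (fibre Y)" for f g
    proof (rule fibre_eqI)
      show "slice (amp Y T (f + g)) y = slice (amp Y T f + amp Y T g) y" if "y \<in> Y" for y
        unfolding slice_linear sl[OF f that] sl[OF g that] sl[OF ell2.mem_H(2)[OF f g] that]
        by (rule ell2.bounded_opD(4)[OF TB slice_ell2[OF f] slice_ell2[OF g]])
    qed (use me f g ell2.mem_H(2) in auto)
    show "amp Y T (c *\<^sub>C f) = c *\<^sub>C amp Y T f" if f: "f \<in> ell2 (fibre Y)" for f c
    proof (rule fibre_eqI)
      show "slice (amp Y T (c *\<^sub>C f)) y = slice (c *\<^sub>C amp Y T f) y" if "y \<in> Y" for y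
        unfolding slice_linear sl[OF f that] sl[OF ell2.mem_H(4)[OF f] that]
        by (rule ell2.bounded_opD(5)[OF TB slice_ell2[OF f]])
    qed (use me f ell2.mem_H(4) in auto)
    show "vnorm (ell2_ip (fibre Y)) (amp Y T f) \<le> K * vnorm (ell2_ip (fibre Y)) f"
      if f: "f \<in> ell2 (fibre Y)" for f
    proof (rule power2_le_imp_le)
      have "(vnorm (ell2_ip (fibre Y)) (amp Y T f))\<^sup>2 = (\<Sum>y\<in>Y. (norm2 (T (slice f y)))\<^sup>2)"
        unfolding fibre_norm[OF Y(1) me[OF f]] by (intro sum.cong refl) (simp add: sl[OF f])
      also have "\<dots> \<le> (\<Sum>y\<in>Y. (K * norm2 (slice f y))\<^sup>2)"
        using K(2)[OF slice_ell2[OF f]] ell2.vnorm_ge_0[OF ell2.bounded_opD(1)[OF TB slice_ell2[OF f]]]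
        by (intro sum_mono power_mono) auto
      also have "\<dots> = (K * vnorm (ell2_ip (fibre Y)) f)\<^sup>2"
        unfolding power_mult_distrib fibre_norm[OF Y(1) f] sum_distrib_left ..
      finally show "(vnorm (ell2_ip (fibre Y)) (amp Y T f))\<^sup>2 \<le> (K * vnorm (ell2_ip (fibre Y)) f)\<^sup>2" .
    qed (use K(1) f in simp)
  qed (use me in \<open>auto simp: amp_def\<close>)
qed

lemma amp_adjoint:
  assumes Y: "finite Y" "Y \<subseteq> X" and T: "T \<in> Roe"
  shows "is_adjoint (ell2 (fibre Y)) (ell2_ip (fibre Y)) (amp Y T) (amp Y (adj T))"
  unfolding is_adjoint_def
proof (intro ballI)
  fix f g assume f: "f \<in> ell2 (fibre Y)" and g: "g \<in> ell2 (fibre Y)"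
  have "ell2_ip (fibre Y) (amp Y T f) g = (\<Sum>y\<in>Y. ell2_ip X (T (slice f y)) (slice g y))"
    unfolding fibre_ip[OF Y(1) amp_ell2[OF Y T f] g]
    by (intro sum.cong refl) (simp add: slice_amp[OF Y(2) T f])
  also have "\<dots> = (\<Sum>y\<in>Y. ell2_ip X (slice f y) (adj T (slice g y)))"
    using ell2_adjoint_op(2)[OF Roe_bounded[OF T]] slice_ell2[OF f] slice_ell2[OF g]
    unfolding is_adjoint_def by (intro sum.cong refl) blast
  also have "\<dots> = ell2_ip (fibre Y) f (amp Y (adj T) g)"
    unfolding fibre_ip[OF Y(1) f amp_ell2[OF Y Roe_adj[OF T] g]]
    by (intro sum.cong refl) (simp add: slice_amp[OF Y(2) Roe_adj[OF T] g])
  finally show "ell2_ip (fibre Y) (amp Y T f) g = ell2_ip (fibre Y) f (amp Y (adj T) g)" .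
qed

lemma amp_rep:
  assumes Y: "finite Y" "Y \<subseteq> X"
  shows "unital_star_rep (uniform_roe X d) (ell2 (fibre Y)) (ell2_ip (fibre Y)) (amp Y)"
  unfolding unital_star_rep_def uniform_roe_simps
proof (intro conjI ballI allI ell2_hilbert amp_bounded[OF Y] amp_adjoint[OF Y])
  fix T S assume T: "T \<in> Roe" and S: "S \<in> Roe"
  show "amp Y (T + S) = amp Y T + amp Y S" by (auto simp: amp_def fun_eq_iff)
  show "amp Y (T \<circ> S) = amp Y T \<circ> amp Y S"
  proof
    fix f show "amp Y (T \<circ> S) f = (amp Y T \<circ> amp Y S) f"
    proof (cases "f \<in> ell2 (fibre Y)")
      case f: True
      show ?thesis
      proof
        fix z show "amp Y (T \<circ> S) f z = (amp Y T \<circ> amp Y S) f z"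
          using f amp_ell2[OF Y S f] slice_amp[OF Y(2) S f, of "snd z"]
          by (cases z) (simp add: amp_def[of Y T] amp_def[of Y "T \<circ> S"] fibre_def)
      qed
    next
      case False
      then show ?thesis
        using ell2.bounded_opD(2)[OF amp_bounded[OF Y S] False] ell2.bounded_opD(3)[OF amp_bounded[OF Y T]]
        by (simp add: amp_def[of Y "T \<circ> S"])
    qed
  qed
next
  fix c and T assume "T \<in> Roe"
  show "amp Y (c *\<^sub>C T) = c *\<^sub>C amp Y T" by (auto simp: amp_def fun_eq_iff)
next
  show "amp Y (id_op (ell2 X)) = id_op (ell2 (fibre Y))"
  proof
    fix f show "amp Y (id_op (ell2 X)) f = id_op (ell2 (fibre Y)) f"
    proof (cases "f \<in> ell2 (fibre Y)")
      case f: True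
      then show ?thesis using slice_ell2[OF f] by (auto simp: amp_def id_op_def slice_def ell2_def fun_eq_iff)
    qed (simp add: amp_def id_op_def)
  qed
qed

lemma base_vector_ell2:
  assumes "finite Y" "Y \<subseteq> X"
  shows "base_vector Y \<in> ell2 (fibre Y)"
proof (rule ell2_finite_support(1)[of "(\<lambda>y. (y, y)) ` Y"])
  show "(\<lambda>y. (y, y)) ` Y \<subseteq> fibre Y" using assms(2) by (auto simp: fibre_def)
qed (use assms in \<open>auto simp: base_vector_def\<close>)

lemma slice_base_vector: "y \<in> Y \<Longrightarrow> slice (base_vector Y) y = ell2_delta y"
  by (auto simp: slice_def base_vector_def ell2_delta_def fun_eq_iff)

text \<open>The matrix unit at (x, y) sends the base vector to the delta at (x, y), since it kills
  the deltas at all other base points. Hence every finitely supported vector is reached exactly, and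
  these are dense.\<close>

lemma base_vector_cyclic:
  assumes Y: "finite Y" "Y \<subseteq> X"
  shows "cyclic_vector (uniform_roe X d) (ell2 (fibre Y)) (ell2_ip (fibre Y)) (amp Y) (base_vector Y)"
  unfolding cyclic_vector_def
proof (intro conjI ballI allI impI base_vector_ell2[OF Y])
  fix f and \<delta> :: real assume f: "f \<in> ell2 (fibre Y)" and "\<delta> > 0"
  then obtain F where F: "finite F" "F \<subseteq> fibre Y"
    "vnorm (ell2_ip (fibre Y)) (f - (\<lambda>z. if z \<in> F then f z else 0)) < \<delta>"
    using ell2_finite_approx by blast
  define a where "a = (\<Sum>z\<in>F. f z *\<^sub>C matrix_unit X (fst z) (snd z))"
  have "matrix_unit X (fst z) (snd z) \<in> Roe" if "z \<in> F" for z
  proof -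
    have "z \<in> fibre Y" using F(2) that by blast
    then have "fst z \<in> X" "snd z \<in> X" "d (fst z) (snd z) < \<infinity>" using Y(2) by (auto simp: fibre_def)
    then show ?thesis using matrix_unit_Alg Alg_subset_Roe by blast
  qed
  then have a: "a \<in> Roe"
    unfolding a_def by (intro cvs.subspace_sum[OF Roe_subspace] cvs.subspace_scale[OF Roe_subspace])
  let ?g = "\<lambda>z. if z \<in> F then f z else 0"
  have "amp Y a (base_vector Y) = ?g"
  proof (rule fibre_eqI)
    show "amp Y a (base_vector Y) \<in> ell2 (fibre Y)" by (rule amp_ell2[OF Y a base_vector_ell2[OF Y]])
    show "?g \<in> ell2 (fibre Y)" by (rule ell2_finite_support(1)[OF F(1,2)]) simp
    fix y assume y: "y \<in> Y"
    have yX: "y \<in> X" using y Y by blast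
    have "a (ell2_delta y) x = slice ?g y x" for x
    proof -
      have "a (ell2_delta y) x = (\<Sum>z\<in>F. f z * matrix_unit X (fst z) (snd z) (ell2_delta y) x)"
        by (simp add: a_def sum_fun_apply[of _ _ "ell2_delta y"] sum_fun_apply[of _ _ x] scaleC_complex_def)
      also have "\<dots> = (\<Sum>z\<in>F. if z = (x, y) then f z else 0)"
        by (intro sum.cong refl) (auto simp: matrix_unit_delta[OF yX])
      finally show ?thesis using F(1) by (simp add: slice_def)
    qed
    then show "slice (amp Y a (base_vector Y)) y = slice ?g y"
      unfolding slice_amp[OF Y(2) a base_vector_ell2[OF Y] y] slice_base_vector[OF y] by (rule ext)
  qed
  then show "\<exists>a\<in>Roe. vnorm (ell2_ip (fibre Y)) (f - amp Y a (base_vector Y)) < \<delta>"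
    using a F(3) by (intro bexI[of _ a]) simp_all
qed

lemma amp_defect:
  assumes Y: "finite Y" "Y \<subseteq> X" and S: "finite S" "S \<subseteq> fibre Y" and a: "a \<in> Roe" and z: "z \<in> S"
  shows "(vnorm (ell2_ip (fibre Y)) (amp Y a (ell2_delta z)
      - ell2.proj (fibre Y) (ell2_delta ` S) (amp Y a (ell2_delta z))))\<^sup>2 = defect S a z"
proof -
  obtain x y where zxy: "z = (x, y)" by force
  have xy: "x \<in> X" "y \<in> Y" using S z zxy by (auto simp: fibre_def)
  let ?e = "ell2_delta z :: 'a \<times> 'a \<Rightarrow> complex"
  have e: "?e \<in> ell2 (fibre Y)" using S z by blast
  note m = amp_ell2[OF Y a e]
  let ?h = "amp Y a ?e - ell2.proj (fibre Y) (ell2_delta ` S) (amp Y a ?e)"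
  have h: "?h \<in> ell2 (fibre Y)"
    by (rule ell2.mem_H(3)[OF m ell2.proj_in_H[OF ell2_orthonormal[OF S(2)]]])
  have se: "slice ?e y' = (if y' = y then ell2_delta x else 0)" for y'
    by (auto simp: slice_def ell2_delta_def zxy fun_eq_iff)
  have sh: "slice ?h y' = (if y' = y then (\<lambda>x'. if (x', y) \<in> S then 0 else a (ell2_delta x) x') else 0)"
    if y': "y' \<in> Y" for y'
  proof
    fix x'
    have "slice ?h y' x' = (if (x', y') \<in> S then 0 else slice (amp Y a ?e) y' x')"
      by (simp add: ell2_proj[OF S] slice_def)
    then show "slice ?h y' x' = (if y' = y then (\<lambda>x'. if (x', y) \<in> S then 0 else a (ell2_delta x) x') else 0) x'"
      unfolding slice_amp[OF Y(2) a e y'] se using ell2.bounded_opD(3)[OF Roe_bounded[OF a]] by auto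
  qed
  have "(vnorm (ell2_ip (fibre Y)) ?h)\<^sup>2 = (\<Sum>y'\<in>Y. if y' = y then defect S a z else 0)"
    unfolding fibre_norm[OF Y(1) h]
  proof (intro sum.cong refl)
    fix y' assume y': "y' \<in> Y"
    show "(norm2 (slice ?h y'))\<^sup>2 = (if y' = y then defect S a z else 0)"
      unfolding sh[OF y'] unfolding defect_def zxy fst_conv snd_conv by simp
  qed
  then show ?thesis using Y(1) xy by simp
qed

text \<open>The (x, y)-coordinate of \<pi>(a) \<Omega> is the entry of a at row x and column y.
  Injectivity after projecting to the points of \<open>S\<close> therefore says that the entries
  indexed by \<open>S\<close> separate the span.\<close>

lemma fibre_foelner_data:
  fixes \<epsilon> :: real
  assumes Y: "finite Y" "Y \<subseteq> X" and S: "finite S" "S \<subseteq> fibre Y" "S \<noteq> {}"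
    and \<F>: "\<F> \<subseteq> Roe" and \<epsilon>: "\<epsilon> > 0"
    and small: "\<And>a. a \<in> \<F> \<Longrightarrow> (\<Sum>z\<in>S. defect S a z) + (\<Sum>z\<in>S. defect S (adj a) z) \<le> \<epsilon>\<^sup>2 * card S"
    and sep: "\<And>a. a \<in> cvs.span \<F> \<Longrightarrow> (\<And>x y. (x, y) \<in> S \<Longrightarrow> a (ell2_delta y) x = 0) \<Longrightarrow> a = 0"
  shows "proper_foelner_data (uniform_roe X d) \<F> \<epsilon> (ell2 (fibre Y)) (ell2_ip (fibre Y)) (amp Y)
    (base_vector Y) (chi (fibre Y) S)"
  unfolding proper_foelner_data_def
proof (intro conjI ballI amp_rep[OF Y] base_vector_cyclic[OF Y] chi_finite_rank_projection(1)[OF S(1,2)])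
  let ?P = "chi (fibre Y) S"
  note on = ell2_orthonormal[OF S(2)] finite_imageI[OF S(1), of ell2_delta]
  note P = chi_finite_rank_projection(2)[OF S(1,2)]
  have injd: "inj_on ell2_delta S" by (simp add: inj_on_def ell2_delta_inj)
  obtain z where z: "z \<in> S" using S(3) by blast
  have zz: "ell2_delta z \<in> ell2 (fibre Y)" using z S(2) by blast
  show "?P \<noteq> 0"
  proof
    assume "?P = 0"
    then have "?P (ell2_delta z) z = 0" by simp
    then show False using chi_apply[OF zz, of S] z by (simp add: ell2_delta_apply)
  qed
  fix a assume a: "a \<in> \<F>"
  then have aR: "a \<in> Roe" using \<F> by blast
  have "hs_norm (ell2 (fibre Y)) (ell2_ip (fibre Y)) ((amp Y a \<circ> ?P) - (?P \<circ> amp Y a)) =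
      sqrt ((\<Sum>z\<in>S. defect S a z) + (\<Sum>z\<in>S. defect S (adj a) z))"
    by (subst ell2.hs_norm_commutator[OF on P amp_bounded[OF Y aR] amp_bounded[OF Y Roe_adj[OF aR]] amp_adjoint[OF Y aR]])
      (simp_all add: sum.reindex[OF injd] amp_defect[OF Y S(1,2) aR] amp_defect[OF Y S(1,2) Roe_adj[OF aR]])
  also have "\<dots> \<le> sqrt (\<epsilon>\<^sup>2 * card S)" using small[OF a] by simp
  also have "\<dots> = \<epsilon> * sqrt (card (ell2_delta ` S :: ('a \<times> 'a \<Rightarrow> complex) set))"
    using \<epsilon> by (simp add: real_sqrt_mult card_image[OF injd])
  also have "sqrt (card (ell2_delta ` S :: ('a \<times> 'a \<Rightarrow> complex) set)) = hs_norm (ell2 (fibre Y)) (ell2_ip (fibre Y)) ?P"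
    by (rule ell2.hs_norm_projection[OF on P, symmetric])
  finally show "hs_norm (ell2 (fibre Y)) (ell2_ip (fibre Y)) ((amp Y a \<circ> ?P) - (?P \<circ> amp Y a))
      \<le> \<epsilon> * hs_norm (ell2 (fibre Y)) (ell2_ip (fibre Y)) ?P" .
next
  let ?P = "chi (fibre Y) S"
  show "inj_on (\<lambda>a. ?P (amp Y a (base_vector Y))) (cvs.span \<F>)"
  proof (rule inj_onI)
    fix a b assume ab: "a \<in> cvs.span \<F>" "b \<in> cvs.span \<F>"
      and eq: "?P (amp Y a (base_vector Y)) = ?P (amp Y b (base_vector Y))"
    have R: "a \<in> Roe" "b \<in> Roe" using ab cvs.span_minimal[OF \<F> Roe_subspace] by auto
    have val: "?P (amp Y c (base_vector Y)) (x, y) = c (ell2_delta y) x" if c: "c \<in> Roe" and xy: "(x, y) \<in> S" for c x y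
    proof -
      have y: "y \<in> Y" using xy S(2) by (auto simp: fibre_def)
      have "?P (amp Y c (base_vector Y)) (x, y) = slice (amp Y c (base_vector Y)) y x"
        using xy by (simp add: chi_apply[OF amp_ell2[OF Y c base_vector_ell2[OF Y]]] slice_def)
      then show ?thesis
        by (simp add: slice_amp[OF Y(2) c base_vector_ell2[OF Y] y] slice_base_vector[OF y])
    qed
    have "a - b = 0"
    proof (rule sep)
      show "a - b \<in> cvs.span \<F>" using ab by (rule cvs.span_diff)
      show "(a - b) (ell2_delta y) x = 0" if "(x, y) \<in> S" for x y
        using val[OF R(1) that] val[OF R(2) that] eq by simp
    qed
    then show "a = b" by simp
  qed
qed

text \<open>The representation lives on functions on pairs, not on the universe prescribed by
  \<open>properly_foelner\<close>; \<open>properly_foelner_universe\<close> transports it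
  there.\<close>

lemma properly_foelnerI:
  assumes "\<And>\<F> (\<epsilon>::real). finite \<F> \<Longrightarrow> \<F> \<subseteq> Roe \<Longrightarrow> \<epsilon> > 0 \<Longrightarrow> \<exists>Y S. finite Y \<and> Y \<subseteq> X \<and> finite S \<and> S \<subseteq> fibre Y \<and> S \<noteq> {} \<and>
      (\<forall>a\<in>\<F>. (\<Sum>z\<in>S. defect S a z) + (\<Sum>z\<in>S. defect S (adj a) z) \<le> \<epsilon>\<^sup>2 * card S) \<and>
      (\<forall>a\<in>cvs.span \<F>. (\<forall>x y. (x, y) \<in> S \<longrightarrow> a (ell2_delta y) x = 0) \<longrightarrow> a = 0)"
  shows "properly_foelner (uniform_roe X d)"
  unfolding properly_foelner_def
proof (intro allI impI)
  fix \<F> and \<epsilon> :: real assume "finite \<F> \<and> \<F> \<subseteq> Roe \<and> \<epsilon> > 0"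
  then have \<F>: "finite \<F>" "\<F> \<subseteq> Roe" and \<epsilon>: "\<epsilon> > 0" by auto
  obtain Y S where Y: "finite Y" "Y \<subseteq> X" and S: "finite S" "S \<subseteq> fibre Y" "S \<noteq> {}"
    and small: "\<forall>a\<in>\<F>. (\<Sum>z\<in>S. defect S a z) + (\<Sum>z\<in>S. defect S (adj a) z) \<le> \<epsilon>\<^sup>2 * card S"
    and sep: "\<forall>a\<in>cvs.span \<F>. (\<forall>x y. (x, y) \<in> S \<longrightarrow> a (ell2_delta y) x = 0) \<longrightarrow> a = 0"
    using assms[OF \<F> \<epsilon>] by (elim exE conjE)
  have data: "proper_foelner_data (uniform_roe X d) \<F> \<epsilon> (ell2 (fibre Y)) (ell2_ip (fibre Y)) (amp Y)
      (base_vector Y) (chi (fibre Y) S)"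
    by (rule fibre_foelner_data[OF Y S \<F>(2) \<epsilon>]) (use small sep in simp_all)
  show "\<exists>(H :: ((('a \<Rightarrow> complex) \<Rightarrow> 'a \<Rightarrow> complex) \<Rightarrow> complex) set) ip \<pi> \<Omega> P.
      proper_foelner_data (uniform_roe X d) \<F> \<epsilon> H ip \<pi> \<Omega> P"
    by (rule properly_foelner_universe[OF data Roe_subspace _ \<F>(2)])
      (simp add: uniform_roe_simps Roe_adj)
qed

section \<open>Foelner sets as finite rank projections\<close>

lemma defect_bounds:
  fixes \<eta> :: real
  assumes \<F>: "finite \<F>" "\<F> \<subseteq> Roe" and \<eta>: "\<eta> > 0"
  obtains R K L :: real where "R > 0" "K \<ge> 0" "L \<ge> 0"
    "\<And>a x. a \<in> \<F> \<Longrightarrow> x \<in> X \<Longrightarrow> (norm2 (a (ell2_delta x)))\<^sup>2 \<le> L"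
    "\<And>a F. a \<in> \<F> \<Longrightarrow> finite F \<Longrightarrow> F \<subseteq> X \<Longrightarrow>
      (\<Sum>x\<in>F. (norm2 (\<lambda>x'. if x' \<in> F then 0 else a (ell2_delta x) x'))\<^sup>2)
        \<le> K * card (R_boundary X d R F) + \<eta> * card F"
proof -
  let ?cut = "\<lambda>F a x x'. if x' \<in> F then 0 else a (ell2_delta x) x'"
  let ?Q = "\<lambda>a R (K :: real) (L :: real). (\<forall>x\<in>X. (norm2 (a (ell2_delta x)))\<^sup>2 \<le> L) \<and> (\<forall>F. finite F \<and> F \<subseteq> X \<longrightarrow>
      (\<Sum>x\<in>F. (norm2 (?cut F a x))\<^sup>2) \<le> K * card (R_boundary X d R F) + \<eta> * card F)"
  have single: "\<exists>R>0. \<exists>K\<ge>0. \<exists>L\<ge>0. ?Q a R K L" if a: "a \<in> Roe" for a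
  proof -
    \<comment> \<open>The bound ||u + v||^2 \<le> 2||u||^2 + 2||v||^2 is applied to the band
      approximant s and the remainder a - s. With 2 e^2 = \<eta> the remainder costs at most \<eta>
      per point, while s leaks out of \<open>F\<close> only at boundary points.\<close>
    define e where "e = sqrt (\<eta> / 2)"
    have e: "e > 0" "2 * e\<^sup>2 = \<eta>" using \<eta> by (simp_all add: e_def)
    obtain s where s: "s \<in> Alg" "a - s \<in> BH" "\<And>f. f \<in> ell2 X \<Longrightarrow> norm2 ((a - s) f) \<le> e * norm2 f"
      using Roe_approx[OF a e(1)] by metis
    note aB = Roe_bounded[OF a] and sB = Alg_bounded[OF s(1)]
    obtain R where R: "R > 0" "\<And>x y. x \<in> X \<Longrightarrow> y \<in> X \<Longrightarrow> s (ell2_delta y) x \<noteq> 0 \<Longrightarrow> d x y \<le> ennreal R"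
      using band_opsE[OF subsetD[OF Alg_subset_band s(1)]] by metis
    have col: "\<exists>k\<ge>0. \<forall>x\<in>X. (norm2 (T (ell2_delta x)))\<^sup>2 \<le> k" if T: "T \<in> BH" for T
    proof -
      obtain k where k: "k > 0" "\<And>f. f \<in> ell2 X \<Longrightarrow> norm2 (T f) \<le> k * norm2 f"
        using ell2.bounded_op_bound[OF T] by metis
      have "(norm2 (T (ell2_delta x)))\<^sup>2 \<le> k\<^sup>2" if x: "x \<in> X" for x
        using k(2)[OF ell2_delta_in[OF x]] ell2.vnorm_ge_0[OF ell2.bounded_opD(1)[OF T ell2_delta_in[OF x]]]
        by (intro power_mono) (simp_all add: ell2_delta_norm[OF x])
      then show ?thesis by (intro exI[of _ "k\<^sup>2"]) simp
    qed
    obtain k where k: "k \<ge> 0" "\<And>x. x \<in> X \<Longrightarrow> (norm2 (s (ell2_delta x)))\<^sup>2 \<le> k" using col[OF sB] by metis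
    obtain L where L: "L \<ge> 0" "\<And>x. x \<in> X \<Longrightarrow> (norm2 (a (ell2_delta x)))\<^sup>2 \<le> L" using col[OF aB] by metis
    have bnd: "(\<Sum>x\<in>F. (norm2 (?cut F a x))\<^sup>2) \<le> (2 * k) * card (R_boundary X d R F) + \<eta> * card F"
      if F: "finite F" "F \<subseteq> X" for F
    proof -
      let ?b = "R_boundary X d R F"
      have pt: "(norm2 (?cut F a x))\<^sup>2 \<le> (if x \<in> ?b then 2 * k else 0) + \<eta>" if x: "x \<in> F" for x
      proof -
        have xX: "x \<in> X" using x F by blast
        have sH: "s (ell2_delta x) \<in> ell2 X" by (rule ell2.bounded_opD(1)[OF sB ell2_delta_in[OF xX]])
        have rH: "(a - s) (ell2_delta x) \<in> ell2 X" by (rule ell2.bounded_opD(1)[OF s(2) ell2_delta_in[OF xX]])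
        have zs: "x' \<notin> X \<Longrightarrow> ?cut F s x x' = 0" for x' using sH by (simp add: ell2_def)
        have zr: "x' \<notin> X \<Longrightarrow> ?cut F (a - s) x x' = 0" for x' using rH by (simp add: ell2_def)
        have cs: "?cut F s x \<in> ell2 X" "(norm2 (?cut F s x))\<^sup>2 \<le> (norm2 (s (ell2_delta x)))\<^sup>2"
          by (rule ell2_mono[OF sH], erule zs, simp)+
        have cr: "?cut F (a - s) x \<in> ell2 X" "(norm2 (?cut F (a - s) x))\<^sup>2 \<le> (norm2 ((a - s) (ell2_delta x)))\<^sup>2"
          by (rule ell2_mono[OF rH], erule zr, simp)+
        have "?cut F a x = ?cut F s x + ?cut F (a - s) x" by (auto simp: fun_eq_iff)
        then have "(norm2 (?cut F a x))\<^sup>2 \<le> 2 * (norm2 (?cut F s x))\<^sup>2 + 2 * (norm2 (?cut F (a - s) x))\<^sup>2"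
          using ell2.vnorm_add_sq_le[OF cs(1) cr(1)] by (simp only:)
        moreover have "(norm2 (?cut F (a - s) x))\<^sup>2 \<le> e\<^sup>2"
        proof -
          have "(norm2 ((a - s) (ell2_delta x)))\<^sup>2 \<le> e\<^sup>2"
            using s(3)[OF ell2_delta_in[OF xX]] ell2.vnorm_ge_0[OF rH]
            by (intro power_mono) (simp_all add: ell2_delta_norm[OF xX])
          then show ?thesis using cr(2) by linarith
        qed
        moreover have "(norm2 (?cut F s x))\<^sup>2 \<le> (if x \<in> ?b then k else 0)"
        proof (cases "x \<in> ?b")
          case True
          then show ?thesis using cs(2) k(2)[OF xX] by simp
        next
          case False
          have "?cut F s x x' = 0" for x'
          proof (rule ccontr)
            assume nz: "?cut F s x x' \<noteq> 0"
            then have x': "x' \<in> X" "x' \<notin> F" "s (ell2_delta x) x' \<noteq> 0"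
              using zs[of x'] by (auto split: if_splits)
            then have "d x x' \<le> ennreal R" using R(2)[OF x'(1) xX] sym[OF xX x'(1)] by simp
            moreover have "d x x \<le> ennreal R" using xX by simp
            ultimately have "x \<in> ?b" unfolding R_boundary_iff[OF F(2) R(1)] using xX x x' by blast
            then show False using False by blast
          qed
          then have "?cut F s x = 0" by (simp add: fun_eq_iff)
          then show ?thesis using False by simp
        qed
        ultimately show ?thesis using e(2) by (cases "x \<in> ?b") auto
      qed
      have "(\<Sum>x\<in>F. (norm2 (?cut F a x))\<^sup>2) \<le> (\<Sum>x\<in>F. (if x \<in> ?b then 2 * k else 0) + \<eta>)"
        by (rule sum_mono) (rule pt)
      also have "\<dots> = 2 * k * card (F \<inter> ?b) + \<eta> * card F"
        using F(1) by (simp add: sum.distrib sum.inter_restrict[symmetric])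
      also have "\<dots> \<le> 2 * k * card ?b + \<eta> * card F"
        using k(1) finite_R_boundary[OF F R(1)]
        by (intro add_right_mono mult_left_mono) (simp_all add: card_mono)
      finally show ?thesis .
    qed
    show ?thesis
      by (intro exI[of _ R] exI[of _ "2 * k"] exI[of _ L] conjI allI impI ballI)
        (use R(1) k(1) L bnd in simp_all)
  qed
  have "\<exists>R>0. \<exists>K\<ge>0. \<exists>L\<ge>0. \<forall>a\<in>\<F>. ?Q a R K L"
    using \<F>
  proof (induction \<F> rule: finite_induct)
    case empty
    then show ?case by (intro exI[of _ 1]) auto
  next
    case (insert b \<F>)
    then obtain R K L where 1: "R > 0" "K \<ge> 0" "L \<ge> 0" "\<And>a. a \<in> \<F> \<Longrightarrow> ?Q a R K L" by auto
    obtain R' K' L' where 2: "R' > 0" "K' \<ge> 0" "L' \<ge> 0" "?Q b R' K' L'"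
      using single[of b] insert.prems by auto
    \<comment> \<open>Passing to maxima makes the constants common to all operators: the boundary
      grows with the scale, and nonnegativity makes the product monotone.\<close>
    have mono: "?Q a (max R R') (max K K') (max L L')"
      if q: "?Q a r k l" and le: "0 < r" "r \<le> max R R'" "0 \<le> k" "k \<le> max K K'" "l \<le> max L L'" for a r k l
    proof (intro conjI ballI allI impI)
      show "(norm2 (a (ell2_delta x)))\<^sup>2 \<le> max L L'" if "x \<in> X" for x
        using q le(5) that by (meson order_trans)
      fix F assume F: "finite F \<and> F \<subseteq> X"
      have "card (R_boundary X d r F) \<le> card (R_boundary X d (max R R') F)"
        using F finite_R_boundary[of F "max R R'"] R_boundary_mono[of F r "max R R'"] le(1,2) 1(1)
        by (intro card_mono) auto
      then have "k * card (R_boundary X d r F) \<le> max K K' * card (R_boundary X d (max R R') F)"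
        using le(3,4) by (intro mult_mono) auto
      then show "(\<Sum>x\<in>F. (norm2 (?cut F a x))\<^sup>2)
          \<le> max K K' * card (R_boundary X d (max R R') F) + \<eta> * card F"
        using conjunct2[OF q, rule_format, OF F] by linarith
    qed
    have "?Q a (max R R') (max K K') (max L L')" if "a \<in> insert b \<F>" for a
    proof (cases "a = b")
      case True
      show ?thesis unfolding True by (rule mono[OF 2(4)]) (use 2 in auto)
    next
      case False
      then have "a \<in> \<F>" using that by blast
      then show ?thesis by (rule mono[OF 1(4)]) (use 1 in auto)
    qed
    then show ?case using 1 2
      by (intro exI[of _ "max R R'"] exI[of _ "max K K'"] exI[of _ "max L L'"] conjI ballI) simp_all
  qed
  then obtain R K L where Q: "R > 0" "K \<ge> 0" "L \<ge> 0" "\<forall>a\<in>\<F>. ?Q a R K L" by (elim exE conjE)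
  show ?thesis
    by (rule that[OF Q(1-3)]) (use Q(4) in simp_all)
qed

text \<open>\<open>S\<close> consists of the pairs (x, c x) over a Foelner set \<open>F\<close> and
  at most |J| separating pairs. The sums for a and its adjoint are each at most 2 \<eta> |F| + |J|
  L; \<eta> = \<epsilon>^2/8 and |J| L \<le> (\<epsilon>^2/4) |F| make the total at most
  \<epsilon>^2 |F|.\<close>

theorem properly_amenable_imp_foelner:
  assumes PA: "properly_amenable X d"
  shows "properly_foelner (uniform_roe X d)"
proof (rule properly_foelnerI)
  fix \<F> and \<epsilon> :: real assume \<F>: "finite \<F>" "\<F> \<subseteq> Roe" and \<epsilon>: "\<epsilon> > 0"
  define \<phi> where "\<phi> i T = T (ell2_delta (snd i)) (fst i)"
    for i :: "'a \<times> 'a" and T :: "('a \<Rightarrow> complex) \<Rightarrow> 'a \<Rightarrow> complex"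
  have \<phi>: "\<phi> i (T + T') = \<phi> i T + \<phi> i T'" "\<phi> i (k *\<^sub>C T) = k * \<phi> i T" for i T T' k
    by (simp_all add: \<phi>_def scaleC_complex_def)
  obtain J where J: "finite J" "J \<subseteq> X \<times> X"
    and J_sep: "\<forall>T\<in>cvs.span \<F>. (\<forall>j\<in>J. \<phi> j T = 0) \<longrightarrow> (\<forall>i\<in>X \<times> X. \<phi> i T = 0)"
    using finite_separating_set[of \<F> "X \<times> X" \<phi>, OF \<F>(1) \<phi>] by (elim exE conjE)
  have span_Roe: "T \<in> Roe" if "T \<in> cvs.span \<F>" for T
    using that cvs.span_minimal[OF \<F>(2) Roe_subspace] by blast
  \<comment> \<open>Pairs of \<open>J\<close> at infinite distance carry the entry 0 for every
    element of the Roe algebra, so testing those at finite distance suffices.\<close>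
  have sep: "T = 0" if T: "T \<in> cvs.span \<F>" and z: "\<And>x y. (x, y) \<in> J \<Longrightarrow> d x y < \<infinity> \<Longrightarrow> T (ell2_delta y) x = 0" for T
  proof -
    note TR = span_Roe[OF T]
    have j: "\<phi> j T = 0" if "j \<in> J" for j
    proof -
      obtain x y where xy: "j = (x, y)" by force
      show ?thesis
        using z[of x y] Roe_entry_infinite[OF TR, of x y] that J(2) unfolding xy \<phi>_def
        by (cases "d x y < \<infinity>") (auto simp flip: less_top)
    qed
    have ent: "T (ell2_delta y) x = 0" if "x \<in> X" "y \<in> X" for x y
      using J_sep[rule_format, OF T j, of "(x, y)"] that by (simp add: \<phi>_def)
    show ?thesis
    proof (rule BH_eqI[OF Roe_bounded[OF TR] ell2.bounded_op_zero])
      fix f x assume f: "f \<in> ell2 X" and x: "x \<in> X"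
      have "((\<lambda>y. f y * T (ell2_delta y) x) has_sum 0) X" using ent[OF x] by (intro has_sum_0) simp
      then show "T f x = 0 f x" using has_sum_unique[OF ell2_matrix[OF Roe_bounded[OF TR] f x]] by simp
    qed
  qed
  let ?G = "\<F> \<union> adj ` \<F>"
  have G: "finite ?G" "?G \<subseteq> Roe" using \<F> Roe_adj by auto
  define \<eta> where "\<eta> = \<epsilon>\<^sup>2 / 8"
  have \<eta>: "\<eta> > 0" using \<epsilon> by (simp add: \<eta>_def)
  obtain R and K L :: real where R: "R > 0" and K: "K \<ge> 0" and L: "L \<ge> 0"
    and col: "\<And>a x. a \<in> ?G \<Longrightarrow> x \<in> X \<Longrightarrow> (norm2 (a (ell2_delta x)))\<^sup>2 \<le> L"
    and bd: "\<And>a F. a \<in> ?G \<Longrightarrow> finite F \<Longrightarrow> F \<subseteq> X \<Longrightarrow>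
      (\<Sum>x\<in>F. (norm2 (\<lambda>x'. if x' \<in> F then 0 else a (ell2_delta x) x'))\<^sup>2)
        \<le> K * card (R_boundary X d R F) + \<eta> * card F"
    by (rule defect_bounds[OF G \<eta>]) (rule that)
  obtain c where c: "\<And>x. x \<in> X \<Longrightarrow> c x \<in> X" "\<And>x. x \<in> X \<Longrightarrow> d x (c x) < \<infinity>"
    "\<And>x y. x \<in> X \<Longrightarrow> y \<in> X \<Longrightarrow> d x y < \<infinity> \<Longrightarrow> c x = c y"
    by (rule component_representatives) (rule that)
  obtain n :: nat where n: "4 * card J * L / \<epsilon>\<^sup>2 < n" using reals_Archimedean2 by blast
  have entry0: "a (ell2_delta x) x' = 0" if "a \<in> Roe" "x \<in> X" "x' \<in> X" "\<not> d x' x < \<infinity>" for a x x'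
    using Roe_entry_infinite[OF that(1,3,2)] that(4) by (simp flip: less_top)
  show "\<exists>Y S. finite Y \<and> Y \<subseteq> X \<and> finite S \<and> S \<subseteq> fibre Y \<and> S \<noteq> {} \<and>
      (\<forall>a\<in>\<F>. (\<Sum>z\<in>S. defect S a z) + (\<Sum>z\<in>S. defect S (adj a) z) \<le> \<epsilon>\<^sup>2 * card S) \<and>
      (\<forall>a\<in>cvs.span \<F>. (\<forall>x y. (x, y) \<in> S \<longrightarrow> a (ell2_delta y) x = 0) \<longrightarrow> a = 0)"
  proof (cases "finite X")
    case True
    \<comment> \<open>For finite \<open>X\<close> all pairs at finite distance are taken: this set
      is invariant, so every defect vanishes, and it records every entry that can be
      nonzero.\<close>
    let ?S = "fibre X"
    have fin: "finite ?S" using True by (intro finite_subset[of ?S "X \<times> X"]) (auto simp: fibre_def)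
    obtain x where x: "x \<in> X" using PA unfolding properly_amenable_def
      by (metis all_not_in_conv finite.emptyI subset_empty zero_less_one)
    have "defect ?S a z = 0" if a: "a \<in> Roe" and z: "z \<in> ?S" for a z
    proof -
      obtain x y where xy: "z = (x, y)" "x \<in> X" "y \<in> X" "d x y < \<infinity>" using z by (auto simp: fibre_def)
      have aH: "a (ell2_delta x) \<in> ell2 X" by (rule ell2.bounded_opD(1)[OF Roe_bounded[OF a] ell2_delta_in[OF xy(2)]])
      have "a (ell2_delta x) x' = 0" if "(x', y) \<notin> ?S" for x'
      proof (cases "x' \<in> X")
        case x': True
        then have "\<not> d x' y < \<infinity>" using that xy by (simp add: fibre_def)
        then have "\<not> d x' x < \<infinity>" using finite_distance_trans[OF x' xy(2,3) _ xy(4)] by blast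
        then show ?thesis using entry0[OF a xy(2) x'] by blast
      qed (use aH in \<open>simp add: ell2_def\<close>)
      then have "(\<lambda>x'. if (x', snd z) \<in> ?S then 0 else a (ell2_delta (fst z)) x') = 0"
        by (auto simp: fun_eq_iff xy(1))
      then show ?thesis unfolding defect_def by simp
    qed
    then have "(\<Sum>z\<in>?S. defect ?S a z) = 0" if "a \<in> Roe" for a using that by (intro sum.neutral) simp
    then have "(\<Sum>z\<in>?S. defect ?S a z) + (\<Sum>z\<in>?S. defect ?S (adj a) z) \<le> \<epsilon>\<^sup>2 * card ?S" if "a \<in> \<F>" for a
      using \<F>(2) Roe_adj that by (simp add: subset_iff)
    moreover have "a = 0" if "a \<in> cvs.span \<F>" "\<forall>x y. (x, y) \<in> ?S \<longrightarrow> a (ell2_delta y) x = 0" for a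
      by (rule sep[OF that(1)]) (use that(2) J(2) in \<open>auto simp: fibre_def\<close>)
    moreover have "(x, x) \<in> ?S" using x by (simp add: fibre_def)
    ultimately have p: "?S \<noteq> {}"
        "\<forall>a\<in>\<F>. (\<Sum>z\<in>?S. defect ?S a z) + (\<Sum>z\<in>?S. defect ?S (adj a) z) \<le> \<epsilon>\<^sup>2 * card ?S"
        "(\<forall>a\<in>cvs.span \<F>. (\<forall>x y. (x, y) \<in> ?S \<longrightarrow> a (ell2_delta y) x = 0) \<longrightarrow> a = 0)"
      by blast+
    then show ?thesis
      by (intro exI[of _ X] exI[of _ ?S] conjI True fin order_refl p)
  next
    case inf: False
    obtain A where A: "finite A" "card A = Suc n" "A \<subseteq> X"
      using infinite_arbitrarily_large[OF inf] by blast
    \<comment> \<open>K + 1 avoids division by zero when K = 0.\<close>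
    have \<eta>K: "\<eta> / (K + 1) > 0" using \<eta> K by simp
    obtain F where F: "finite F" "F \<subseteq> X" "A \<subseteq> F"
      "real (card (R_boundary X d R F)) \<le> \<eta> / (K + 1) * real (card F)"
      using PA[unfolded properly_amenable_def, rule_format, OF R \<eta>K conjI[OF A(1,3)]]
      by (elim exE conjE)
    have nF: "n \<le> card F" "F \<noteq> {}" using card_mono[OF F(1,3)] A(2) F(3) by auto
    have KF: "K * card (R_boundary X d R F) \<le> \<eta> * card F"
    proof -
      have "K * card (R_boundary X d R F) \<le> (K + 1) * card (R_boundary X d R F)" by (simp add: algebra_simps)
      also have "\<dots> \<le> (K + 1) * (\<eta> / (K + 1) * card F)" using F(4) K by (intro mult_left_mono) auto
      also have "\<dots> = \<eta> * card F" using K by simp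
      finally show ?thesis .
    qed
    define S1 where "S1 = (\<lambda>x. (x, c x)) ` F"
    define S2 where "S2 = {z \<in> J. d (fst z) (snd z) < \<infinity>}"
    define S where "S = S1 \<union> S2"
    define Y where "Y = c ` F \<union> snd ` J"
    have Y: "finite Y" "Y \<subseteq> X" using F(1,2) J c(1) by (auto simp: Y_def)
    have S: "finite S1" "finite S2" "finite S" using F(1) J(1) by (simp_all add: S_def S1_def S2_def)
    have SY: "S \<subseteq> fibre Y"
    proof
      fix z assume "z \<in> S"
      then consider x where "x \<in> F" "z = (x, c x)" | "z \<in> J" "d (fst z) (snd z) < \<infinity>"
        by (auto simp: S_def S1_def S2_def)
      then show "z \<in> fibre Y"
      proof cases
        case 1
        then show ?thesis using F(2) c(2)[of x] by (auto simp: fibre_def Y_def)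
      next
        case 2
        then have "fst z \<in> X" "snd z \<in> Y" using J(2) by (auto simp: Y_def)
        then show ?thesis using 2(2) by (cases z) (simp add: fibre_def)
      qed
    qed
    have Sne: "S \<noteq> {}" using nF(2) by (simp add: S_def S1_def)
    have inj: "inj_on (\<lambda>x. (x, c x)) F" by (simp add: inj_on_def)
    have cardS: "card F \<le> card S"
      using card_image[OF inj] card_mono[OF S(3), of S1] by (simp add: S_def S1_def)
    have fstS: "fst z \<in> X" if "z \<in> S" for z using SY that by (auto simp: fibre_def)
    have est: "(\<Sum>z\<in>S. defect S a z) \<le> 2 * \<eta> * card F + card J * L" if a: "a \<in> ?G" for a
    proof -
      have aR: "a \<in> Roe" using a G(2) by blast
      have aH: "a (ell2_delta x) \<in> ell2 X" if "x \<in> X" for x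
        by (rule ell2.bounded_opD(1)[OF Roe_bounded[OF aR] ell2_delta_in[OF that]])
      have d0: "defect S a z \<ge> 0" for z by (simp add: defect_def)
      have d2: "defect S a z \<le> L" if z: "z \<in> S2" for z
      proof -
        have x: "fst z \<in> X" using fstS z by (simp add: S_def)
        have "defect S a z \<le> (norm2 (a (ell2_delta (fst z))))\<^sup>2"
          unfolding defect_def by (rule ell2_mono(2)[OF aH[OF x]]) (use aH[OF x] in \<open>simp_all add: ell2_def\<close>)
        then show ?thesis using col[OF a x] by linarith
      qed
      have d1: "defect S a (x, c x) \<le> (norm2 (\<lambda>x'. if x' \<in> F then 0 else a (ell2_delta x) x'))\<^sup>2"
        if x: "x \<in> F" for x
      proof -
        have xX: "x \<in> X" using x F by blast
        let ?g = "\<lambda>x'. if x' \<in> F then 0 else a (ell2_delta x) x'"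
        have g: "?g \<in> ell2 X"
          by (rule ell2_mono(1)[OF aH[OF xX]]) (use aH[OF xX] in \<open>simp_all add: ell2_def\<close>)
        \<comment> \<open>Points outside \<open>F\<close> agree on both sides. If x' lies in
          \<open>F\<close> but (x', c x) is missing from \<open>S\<close>, then c x' differs from c
          x, so x' and x lie in different components and the entry is 0.\<close>
        have le: "cmod (if (x', c x) \<in> S then 0 else a (ell2_delta x) x') \<le> cmod (?g x')" if x': "x' \<in> X" for x'
        proof (cases "x' \<in> F \<and> (x', c x) \<notin> S")
          case True
          then have "c x' \<noteq> c x" by (auto simp: S_def S1_def)
          then have "\<not> d x' x < \<infinity>" using c(3)[OF x' xX] by blast
          then show ?thesis using entry0[OF aR xX x'] by simp
        qed auto
        show ?thesis
          unfolding defect_def fst_conv snd_conv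
          by (rule ell2_mono(2)[OF g _ le]) (use aH[OF xX] in \<open>simp_all add: ell2_def\<close>)
      qed
      have "(\<Sum>z\<in>S. defect S a z) \<le> (\<Sum>z\<in>S1. defect S a z) + (\<Sum>z\<in>S2. defect S a z)"
        using sum.union_inter[OF S(1,2), of "defect S a"] sum_nonneg[of "S1 \<inter> S2" "defect S a"] d0
        by (simp add: S_def)
      also have "(\<Sum>z\<in>S1. defect S a z) = (\<Sum>x\<in>F. defect S a (x, c x))"
        unfolding S1_def by (simp add: sum.reindex[OF inj])
      also have "\<dots> \<le> (\<Sum>x\<in>F. (norm2 (\<lambda>x'. if x' \<in> F then 0 else a (ell2_delta x) x'))\<^sup>2)"
        by (rule sum_mono) (rule d1)
      also have "\<dots> \<le> K * card (R_boundary X d R F) + \<eta> * card F" by (rule bd[OF a F(1,2)])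
      also have "(\<Sum>z\<in>S2. defect S a z) \<le> card S2 * L"
        using sum_bounded_above[of S2 "defect S a" L] d2 by simp
      also have "card S2 * L \<le> card J * L"
        using L J(1) by (intro mult_right_mono) (auto simp: S2_def intro: card_mono)
      finally show ?thesis using KF by simp
    qed
    have JL: "card J * L \<le> \<epsilon>\<^sup>2 / 4 * card F"
    proof -
      have "4 * card J * L / \<epsilon>\<^sup>2 \<le> card F" using n nF(1) by linarith
      then show ?thesis using \<epsilon> by (simp add: field_simps)
    qed
    have "(\<Sum>z\<in>S. defect S a z) + (\<Sum>z\<in>S. defect S (adj a) z) \<le> \<epsilon>\<^sup>2 * card S" if a: "a \<in> \<F>" for a
    proof -
      have "(\<Sum>z\<in>S. defect S a z) + (\<Sum>z\<in>S. defect S (adj a) z) \<le> 4 * \<eta> * card F + 2 * (card J * L)"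
        using est[of a] est[of "adj a"] a by simp
      also have "\<dots> \<le> \<epsilon>\<^sup>2 * card F" using JL by (simp add: \<eta>_def)
      also have "\<dots> \<le> \<epsilon>\<^sup>2 * card S" using cardS by (intro mult_left_mono) auto
      finally show ?thesis .
    qed
    moreover have "a = 0" if "a \<in> cvs.span \<F>" "\<forall>x y. (x, y) \<in> S \<longrightarrow> a (ell2_delta y) x = 0" for a
      by (rule sep[OF that(1)]) (use that(2) in \<open>simp add: S_def S2_def\<close>)
    ultimately have p: "\<forall>a\<in>\<F>. (\<Sum>z\<in>S. defect S a z) + (\<Sum>z\<in>S. defect S (adj a) z) \<le> \<epsilon>\<^sup>2 * card S"
        "(\<forall>a\<in>cvs.span \<F>. (\<forall>x y. (x, y) \<in> S \<longrightarrow> a (ell2_delta y) x = 0) \<longrightarrow> a = 0)"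
      by blast+
    then show ?thesis
      by (intro exI[of _ Y] exI[of _ S] conjI Y S(3) SY Sne p)
  qed
qed

end

theorem theorem4p12:
  fixes X :: "'a set" and d :: "'a \<Rightarrow> 'a \<Rightarrow> ennreal"
  assumes "ext_metric_space X d" and "bounded_geometry X d"
  shows "(properly_amenable X d \<longleftrightarrow> properly_alg_amenable (alg_uniform_roe X d)) \<and>
         (properly_alg_amenable (alg_uniform_roe X d) \<longleftrightarrow> properly_foelner (uniform_roe X d))"
proof -
  interpret bounded_geometry_space X d
    using assms by (simp add: bounded_geometry_space_def bounded_geometry_space_axioms_def)
  show ?thesis
    using properly_amenable_imp_alg alg_imp_properly_amenable
      properly_amenable_imp_foelner foelner_imp_properly_amenable by blast
qed

end
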